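(* Let $\mathcal{H}$ be a family of finite simple graphs which satisfies the following two conditions. (i) For every graph $G\in\mathcal{H}$ and every vertex $x\in V(G)$, the graph $G\setminus N_G[x]$ belongs to $\mathcal{H}$. (ii) If $G\in\mathcal{H}$ has no isolated vertex, then $G$ admits a minimal vertex cover of cardinality at least $\frac{|V(G)|}{2}$. Then for every graph $G\in\mathcal{H}$ with $V(G)\neq\emptyset$ and every integer $k\geq 1$, $$k\deg(J(G))\leq \mathrm{reg}(J(G)^{(k)})\leq (k-1)\deg(J(G))+|V(G)|-1.$$
   Context: All graphs are finite and simple. $N_G(x)$ is the set of neighbors of $x$ in $G$ and $N_G[x]=N_G(x)\cup\{x\}$. For $A\subseteq V(G)$, $G\setminus A$ is the graph with vertex set $V(G)\setminus A$ and edge set $\{e\in E(G)\mid e\cap A=\emptyset\}$ (it may be the graph with no vertices). A vertex cover of $G$ is a subset $C\subseteq V(G)$ meeting every edge of $G$; it is minimal if no proper subset of it is a vertex cover. Let $G$ be a graph with vertex set $\{x_1,\ldots,x_n\}$, let $\mathbb{K}$ be a field and $S=\mathbb{K}[x_1,\ldots,x_n]$ (vertices are identified with variables). The cover ideal of $G$ is $$J(G)=\Big(\prod_{x_i\in C}x_i \;\Big|\; C\text{ a minimal vertex cover of }G\Big)=\bigcap_{\{x_i,x_j\}\in E(G)}(x_i,x_j)\subseteq S,$$ and its $k$-th symbolic power is $J(G)^{(k)}=\bigcap_{\{x_i,x_j\}\in E(G)}(x_i,x_j)^k$ (an empty intersection is $S$). For a nonzero monomial ideal $I$, $\deg(I)$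 is the maximum degree of a minimal monomial generator of $I$; thus $\deg(J(G))$ is the largest cardinality of a minimal vertex cover of $G$. For a nonzero homogeneous ideal $I\subseteq S$ with graded Betti numbers $\beta_{i,j}(I)$ (from the minimal graded free resolution $\cdots\to\bigoplus_jS(-j)^{\beta_{1,j}(I)}\to\bigoplus_jS(-j)^{\beta_{0,j}(I)}\to I\to 0$ of $I$), the Castelnuovo–Mumford regularity is $\mathrm{reg}(I)=\max\{j-i\mid \beta_{i,j}(I)\neq 0\}$. *)

theory Defs
  imports
    Complex_Main
    "HOL-Library.Poly_Mapping"
    "HOL-Algebra.Ideal_Product"
    "Jordan_Normal_Form.Matrix"
begin

section \<open>Finite simple graphs\<close>

record 'a ugraph =
  verts :: "'a set"
  edges :: "'a set set"

definition finite_simple_graph :: "'a ugraph \<Rightarrow> bool" where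
  "finite_simple_graph G \<longleftrightarrow>
     finite (verts G) \<and> (\<forall>e \<in> edges G. e \<subseteq> verts G \<and> card e = 2)"

definition nbhd :: "'a ugraph \<Rightarrow> 'a \<Rightarrow> 'a set" where
  "nbhd G x = {y \<in> verts G. {x, y} \<in> edges G}"

definition closed_nbhd :: "'a ugraph \<Rightarrow> 'a \<Rightarrow> 'a set" where
  "closed_nbhd G x = nbhd G x \<union> {x}"

definition delete_verts :: "'a ugraph \<Rightarrow> 'a set \<Rightarrow> 'a ugraph" where
  "delete_verts G A = \<lparr>verts = verts G - A, edges = {e \<in> edges G. e \<inter> A = {}}\<rparr>"

definition isolated_vertex :: "'a ugraph \<Rightarrow> 'a \<Rightarrow> bool" where
  "isolated_vertex G x \<longleftrightarrow> x \<in> verts G \<and> nbhd G x = {}"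

definition vertex_cover :: "'a ugraph \<Rightarrow> 'a set \<Rightarrow> bool" where
  "vertex_cover G C \<longleftrightarrow> C \<subseteq> verts G \<and> (\<forall>e \<in> edges G. e \<inter> C \<noteq> {})"

definition minimal_vertex_cover :: "'a ugraph \<Rightarrow> 'a set \<Rightarrow> bool" where
  "minimal_vertex_cover G C \<longleftrightarrow> vertex_cover G C \<and> (\<forall>C'. C' \<subset> C \<longrightarrow> \<not> vertex_cover G C')"


section \<open>The polynomial ring with a given set of variables\<close>

text \<open>
  A monomial is its exponent vector, of type \<open>'a \<Rightarrow>\<^sub>0 nat\<close>; a polynomial assigns a coefficient
  to each monomial, and multiplication on \<open>('a \<Rightarrow>\<^sub>0 nat) \<Rightarrow>\<^sub>0 'k\<close> is convolution.  That type
  has every element of \<open>'a\<close> as a variable; the carrier below restricts the variables to \<open>V\<close>.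
\<close>

type_synonym ('a, 'k) mpoly = "('a \<Rightarrow>\<^sub>0 nat) \<Rightarrow>\<^sub>0 'k"

definition monoms :: "'a set \<Rightarrow> ('a \<Rightarrow>\<^sub>0 nat) set" where
  "monoms V = {m. Poly_Mapping.keys m \<subseteq> V}"

definition mpoly_ring :: "'a set \<Rightarrow> ('a, 'k::field) mpoly ring" where
  "mpoly_ring V =
     \<lparr>carrier = {p. Poly_Mapping.keys p \<subseteq> monoms V},
      monoid.mult = (*), one = 1, zero = 0, add = (+)\<rparr>"

definition monom_poly :: "('a \<Rightarrow>\<^sub>0 nat) \<Rightarrow> ('a, 'k::field) mpoly" where
  "monom_poly m = Poly_Mapping.single m 1"

definition var :: "'a \<Rightarrow> ('a, 'k::field) mpoly" where
  "var x = monom_poly (Poly_Mapping.single x 1)"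

definition monom_degree :: "('a \<Rightarrow>\<^sub>0 nat) \<Rightarrow> nat" where
  "monom_degree m = (\<Sum>x \<in> Poly_Mapping.keys m. Poly_Mapping.lookup m x)"

definition homogeneous_part :: "'a set \<Rightarrow> int \<Rightarrow> ('a, 'k::field) mpoly set" where
  "homogeneous_part V j =
     {p \<in> carrier (mpoly_ring V). \<forall>m \<in> Poly_Mapping.keys p. int (monom_degree m) = j}"

definition irrelevant_ideal :: "'a set \<Rightarrow> ('a, 'k::field) mpoly set" where
  "irrelevant_ideal V = Idl\<^bsub>mpoly_ring V\<^esub> (var ` V)"


section \<open>Cover ideals and their symbolic powers\<close>

definition cover_ideal :: "'a ugraph \<Rightarrow> ('a, 'k::field) mpoly set" where
  "cover_ideal G =
     Idl\<^bsub>mpoly_ring (verts G)\<^esub> {\<Prod>x\<in>C. var x | C. minimal_vertex_cover G C}"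

text \<open>
  For an edge \<open>e = {x, y}\<close> the ideal generated by \<open>var ` e\<close> is \<open>(x, y)\<close>; its powers are
  taken in the semiring of ideals.  The intersection with the carrier matters only for
  graphs without edges.
\<close>

definition cover_ideal_symbolic_power :: "'a ugraph \<Rightarrow> nat \<Rightarrow> ('a, 'k::field) mpoly set" where
  "cover_ideal_symbolic_power G k =
     carrier (mpoly_ring (verts G)) \<inter>
     (\<Inter>e \<in> edges G. (Idl\<^bsub>mpoly_ring (verts G)\<^esub> (var ` e)) [^]\<^bsub>ideals_set (mpoly_ring (verts G))\<^esub> k)"


section \<open>The degree of a monomial ideal\<close>

definition minimal_monomial_generating_set ::
  "'a set \<Rightarrow> ('a, 'k::field) mpoly set \<Rightarrow> ('a \<Rightarrow>\<^sub>0 nat) set \<Rightarrow> bool" where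
  "minimal_monomial_generating_set V I M \<longleftrightarrow>
     M \<subseteq> monoms V \<and> Idl\<^bsub>mpoly_ring V\<^esub> (monom_poly ` M) = I \<and>
     (\<forall>M'. M' \<subset> M \<longrightarrow> Idl\<^bsub>mpoly_ring V\<^esub> (monom_poly ` M') \<noteq> I)"

text \<open>Only meaningful for nonzero monomial ideals, where the maximum is over a finite nonempty set.\<close>

definition ideal_degree :: "'a set \<Rightarrow> ('a, 'k::field) mpoly set \<Rightarrow> nat" where
  "ideal_degree V I =
     Max {monom_degree m | m. \<exists>M. minimal_monomial_generating_set V I M \<and> m \<in> M}"


section \<open>Minimal graded free resolutions and regularity\<close>

text \<open>
  Write \<open>S\<close> for \<open>mpoly_ring V\<close>.  A list \<open>[j\<^sub>1, \<dots>, j\<^sub>r]\<close> of integers stands for the graded free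
  module \<open>S(-j\<^sub>1) \<oplus> \<dots> \<oplus> S(-j\<^sub>r)\<close>, whose underlying module is \<open>free_module V r\<close> and whose
  basis elements have degrees \<open>j\<^sub>1, \<dots>, j\<^sub>r\<close>.
\<close>

definition free_module :: "'a set \<Rightarrow> nat \<Rightarrow> ('a, 'k::field) mpoly vec set" where
  "free_module V r = {v \<in> carrier_vec r. \<forall>a < r. v $ a \<in> carrier (mpoly_ring V)}"

text \<open>Matrices of degree-preserving \<open>S\<close>-linear maps from the module with shifts \<open>src\<close> to the
  one with shifts \<open>tgt\<close>.\<close>

definition graded_map :: "'a set \<Rightarrow> int list \<Rightarrow> int list \<Rightarrow> ('a, 'k::field) mpoly mat \<Rightarrow> bool" where
  "graded_map V src tgt A \<longleftrightarrow>
     A \<in> carrier_mat (length tgt) (length src) \<and>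
     (\<forall>a < length tgt. \<forall>b < length src. A $$ (a, b) \<in> homogeneous_part V (src ! b - tgt ! a))"

text \<open>
  The shifts \<open>d i\<close> give the module \<open>F\<^sub>i\<close>, and \<open>D (Suc i)\<close> is the differential from \<open>F\<^sub>i\<^sub>+\<^sub>1\<close> to
  \<open>F\<^sub>i\<close>.  The augmentation \<open>D 0\<close> from \<open>F\<^sub>0\<close> onto \<open>I\<close> is given as a map into \<open>S\<close>, a free module
  of rank one with shift \<open>0\<close>, with image \<open>I\<close>.  Minimality says that the differentials, but not
  necessarily the augmentation, have entries in the irrelevant maximal ideal.
\<close>

definition minimal_graded_free_resolution ::
  "'a set \<Rightarrow> ('a, 'k::field) mpoly set \<Rightarrow> (nat \<Rightarrow> int list) \<Rightarrow> (nat \<Rightarrow> ('a, 'k) mpoly mat) \<Rightarrow> bool"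
  where
  "minimal_graded_free_resolution V I d D \<longleftrightarrow>
     graded_map V (d 0) [0] (D 0) \<and>
     (\<forall>i. graded_map V (d (Suc i)) (d i) (D (Suc i))) \<and>
     (\<lambda>v. D 0 *\<^sub>v v) ` free_module V (length (d 0)) = {w \<in> free_module V 1. w $ 0 \<in> I} \<and>
     (\<forall>i. (\<lambda>v. D (Suc i) *\<^sub>v v) ` free_module V (length (d (Suc i))) =
          {w \<in> free_module V (length (d i)). D i *\<^sub>v w = 0\<^sub>v (dim_row (D i))}) \<and>
     (\<forall>i. \<forall>a < length (d i). \<forall>b < length (d (Suc i)).
          D (Suc i) $$ (a, b) \<in> irrelevant_ideal V)"

text \<open>
  A minimal graded free resolution of a homogeneous ideal exists and is unique up to isomorphism
  of graded complexes, so the choice made here does not affect the Betti numbers.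
\<close>

definition graded_betti :: "'a set \<Rightarrow> ('a, 'k::field) mpoly set \<Rightarrow> nat \<Rightarrow> int \<Rightarrow> nat" where
  "graded_betti V I i j =
     count_list ((SOME d. \<exists>D. minimal_graded_free_resolution V I d D) i) j"

text \<open>Only meaningful for nonzero homogeneous ideals in finitely many variables.\<close>

definition regularity :: "'a set \<Rightarrow> ('a, 'k::field) mpoly set \<Rightarrow> int" where
  "regularity V I = Max {j - int i | i j. graded_betti V I i j \<noteq> 0}"

end

theory Submission
  imports Defs
begin

text \<open>
  The lower bound holds because \<open>(\<Prod>x\<in>C. x)\<^sup>k\<close> is a minimal generator of \<open>J(G)\<^sup>(\<^sup>k\<^sup>)\<close> for every
  minimal vertex cover \<open>C\<close>.

  For the upper bound, let \<open>I\<close> be a monomial ideal, \<open>x\<close> a variable and \<open>I\<^sub>0\<close> the ideal generated by the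
  monomials of \<open>I\<close> without \<open>x\<close>.  The exact sequence
  \<open>0 \<rightarrow> I\<^sub>0(-1) \<rightarrow> I\<^sub>0 \<oplus> (I : x)(-1) \<rightarrow> I \<rightarrow> 0\<close> and a mapping cone give
  \<open>reg I \<le> max (reg I\<^sub>0) (reg (I : x) + 1)\<close>.  This is applied to \<open>I = J(G)\<^sup>(\<^sup>k\<^sup>) : \<Prod>y\<in>A. y\<close>
  for a growing set \<open>A\<close> of vertices.  The ideal \<open>I\<^sub>0\<close> is a monomial times an ideal of the same kind for
  \<open>G \<setminus> N[x]\<close>.  Once \<open>A\<close> is the whole vertex set, \<open>I = J(G)\<^sup>(\<^sup>k\<^sup>-\<^sup>2\<^sup>)\<close>, because every edge has two
  ends, and the \<open>|V(G)|\<close> steps are paid for by \<open>|V(G)| \<le> 2 deg J(G)\<close>.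

  The bound concerns an arbitrary minimal resolution, whereas the cones need not be minimal.  In a
  comparison of the two, the composite on the minimal one is the identity modulo the irrelevant
  ideal, so its shifts occur among those of the other.  The same comparison shows that the syzygy
  modules are finitely generated, so that a minimal resolution exists.
\<close>

section \<open>Monomials and polynomials\<close>

text \<open>The bound carried along is (k-1) deg J(G) + |V(G)| - 1 - |A|. Each vertex added to
  \<open>A\<close> lowers it by one, as the summand 1 in reg (I : x) + 1 requires. For full
  \<open>A\<close> it has thus fallen by |V(G)|, whereas restarting with k-2 and empty
  \<open>A\<close> lowers it by 2 deg J(G), and |V(G)| \<le> 2 deg J(G) closes the loop. That
  inequality is condition (ii), available only without isolated vertices, which are therefore
  deleted beforehand by condition (i). When \<open>x\<close> is split off, the monomial factor has
  degree about k |N(x)|; this is affordable since N(x) together with a minimal cover of the graph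
  left over is a minimal cover of G. The ring keeps all its variables while the graph shrinks, so no
  change of rings occurs.

  \<open>regularity\<close> is a maximum over one chosen minimal resolution, so the existence of
  such a resolution and the finiteness of the set under the maximum are obligations of the proof.
  Upper bounds are propagated as the existence of some resolution with small shifts, and only at the
  end is it compared with the chosen one.\<close>

lemma poly_mapping_sum_single:
  "(\<Sum>m\<in>Poly_Mapping.keys p. Poly_Mapping.single m (Poly_Mapping.lookup p m)) = p"
  by (rule poly_mapping_eqI)
     (simp add: lookup_sum lookup_single when_def sum.delta' in_keys_iff)

lemma monom_degree_eq_sum:
  "finite A \<Longrightarrow> Poly_Mapping.keys m \<subseteq> A \<Longrightarrow> monom_degree m = (\<Sum>x\<in>A. Poly_Mapping.lookup m x)"
  unfolding monom_degree_def by (rule sum.mono_neutral_left) (auto simp: in_keys_iff)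

lemma monom_degree_add: "monom_degree (a + b) = monom_degree a + monom_degree b"
proof -
  let ?A = "Poly_Mapping.keys a \<union> Poly_Mapping.keys b"
  have "Poly_Mapping.keys (a + b) \<subseteq> ?A" by (rule keys_add)
  then show ?thesis
    by (simp add: monom_degree_eq_sum[of ?A] lookup_add sum.distrib)
qed

lemma monom_degree_0 [simp]: "monom_degree 0 = 0"
  by (simp add: monom_degree_def)

lemma monom_degree_single [simp]: "monom_degree (Poly_Mapping.single x n) = n"
  by (simp add: monom_degree_def)

lemma monom_degree_eq_0_iff: "monom_degree m = 0 \<longleftrightarrow> m = 0"
  by (auto simp: monom_degree_def in_keys_iff intro!: poly_mapping_eqI)

lemma keys_add_nat:
  fixes a b :: "'a \<Rightarrow>\<^sub>0 nat"
  shows "Poly_Mapping.keys (a + b) = Poly_Mapping.keys a \<union> Poly_Mapping.keys b"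
  by (auto simp: in_keys_iff lookup_add)

lemma monoms_add_iff: "a + b \<in> monoms V \<longleftrightarrow> a \<in> monoms V \<and> b \<in> monoms V"
  by (auto simp: monoms_def keys_add_nat)

lemma zero_in_monoms [simp]: "0 \<in> monoms V"
  by (simp add: monoms_def)

lemma single_in_monoms: "x \<in> V \<Longrightarrow> Poly_Mapping.single x n \<in> monoms V"
  by (simp add: monoms_def)

text \<open>The polynomials supported on \<open>U\<close>. Every ideal of the proof has this form,
  so questions about ideals become questions about sets of exponent vectors;
  \<open>U = monoms V\<close> gives the ring itself.\<close>

definition mono_ideal :: "('a \<Rightarrow>\<^sub>0 nat) set \<Rightarrow> ('a, 'k::field) mpoly set" where
  "mono_ideal U = {p. Poly_Mapping.keys p \<subseteq> U}"

lemma carrier_mpoly_ring: "carrier (mpoly_ring V) = mono_ideal (monoms V)"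
  by (simp add: mpoly_ring_def mono_ideal_def)

lemma mono_ideal_zero [simp]: "0 \<in> mono_ideal U"
  by (simp add: mono_ideal_def)

lemma mono_ideal_add: "p \<in> mono_ideal U \<Longrightarrow> q \<in> mono_ideal U \<Longrightarrow> p + q \<in> mono_ideal U"
  using keys_add[of p q] by (auto simp: mono_ideal_def)

lemma mono_ideal_uminus [simp]: "- p \<in> mono_ideal U \<longleftrightarrow> p \<in> mono_ideal U"
  by (auto simp: mono_ideal_def in_keys_iff subset_iff)

lemma mono_ideal_diff: "p \<in> mono_ideal U \<Longrightarrow> q \<in> mono_ideal U \<Longrightarrow> p - q \<in> mono_ideal U"
  using mono_ideal_add[of p U "- q"] by simp

lemma mono_ideal_sum: "(\<And>i. i \<in> A \<Longrightarrow> f i \<in> mono_ideal U) \<Longrightarrow> sum f A \<in> mono_ideal U"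
  by (induction A rule: infinite_finite_induct) (auto intro: mono_ideal_add)

lemma mono_ideal_mult:
  assumes "p \<in> mono_ideal U" "q \<in> mono_ideal W"
    and "\<And>a b. a \<in> U \<Longrightarrow> b \<in> W \<Longrightarrow> a + b \<in> X"
  shows "p * q \<in> mono_ideal X"
  using assms keys_mult[of p q] unfolding mono_ideal_def by blast

lemma mono_ideal_single: "m \<in> U \<Longrightarrow> Poly_Mapping.single m c \<in> mono_ideal U"
  by (simp add: mono_ideal_def)

lemma mono_ideal_mono: "U \<subseteq> W \<Longrightarrow> mono_ideal U \<subseteq> mono_ideal W"
  by (auto simp: mono_ideal_def)

lemma homogeneous_part_iff:
  "p \<in> homogeneous_part V j \<longleftrightarrow> p \<in> mono_ideal {m \<in> monoms V. int (monom_degree m) = j}"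
  by (auto simp: homogeneous_part_def mpoly_ring_def mono_ideal_def)

lemma homogeneous_zero [simp]: "0 \<in> homogeneous_part V j"
  by (simp add: homogeneous_part_iff)

lemma homogeneous_add:
  "p \<in> homogeneous_part V j \<Longrightarrow> q \<in> homogeneous_part V j \<Longrightarrow> p + q \<in> homogeneous_part V j"
  by (simp add: homogeneous_part_iff mono_ideal_add)

lemma homogeneous_uminus [simp]: "- p \<in> homogeneous_part V j \<longleftrightarrow> p \<in> homogeneous_part V j"
  by (simp add: homogeneous_part_iff)

lemma homogeneous_diff:
  "p \<in> homogeneous_part V j \<Longrightarrow> q \<in> homogeneous_part V j \<Longrightarrow> p - q \<in> homogeneous_part V j"
  by (simp add: homogeneous_part_iff mono_ideal_diff)

lemma homogeneous_sum:
  "(\<And>i. i \<in> A \<Longrightarrow> f i \<in> homogeneous_part V j) \<Longrightarrow> sum f A \<in> homogeneous_part V j"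
  by (simp add: homogeneous_part_iff mono_ideal_sum)

lemma homogeneous_mult:
  assumes "p \<in> homogeneous_part V i" "q \<in> homogeneous_part V j"
  shows "p * q \<in> homogeneous_part V (i + j)"
  using assms unfolding homogeneous_part_iff
  by (rule mono_ideal_mult) (auto simp: monoms_add_iff monom_degree_add)

lemma homogeneous_single:
  "m \<in> monoms V \<Longrightarrow> j = int (monom_degree m) \<Longrightarrow> Poly_Mapping.single m c \<in> homogeneous_part V j"
  by (simp add: homogeneous_part_iff mono_ideal_single)

lemma homogeneous_one [simp]: "1 \<in> homogeneous_part V 0"
  using homogeneous_single[of 0 V 0 1] by simp

lemma homogeneous_var: "x \<in> V \<Longrightarrow> var x \<in> homogeneous_part V 1"
  unfolding var_def monom_poly_def by (rule homogeneous_single) (auto simp: single_in_monoms)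

lemma homogeneous_carrier: "p \<in> homogeneous_part V j \<Longrightarrow> p \<in> carrier (mpoly_ring V)"
  by (simp add: homogeneous_part_def)

section \<open>Multiplication by a monomial\<close>

lemma lookup_single_mult:
  fixes p :: "('a, 'k::field) mpoly"
  shows "Poly_Mapping.lookup (Poly_Mapping.single t c * p) (t + m) = c * Poly_Mapping.lookup p m"
proof -
  have *: "t + m = t + q \<longleftrightarrow> q = m" for q by auto
  have "Poly_Mapping.lookup (Poly_Mapping.single t c * p) (t + m) =
      Sum_any (\<lambda>l. (c when t = l) * Sum_any (\<lambda>q. Poly_Mapping.lookup p q when t + m = l + q))"
    by (simp add: lookup_mult lookup_single)
  also have "\<dots> = Sum_any (\<lambda>l. (c * Sum_any (\<lambda>q. Poly_Mapping.lookup p q when t + m = l + q)) when l = t)"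
    by (rule Sum_any.cong) (auto simp: when_def)
  also have "\<dots> = c * Sum_any (\<lambda>q. Poly_Mapping.lookup p q when t + m = t + q)" by simp
  finally show ?thesis unfolding * by simp
qed

lemma keys_monom_mult:
  fixes p :: "('a, 'k::field) mpoly"
  shows "Poly_Mapping.keys (monom_poly t * p) = (+) t ` Poly_Mapping.keys p"
proof
  show "Poly_Mapping.keys (monom_poly t * p) \<subseteq> (+) t ` Poly_Mapping.keys p"
    using keys_mult[of "monom_poly t" p] by (auto simp: monom_poly_def)
  show "(+) t ` Poly_Mapping.keys p \<subseteq> Poly_Mapping.keys (monom_poly t * p)"
    by (auto simp: monom_poly_def in_keys_iff lookup_single_mult)
qed

text \<open>Translation by \<open>t\<close> is injective on exponents, so nothing cancels. That
  monomials are nonzerodivisors is used for translated resolutions and for the exactness of the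
  cone.\<close>

lemma monom_mult_eq_0_iff:
  fixes p :: "('a, 'k::field) mpoly"
  shows "monom_poly t * p = 0 \<longleftrightarrow> p = 0"
proof
  assume "monom_poly t * p = 0"
  then have "Poly_Mapping.keys p = {}" using keys_monom_mult[of t p] by simp
  then show "p = 0" by (auto intro!: poly_mapping_eqI simp: in_keys_iff)
qed simp

lemma monom_poly_mult: "monom_poly (a + b) = monom_poly a * monom_poly b"
  by (simp add: monom_poly_def mult_single)

lemma monom_dvd_poly:
  fixes p :: "('a, 'k::field) mpoly"
  assumes "\<And>m. m \<in> Poly_Mapping.keys p \<Longrightarrow> \<exists>m'. m = t + m'"
  obtains q where "p = monom_poly t * q"
proof
  have "monom_poly t * (\<Sum>m\<in>Poly_Mapping.keys p. Poly_Mapping.single (m - t) (Poly_Mapping.lookup p m))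
      = (\<Sum>m\<in>Poly_Mapping.keys p. Poly_Mapping.single m (Poly_Mapping.lookup p m))"
    unfolding sum_distrib_left
    by (rule sum.cong) (use assms in \<open>force simp: monom_poly_def mult_single\<close>)+
  then show "p = monom_poly t * (\<Sum>m\<in>Poly_Mapping.keys p. Poly_Mapping.single (m - t) (Poly_Mapping.lookup p m))"
    by (simp add: poly_mapping_sum_single)
qed

text \<open>Used with two kinds of predicate: a fixed degree, for homogeneous components, and the
  absence of a variable, for splitting off the part of an ideal without \<open>x\<close>.\<close>

definition monom_filter ::
  "(('a \<Rightarrow>\<^sub>0 nat) \<Rightarrow> bool) \<Rightarrow> ('a, 'k::field) mpoly \<Rightarrow> ('a, 'k) mpoly" where
  "monom_filter P p = (\<Sum>m\<in>{m \<in> Poly_Mapping.keys p. P m}. Poly_Mapping.single m (Poly_Mapping.lookup p m))"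

lemma lookup_monom_filter:
  "Poly_Mapping.lookup (monom_filter P p) m = (if P m then Poly_Mapping.lookup p m else 0)"
  by (auto simp: monom_filter_def lookup_sum lookup_single when_def sum.delta' in_keys_iff)

lemma keys_monom_filter:
  "Poly_Mapping.keys (monom_filter P p) = {m \<in> Poly_Mapping.keys p. P m}"
  by (auto simp: in_keys_iff lookup_monom_filter split: if_splits)

lemma monom_filter_add: "monom_filter P (p + q) = monom_filter P p + monom_filter P q"
  by (rule poly_mapping_eqI) (simp add: lookup_monom_filter lookup_add)

lemma monom_filter_0 [simp]: "monom_filter P 0 = 0"
  by (rule poly_mapping_eqI) (simp add: lookup_monom_filter)

lemma monom_filter_sum: "monom_filter P (sum f A) = (\<Sum>i\<in>A. monom_filter P (f i))"
  by (induction A rule: infinite_finite_induct) (auto simp: monom_filter_add)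

lemma monom_filter_split: "monom_filter P p + monom_filter (\<lambda>m. \<not> P m) p = p"
  by (rule poly_mapping_eqI) (simp add: lookup_monom_filter lookup_add)

section \<open>Homogeneous components and constant coefficients\<close>

definition hom_comp :: "int \<Rightarrow> ('a, 'k::field) mpoly \<Rightarrow> ('a, 'k) mpoly" where
  "hom_comp j = monom_filter (\<lambda>m. int (monom_degree m) = j)"

text \<open>Multiplication by a form of degree \<open>i\<close> raises all degrees by
  \<open>i\<close>: the component of \<open>p\<close> in degree \<open>j - i\<close> lands in degree
  \<open>j\<close>, and the remaining terms cannot reach it.\<close>

lemma hom_comp_mult:
  assumes q: "q \<in> homogeneous_part V i"
  shows "hom_comp j (q * p) = q * hom_comp (j - i) p"
proof -
  define a where "a = hom_comp (j - i) p"
  define b where "b = monom_filter (\<lambda>m. \<not> int (monom_degree m) = j - i) p"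
  have p: "p = a + b" unfolding a_def b_def hom_comp_def by (simp add: monom_filter_split)
  have "\<forall>m\<in>Poly_Mapping.keys (q * a). int (monom_degree m) = j"
    using keys_mult[of q a] q
    by (fastforce simp: a_def hom_comp_def keys_monom_filter monom_degree_add homogeneous_part_def)
  then have 1: "hom_comp j (q * a) = q * a"
    by (intro poly_mapping_eqI) (auto simp: hom_comp_def lookup_monom_filter in_keys_iff)
  have "\<forall>m\<in>Poly_Mapping.keys (q * b). int (monom_degree m) \<noteq> j"
    using keys_mult[of q b] q
    by (fastforce simp: b_def keys_monom_filter monom_degree_add homogeneous_part_def)
  then have 2: "hom_comp j (q * b) = 0"
    by (intro poly_mapping_eqI) (auto simp: hom_comp_def lookup_monom_filter in_keys_iff)
  have "hom_comp j (q * p) = hom_comp j (q * a) + hom_comp j (q * b)"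
    unfolding p by (simp add: distrib_left hom_comp_def monom_filter_add)
  then show ?thesis by (simp add: 1 2) (simp add: a_def)
qed

lemma hom_comp_homogeneous:
  "p \<in> carrier (mpoly_ring V) \<Longrightarrow> hom_comp j p \<in> homogeneous_part V j"
  by (auto simp: homogeneous_part_def mpoly_ring_def hom_comp_def keys_monom_filter)

lemma hom_comp_id: "p \<in> homogeneous_part V j \<Longrightarrow> hom_comp j p = p"
  by (intro poly_mapping_eqI)
     (auto simp: homogeneous_part_def hom_comp_def lookup_monom_filter in_keys_iff)

lemma sum_hom_comp:
  assumes "finite J" "\<And>m. m \<in> Poly_Mapping.keys p \<Longrightarrow> int (monom_degree m) \<in> J"
  shows "(\<Sum>j\<in>J. hom_comp j p) = p"
proof (rule poly_mapping_eqI)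
  fix m
  show "Poly_Mapping.lookup (\<Sum>j\<in>J. hom_comp j p) m = Poly_Mapping.lookup p m"
    using assms by (cases "m \<in> Poly_Mapping.keys p")
      (auto simp: hom_comp_def lookup_sum lookup_monom_filter in_keys_iff)
qed

lemma homogeneous_neg: "j < 0 \<Longrightarrow> p \<in> homogeneous_part V j \<Longrightarrow> p = 0"
  by (rule poly_mapping_eqI) (auto simp: homogeneous_part_def in_keys_iff)

lemma homogeneous_degree_0:
  assumes "p \<in> homogeneous_part V 0"
  shows "p = Poly_Mapping.single 0 (Poly_Mapping.lookup p 0)"
proof (rule poly_mapping_eqI)
  fix m
  show "Poly_Mapping.lookup p m = Poly_Mapping.lookup (Poly_Mapping.single 0 (Poly_Mapping.lookup p 0)) m"
    using assms by (cases "m = 0")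
      (auto simp: homogeneous_part_def lookup_single in_keys_iff monom_degree_eq_0_iff)
qed

text \<open>A sum of two exponent vectors is zero only if both are, so no other pair of terms
  contributes. Taking the constant coefficient is reduction modulo the irrelevant ideal.\<close>

lemma const_coeff_mult:
  fixes p q :: "('a, 'k::field) mpoly"
  shows "Poly_Mapping.lookup (p * q) 0 = Poly_Mapping.lookup p 0 * Poly_Mapping.lookup q 0"
proof -
  have z: "0 = a + b \<longleftrightarrow> a = 0 \<and> b = 0" for a b :: "'a \<Rightarrow>\<^sub>0 nat"
    by (auto simp: poly_mapping_eq_iff lookup_add fun_eq_iff)
  have "Poly_Mapping.lookup (p * q) 0 =
      Sum_any (\<lambda>l. Poly_Mapping.lookup p l * Sum_any (\<lambda>r. Poly_Mapping.lookup q r when 0 = l + r))"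
    by (simp add: lookup_mult)
  also have "\<dots> = Sum_any (\<lambda>l. (Poly_Mapping.lookup p l * Sum_any (\<lambda>r. Poly_Mapping.lookup q r when r = 0)) when l = 0)"
    by (rule Sum_any.cong) (simp add: z when_def)
  finally show ?thesis by simp
qed

section \<open>Monomial ideals\<close>

lemma mpoly_ring_simps [simp]:
  "monoid.mult (mpoly_ring V) = (*)" "add (mpoly_ring V) = (+)"
  "one (mpoly_ring V) = 1" "zero (mpoly_ring V) = 0"
  by (simp_all add: mpoly_ring_def)

lemma carrier_mult: "p \<in> mono_ideal (monoms V) \<Longrightarrow> q \<in> mono_ideal (monoms V) \<Longrightarrow> p * q \<in> mono_ideal (monoms V)"
  by (rule mono_ideal_mult) (auto simp: monoms_add_iff)

lemma one_in_carrier: "1 \<in> mono_ideal (monoms V)"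
  by (simp add: mono_ideal_def)

lemma cring_mpoly_ring: "cring (mpoly_ring V :: ('a, 'k::field) mpoly ring)"
proof (rule cringI)
  show "abelian_group (mpoly_ring V :: ('a, 'k) mpoly ring)"
  proof (rule abelian_groupI)
    fix p :: "('a, 'k) mpoly"
    assume "p \<in> carrier (mpoly_ring V)"
    then show "\<exists>q\<in>carrier (mpoly_ring V). q \<oplus>\<^bsub>mpoly_ring V\<^esub> p = \<zero>\<^bsub>mpoly_ring V\<^esub>"
      by (intro bexI[of _ "- p"]) (auto simp: carrier_mpoly_ring)
  qed (auto simp: carrier_mpoly_ring mono_ideal_add ac_simps)
  show "Group.comm_monoid (mpoly_ring V :: ('a, 'k) mpoly ring)"
    by (rule comm_monoidI) (auto simp: carrier_mpoly_ring carrier_mult one_in_carrier ac_simps)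
qed (simp add: distrib_right)

text \<open>These are the exponent sets of the monomial ideals of the ring in the variables
  \<open>V\<close>.\<close>

definition up_closed :: "'a set \<Rightarrow> ('a \<Rightarrow>\<^sub>0 nat) set \<Rightarrow> bool" where
  "up_closed V U \<longleftrightarrow> U \<subseteq> monoms V \<and> (\<forall>m\<in>U. \<forall>t\<in>monoms V. t + m \<in> U)"

definition up_closure :: "'a set \<Rightarrow> ('a \<Rightarrow>\<^sub>0 nat) set \<Rightarrow> ('a \<Rightarrow>\<^sub>0 nat) set" where
  "up_closure V M = {t + m | t m. t \<in> monoms V \<and> m \<in> M}"

lemma up_closed_up_closure: "M \<subseteq> monoms V \<Longrightarrow> up_closed V (up_closure V M)"
  unfolding up_closed_def up_closure_def
  by (auto simp: monoms_add_iff subset_iff) (metis add.assoc monoms_add_iff)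

lemma up_closure_superset: "M \<subseteq> up_closure V M"
  unfolding up_closure_def by (force intro: exI[of _ 0])

lemma mono_ideal_subset_iff:
  "(mono_ideal U :: ('a, 'k::field) mpoly set) \<subseteq> mono_ideal W \<longleftrightarrow> U \<subseteq> W"
proof
  assume sub: "(mono_ideal U :: ('a, 'k) mpoly set) \<subseteq> mono_ideal W"
  show "U \<subseteq> W"
  proof
    fix m assume "m \<in> U"
    then have "Poly_Mapping.single m (1::'k) \<in> mono_ideal W"
      using sub mono_ideal_single by blast
    then show "m \<in> W" by (simp add: mono_ideal_def)
  qed
qed (rule mono_ideal_mono)

lemma mono_ideal_eq_iff:
  "(mono_ideal U :: ('a, 'k::field) mpoly set) = mono_ideal W \<longleftrightarrow> U = W"
  using mono_ideal_subset_iff[of U W, where 'k = 'k] mono_ideal_subset_iff[of W U, where 'k = 'k]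
  by blast

lemma ideal_mono_ideal:
  assumes "up_closed V U"
  shows "ideal (mono_ideal U :: ('a, 'k::field) mpoly set) (mpoly_ring V)"
proof -
  interpret cring "mpoly_ring V :: ('a, 'k) mpoly ring" by (rule cring_mpoly_ring)
  have U: "U \<subseteq> monoms V" and up: "\<And>t m. t \<in> monoms V \<Longrightarrow> m \<in> U \<Longrightarrow> t + m \<in> U"
    using assms by (auto simp: up_closed_def)
  have sub: "(mono_ideal U :: ('a, 'k) mpoly set) \<subseteq> carrier (mpoly_ring V)"
    unfolding carrier_mpoly_ring using U by (rule mono_ideal_mono)
  show ?thesis
  proof (rule idealI)
    show "ring (mpoly_ring V :: ('a, 'k) mpoly ring)" by (rule ring_axioms)
    show "subgroup (mono_ideal U) (add_monoid (mpoly_ring V :: ('a, 'k) mpoly ring))"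
    proof (rule group.subgroupI)
      show "Group.group (add_monoid (mpoly_ring V :: ('a, 'k) mpoly ring))"
        by (rule add.group_axioms)
      fix p :: "('a, 'k) mpoly" assume p: "p \<in> mono_ideal U"
      then have "\<ominus>\<^bsub>mpoly_ring V\<^esub> p = - p"
        using sub by (intro minus_equality) (auto simp: carrier_mpoly_ring)
      then show "inv\<^bsub>add_monoid (mpoly_ring V)\<^esub> p \<in> mono_ideal U"
        using p by (simp add: a_inv_def)
    next
      show "(mono_ideal U :: ('a, 'k) mpoly set) \<noteq> {}"
        using mono_ideal_zero by blast
    qed (use sub in \<open>auto simp: mono_ideal_add\<close>)
    fix a x :: "('a, 'k) mpoly" assume ax: "a \<in> mono_ideal U" "x \<in> carrier (mpoly_ring V)"
    then have "x * a \<in> mono_ideal U"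
      unfolding carrier_mpoly_ring by (intro mono_ideal_mult[of x "monoms V" a U] up)
    then show "x \<otimes>\<^bsub>mpoly_ring V\<^esub> a \<in> mono_ideal U" "a \<otimes>\<^bsub>mpoly_ring V\<^esub> x \<in> mono_ideal U"
      by (simp_all add: mult.commute)
  qed
qed

text \<open>One inclusion is minimality of the generated ideal. For the other, each term of a
  polynomial supported on the closure is a term times a generator, and the ideal is closed under
  finite sums.\<close>

lemma Idl_monoms:
  assumes M: "M \<subseteq> monoms V"
  shows "Idl\<^bsub>mpoly_ring V\<^esub> (monom_poly ` M) = (mono_ideal (up_closure V M) :: ('a, 'k::field) mpoly set)"
proof -
  interpret cring "mpoly_ring V :: ('a, 'k) mpoly ring" by (rule cring_mpoly_ring)
  have id: "ideal (mono_ideal (up_closure V M)) (mpoly_ring V :: ('a, 'k) mpoly ring)"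
    by (rule ideal_mono_ideal[OF up_closed_up_closure[OF M]])
  have gens: "(monom_poly ` M :: ('a, 'k) mpoly set) \<subseteq> carrier (mpoly_ring V)"
    using M by (auto simp: carrier_mpoly_ring monom_poly_def intro: mono_ideal_single)
  have Iid: "ideal (Idl\<^bsub>mpoly_ring V\<^esub> (monom_poly ` M)) (mpoly_ring V :: ('a, 'k) mpoly ring)"
    by (rule genideal_ideal[OF gens])
  show ?thesis
  proof
    show "Idl\<^bsub>mpoly_ring V\<^esub> (monom_poly ` M) \<subseteq> (mono_ideal (up_closure V M) :: ('a, 'k) mpoly set)"
      by (rule genideal_minimal[OF id])
         (use up_closure_superset in \<open>auto simp: monom_poly_def intro!: mono_ideal_single\<close>)
    show "(mono_ideal (up_closure V M) :: ('a, 'k) mpoly set) \<subseteq> Idl\<^bsub>mpoly_ring V\<^esub> (monom_poly ` M)"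
    proof
      fix p :: "('a, 'k) mpoly" assume p: "p \<in> mono_ideal (up_closure V M)"
      have s: "Poly_Mapping.single m (Poly_Mapping.lookup p m) \<in> Idl\<^bsub>mpoly_ring V\<^esub> (monom_poly ` M)"
        if "m \<in> Poly_Mapping.keys p" for m
      proof -
        have "m \<in> up_closure V M"
          using p \<open>m \<in> Poly_Mapping.keys p\<close> by (auto simp: mono_ideal_def)
        then obtain t g where tg: "m = t + g" "t \<in> monoms V" "g \<in> M"
          by (auto simp: up_closure_def)
        have "monom_poly g \<in> Idl\<^bsub>mpoly_ring V\<^esub> (monom_poly ` M :: ('a, 'k) mpoly set)"
          using genideal_self[OF gens] tg(3) by blast
        moreover have "Poly_Mapping.single t (Poly_Mapping.lookup p m) \<in> carrier (mpoly_ring V)"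
          using tg(2) by (simp add: carrier_mpoly_ring mono_ideal_single)
        ultimately have "Poly_Mapping.single t (Poly_Mapping.lookup p m) \<otimes>\<^bsub>mpoly_ring V\<^esub> monom_poly g
            \<in> Idl\<^bsub>mpoly_ring V\<^esub> (monom_poly ` M)"
          by (rule ideal.I_l_closed[OF Iid])
        then show ?thesis by (simp add: monom_poly_def mult_single tg(1))
      qed
      have "(\<Sum>m\<in>K. Poly_Mapping.single m (Poly_Mapping.lookup p m)) \<in> Idl\<^bsub>mpoly_ring V\<^esub> (monom_poly ` M)"
        if "finite K" "K \<subseteq> Poly_Mapping.keys p" for K
        using that
      proof (induction K)
        case empty
        then show ?case
          using additive_subgroup.zero_closed[OF ideal.axioms(1)[OF Iid]] by simp
      next
        case (insert m K)
        then show ?case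
          using additive_subgroup.a_closed[OF ideal.axioms(1)[OF Iid] s] by simp
      qed
      from this[of "Poly_Mapping.keys p"] show "p \<in> Idl\<^bsub>mpoly_ring V\<^esub> (monom_poly ` M)"
        by (simp add: poly_mapping_sum_single)
    qed
  qed
qed

lemma monom_peel:
  fixes m :: "'a \<Rightarrow>\<^sub>0 nat"
  assumes "x \<in> Poly_Mapping.keys m"
  shows "m = (m - Poly_Mapping.single x 1) + Poly_Mapping.single x 1"
  using assms by (intro poly_mapping_eqI) (auto simp: lookup_add lookup_minus lookup_single when_def in_keys_iff)

lemma up_closure_vars:
  assumes "A \<subseteq> V"
  shows "up_closure V ((\<lambda>x. Poly_Mapping.single x 1) ` A) = {m \<in> monoms V. Poly_Mapping.keys m \<inter> A \<noteq> {}}"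
proof (rule subset_antisym; rule subsetI)
  fix m assume "m \<in> up_closure V ((\<lambda>x. Poly_Mapping.single x 1) ` A)"
  then show "m \<in> {m \<in> monoms V. Poly_Mapping.keys m \<inter> A \<noteq> {}}"
    using assms by (auto simp: up_closure_def keys_add_nat monoms_def)
next
  fix m assume m: "m \<in> {m \<in> monoms V. Poly_Mapping.keys m \<inter> A \<noteq> {}}"
  then obtain x where x: "x \<in> Poly_Mapping.keys m" "x \<in> A" by auto
  note peel = monom_peel[OF x(1)]
  have "m - Poly_Mapping.single x 1 \<in> monoms V"
    using m peel monoms_add_iff[of "m - Poly_Mapping.single x 1" "Poly_Mapping.single x 1" V] by simp
  then show "m \<in> up_closure V ((\<lambda>x. Poly_Mapping.single x 1) ` A)"
    unfolding up_closure_def using peel x(2) by blast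
qed

lemma Idl_vars:
  assumes "A \<subseteq> V"
  shows "Idl\<^bsub>mpoly_ring V\<^esub> (var ` A)
    = (mono_ideal {m \<in> monoms V. Poly_Mapping.keys m \<inter> A \<noteq> {}} :: ('a, 'k::field) mpoly set)"
proof -
  have "(var ` A :: ('a, 'k) mpoly set) = monom_poly ` (\<lambda>x. Poly_Mapping.single x 1) ` A"
    by (simp add: image_image var_def)
  then show ?thesis
    using Idl_monoms[of "(\<lambda>x. Poly_Mapping.single x 1) ` A" V, where 'k = 'k]
      up_closure_vars[OF assms] assms
    by (simp add: single_in_monoms image_subset_iff subsetD)
qed

text \<open>Only the monomial 1 avoids all variables. Minimality of a resolution is handled in this
  form throughout, because constant coefficients are multiplicative.\<close>

lemma irrelevant_ideal_iff:
  "p \<in> irrelevant_ideal V \<longleftrightarrow> p \<in> carrier (mpoly_ring V) \<and> Poly_Mapping.lookup p 0 = 0"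
proof -
  have "{m \<in> monoms V. Poly_Mapping.keys m \<inter> V \<noteq> {}} = monoms V - {0}"
    by (auto simp: monoms_def poly_mapping_eq_iff fun_eq_iff in_keys_iff subset_iff disjoint_iff) blast
  then show ?thesis
    unfolding irrelevant_ideal_def Idl_vars[OF subset_refl] carrier_mpoly_ring
    by (auto simp: mono_ideal_def in_keys_iff)
qed

lemma ideal_prod_mono_ideal:
  assumes U: "up_closed V U" and W: "up_closed V W"
  shows "ideal_prod (mpoly_ring V) (mono_ideal U) (mono_ideal W)
    = (mono_ideal {u + w | u w. u \<in> U \<and> w \<in> W} :: ('a, 'k::field) mpoly set)" (is "?P = ?Q")
proof
  show "?P \<subseteq> ?Q"
  proof
    fix p assume "p \<in> ?P"
    then show "p \<in> ?Q"
      by induction (auto intro: mono_ideal_mult mono_ideal_add)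
  qed
  show "?Q \<subseteq> ?P"
  proof
    fix p assume p: "p \<in> ?Q"
    have s: "Poly_Mapping.single m (Poly_Mapping.lookup p m) \<in> ?P" if "m \<in> Poly_Mapping.keys p" for m
    proof -
      obtain u w where uw: "m = u + w" "u \<in> U" "w \<in> W"
        using p \<open>m \<in> Poly_Mapping.keys p\<close> unfolding mono_ideal_def by blast
      have "Poly_Mapping.single u (Poly_Mapping.lookup p m) \<otimes>\<^bsub>mpoly_ring V\<^esub> Poly_Mapping.single w 1 \<in> ?P"
        using uw by (intro ideal_prod.prod mono_ideal_single)
      then show ?thesis by (simp add: mult_single uw(1))
    qed
    have z: "0 \<in> ?P"
      using ideal_prod.prod[of 0 "mono_ideal U" 0 "mono_ideal W" "mpoly_ring V"] by simp
    have "(\<Sum>m\<in>K. Poly_Mapping.single m (Poly_Mapping.lookup p m)) \<in> ?P"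
      if "finite K" "K \<subseteq> Poly_Mapping.keys p" for K
      using that
    proof (induction K)
      case (insert m K)
      then show ?case using ideal_prod.sum[OF s, of m] by simp
    qed (use z in simp)
    from this[of "Poly_Mapping.keys p"] show "p \<in> ?P"
      by (simp add: poly_mapping_sum_single)
  qed
qed

lemma up_closed_edge:
  "up_closed V {m \<in> monoms V. k \<le> Poly_Mapping.lookup m x + Poly_Mapping.lookup m y}"
  by (auto simp: up_closed_def monoms_add_iff lookup_add)

text \<open>Each multiplication by \<open>(x, y)\<close> raises the required sum of the two
  exponents by one, since a monomial whose sum is at least \<open>Suc k\<close> can give up one
  factor \<open>x\<close> or \<open>y\<close>.\<close>

lemma Idl_edge_power:
  assumes "x \<in> V" "y \<in> V" "x \<noteq> y"
  shows "(Idl\<^bsub>mpoly_ring V\<^esub> (var ` {x, y})) [^]\<^bsub>ideals_set (mpoly_ring V)\<^esub> (k::nat)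
    = (mono_ideal {m \<in> monoms V. k \<le> Poly_Mapping.lookup m x + Poly_Mapping.lookup m y}
        :: ('a, 'k::field) mpoly set)"
proof -
  interpret R: cring "mpoly_ring V :: ('a, 'k) mpoly ring" by (rule cring_mpoly_ring)
  interpret I: semiring "ideals_set (mpoly_ring V :: ('a, 'k) mpoly ring)"
    by (rule R.ideals_set_is_semiring)
  let ?U = "\<lambda>k. {m \<in> monoms V. k \<le> Poly_Mapping.lookup m x + Poly_Mapping.lookup m y}"
  have base: "Idl\<^bsub>mpoly_ring V\<^esub> (var ` {x, y}) = (mono_ideal (?U 1) :: ('a, 'k) mpoly set)"
    using assms by (subst Idl_vars) (auto simp: in_keys_iff intro!: arg_cong[of _ _ mono_ideal])
  show ?thesis
    unfolding base
  proof (induction k)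
    case 0
    then show ?case by (simp add: ideals_set_def carrier_mpoly_ring)
  next
    case (Suc k)
    have "{u + w | u w. u \<in> ?U k \<and> w \<in> ?U 1} = ?U (Suc k)" (is "?A = _")
    proof (rule subset_antisym; rule subsetI)
      fix m assume "m \<in> ?A"
      then show "m \<in> ?U (Suc k)" by (auto simp: monoms_add_iff lookup_add)
    next
      fix m assume m: "m \<in> ?U (Suc k)"
      then have "Poly_Mapping.lookup m x \<noteq> 0 \<or> Poly_Mapping.lookup m y \<noteq> 0" by auto
      then obtain z where z: "z \<in> {x, y}" "z \<in> Poly_Mapping.keys m"
        unfolding in_keys_iff by blast
      note peel = monom_peel[OF z(2)]
      have "m - Poly_Mapping.single z 1 \<in> ?U k"
        using m peel z monoms_add_iff[of "m - Poly_Mapping.single z 1" "Poly_Mapping.single z 1" V] assms(3)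
        by (auto simp: lookup_minus lookup_single when_def)
      moreover have "Poly_Mapping.single z 1 \<in> ?U 1"
        using z(1) assms by (auto simp: single_in_monoms lookup_single)
      ultimately show "m \<in> ?A"
        using peel by blast
    qed
    then have *: "ideal_prod (mpoly_ring V) (mono_ideal (?U k)) (mono_ideal (?U 1))
        = (mono_ideal (?U (Suc k)) :: ('a, 'k) mpoly set)"
      using ideal_prod_mono_ideal[OF up_closed_edge[of V k x y] up_closed_edge[of V 1 x y]] by simp
    have mult: "monoid.mult (ideals_set (mpoly_ring V :: ('a, 'k) mpoly ring)) = ideal_prod (mpoly_ring V)"
      by (simp add: ideals_set_def)
    show ?case
      unfolding I.nat_pow_Suc Suc.IH mult by (rule *)
  qed
qed

text \<open>A generator \<open>m\<close> in \<open>M\<close> is a multiple of some \<open>n\<close>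
  in \<open>N\<close>, and \<open>n\<close> is a multiple of some \<open>m'\<close> in
  \<open>M\<close>; the antichain condition makes all three equal. Hence every generating set of
  monomials contains \<open>M\<close>.\<close>

lemma minimal_monomial_generating_set_antichain:
  assumes M: "M \<subseteq> monoms V"
    and anti: "\<And>m m' t. m \<in> M \<Longrightarrow> m' \<in> M \<Longrightarrow> m' = t + m \<Longrightarrow> t = 0"
  shows "minimal_monomial_generating_set V (mono_ideal (up_closure V M) :: ('a, 'k::field) mpoly set) N
    \<longleftrightarrow> N = M"
proof -
  have gen: "M \<subseteq> N" if "N \<subseteq> monoms V"
    "Idl\<^bsub>mpoly_ring V\<^esub> (monom_poly ` N) = (mono_ideal (up_closure V M) :: ('a, 'k) mpoly set)" for N
  proof
    have eq: "up_closure V N = up_closure V M"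
      using that Idl_monoms[OF that(1), where 'k = 'k] by (simp add: mono_ideal_eq_iff)
    fix m assume m: "m \<in> M"
    then have "m \<in> up_closure V N" using eq up_closure_superset by blast
    then obtain t n where tn: "m = t + n" "n \<in> N" by (auto simp: up_closure_def)
    then have "n \<in> up_closure V M" using eq up_closure_superset by blast
    then obtain s m' where s: "n = s + m'" "m' \<in> M" by (auto simp: up_closure_def)
    have "t + s = 0" using anti[OF s(2) m] tn(1) s(1) by (simp add: add.assoc)
    then have "t = 0" by (auto simp: poly_mapping_eq_iff lookup_add fun_eq_iff)
    then show "m \<in> N" using tn by simp
  qed
  note gM = Idl_monoms[OF M, where 'k = 'k]
  show ?thesis
  proof
    assume N: "minimal_monomial_generating_set V (mono_ideal (up_closure V M) :: ('a, 'k) mpoly set) N"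
    then have "M \<subseteq> N" by (intro gen) (auto simp: minimal_monomial_generating_set_def)
    moreover have "\<not> M \<subset> N" using N gM by (auto simp: minimal_monomial_generating_set_def)
    ultimately show "N = M" by blast
  next
    assume N: "N = M"
    show "minimal_monomial_generating_set V (mono_ideal (up_closure V M) :: ('a, 'k) mpoly set) N"
      unfolding minimal_monomial_generating_set_def N
    proof (intro conjI allI impI notI M gM)
      fix M' assume "M' \<subset> M"
        "Idl\<^bsub>mpoly_ring V\<^esub> (monom_poly ` M') = (mono_ideal (up_closure V M) :: ('a, 'k) mpoly set)"
      then show False using gen[of M'] M by blast
    qed
  qed
qed

lemma ideal_degree_antichain:
  assumes M: "M \<subseteq> monoms V"
    and anti: "\<And>m m' t. m \<in> M \<Longrightarrow> m' \<in> M \<Longrightarrow> m' = t + m \<Longrightarrow> t = 0"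
  shows "ideal_degree V (mono_ideal (up_closure V M) :: ('a, 'k::field) mpoly set)
    = Max (monom_degree ` M)"
proof -
  have "minimal_monomial_generating_set V (mono_ideal (up_closure V M) :: ('a, 'k) mpoly set) N
    \<longleftrightarrow> N = M" for N
    using M anti by (rule minimal_monomial_generating_set_antichain)
  then have "{monom_degree m |m. \<exists>N. minimal_monomial_generating_set V
      (mono_ideal (up_closure V M) :: ('a, 'k) mpoly set) N \<and> m \<in> N} = monom_degree ` M"
    by auto
  then show ?thesis unfolding ideal_degree_def by simp
qed

section \<open>Cover ideals and their symbolic powers in terms of exponents\<close>

definition ind_monom :: "'a set \<Rightarrow> 'a \<Rightarrow>\<^sub>0 nat" where
  "ind_monom C = (\<Sum>x\<in>C. Poly_Mapping.single x 1)"

lemma lookup_ind_monom: "finite C \<Longrightarrow> Poly_Mapping.lookup (ind_monom C) x = (if x \<in> C then 1 else 0)"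
  by (simp add: ind_monom_def lookup_sum lookup_single when_def sum.delta')

lemma keys_ind_monom: "finite C \<Longrightarrow> Poly_Mapping.keys (ind_monom C) = C"
  by (auto simp: in_keys_iff lookup_ind_monom split: if_splits)

lemma monom_degree_ind_monom: "finite C \<Longrightarrow> monom_degree (ind_monom C) = card C"
  by (simp add: monom_degree_def keys_ind_monom lookup_ind_monom)

lemma prod_var: "finite C \<Longrightarrow> (\<Prod>x\<in>C. var x) = monom_poly (ind_monom C)"
  by (induction C rule: finite_induct)
     (auto simp: ind_monom_def var_def monom_poly_mult, simp add: monom_poly_def)

lemma minimal_vertex_cover_finite:
  "finite_simple_graph G \<Longrightarrow> minimal_vertex_cover G C \<Longrightarrow> finite C"
  by (auto simp: finite_simple_graph_def minimal_vertex_cover_def vertex_cover_def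
        intro: finite_subset)

text \<open>Divisibility between squarefree monomials is inclusion of their supports, so minimality
  of the covers makes their monomials an antichain.\<close>

lemma ideal_degree_cover_ideal:
  assumes G: "finite_simple_graph G"
  shows "ideal_degree (verts G) (cover_ideal G :: ('a, 'k::field) mpoly set)
    = Max (card ` {C. minimal_vertex_cover G C})"
proof -
  let ?M = "ind_monom ` {C. minimal_vertex_cover G C}"
  note fin = minimal_vertex_cover_finite[OF G]
  have gens: "{\<Prod>x\<in>C. var x | C. minimal_vertex_cover G C} = (monom_poly ` ?M :: ('a, 'k) mpoly set)"
    using fin by (auto simp: prod_var image_iff) (metis prod_var)
  have M: "?M \<subseteq> monoms (verts G)"
    using fin by (auto simp: monoms_def keys_ind_monom minimal_vertex_cover_def vertex_cover_def)
  have anti: "t = 0" if "m \<in> ?M" "m' \<in> ?M" "m' = t + m" for m m' t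
  proof -
    obtain C C' where C: "minimal_vertex_cover G C" "m = ind_monom C"
      and C': "minimal_vertex_cover G C'" "m' = ind_monom C'" using \<open>m \<in> ?M\<close> \<open>m' \<in> ?M\<close> by auto
    have "C' = Poly_Mapping.keys t \<union> C"
      using arg_cong[OF \<open>m' = t + m\<close>, of Poly_Mapping.keys] C C' fin by (simp add: keys_add_nat keys_ind_monom)
    then have "C' = C" using C(1) C'(1) by (auto simp: minimal_vertex_cover_def)
    then show "t = 0" using C(2) C'(2) \<open>m' = t + m\<close> by simp
  qed
  have "cover_ideal G = (mono_ideal (up_closure (verts G) ?M) :: ('a, 'k) mpoly set)"
    unfolding cover_ideal_def gens by (rule Idl_monoms[OF M])
  moreover have "ideal_degree (verts G) (mono_ideal (up_closure (verts G) ?M) :: ('a, 'k) mpoly set)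
      = Max (monom_degree ` ?M)"
    by (rule ideal_degree_antichain[OF M]) (rule anti)
  ultimately have "ideal_degree (verts G) (cover_ideal G :: ('a, 'k) mpoly set) = Max (monom_degree ` ?M)"
    by simp
  also have "monom_degree ` ?M = card ` {C. minimal_vertex_cover G C}"
    using fin by (force simp: image_iff monom_degree_ind_monom)
  finally show ?thesis .
qed

text \<open>The condition is a sum over the set \<open>e\<close>, so no order of its two ends has to
  be chosen; without edges it is vacuous and the whole ring results, as the definition
  demands.\<close>

lemma cover_ideal_symbolic_power_eq:
  assumes G: "finite_simple_graph G"
  shows "cover_ideal_symbolic_power G k
    = (mono_ideal {m \<in> monoms (verts G). \<forall>e\<in>edges G. k \<le> (\<Sum>x\<in>e. Poly_Mapping.lookup m x)}
        :: ('a, 'k::field) mpoly set)"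
proof -
  have e: "(Idl\<^bsub>mpoly_ring (verts G)\<^esub> (var ` e)) [^]\<^bsub>ideals_set (mpoly_ring (verts G))\<^esub> k
    = (mono_ideal {m \<in> monoms (verts G). k \<le> (\<Sum>x\<in>e. Poly_Mapping.lookup m x)} :: ('a, 'k) mpoly set)"
    if "e \<in> edges G" for e
  proof -
    have e: "e \<subseteq> verts G" "card e = 2" using G that by (auto simp: finite_simple_graph_def)
    then obtain x y where "e = {x, y}" "x \<noteq> y" by (auto simp: card_2_iff)
    then show ?thesis using e(1) Idl_edge_power[of x "verts G" y k] by simp
  qed
  show ?thesis
    unfolding cover_ideal_symbolic_power_def carrier_mpoly_ring
    by (simp add: e cong: INF_cong) (auto simp: mono_ideal_def)
qed

section \<open>Graded maps and resolutions\<close>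

text \<open>The degree \<open>j\<close> component of the graded free module with shifts
  \<open>t\<close>.\<close>

definition hvec :: "'a set \<Rightarrow> int \<Rightarrow> int list \<Rightarrow> ('a, 'k::field) mpoly vec set" where
  "hvec V j t = {v \<in> carrier_vec (length t). \<forall>a<length t. v $ a \<in> homogeneous_part V (j - t ! a)}"

lemma hvec_carrier: "v \<in> hvec V j t \<Longrightarrow> v \<in> carrier_vec (length t)"
  by (simp add: hvec_def)

lemma graded_map_carrier: "graded_map V s t A \<Longrightarrow> A \<in> carrier_mat (length t) (length s)"
  by (simp add: graded_map_def)

lemma hvec_free_module: "v \<in> hvec V j t \<Longrightarrow> v \<in> free_module V (length t)"
  by (auto simp: hvec_def free_module_def homogeneous_carrier)

lemma hvec_zero [simp]: "0\<^sub>v (length t) \<in> hvec V j t"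
  by (simp add: hvec_def)

lemma hvec_add: "v \<in> hvec V j t \<Longrightarrow> w \<in> hvec V j t \<Longrightarrow> v + w \<in> hvec V j t"
  by (auto simp: hvec_def homogeneous_add)

lemma hvec_diff: "v \<in> hvec V j t \<Longrightarrow> w \<in> hvec V j t \<Longrightarrow> v - w \<in> hvec V j t"
  by (auto simp: hvec_def homogeneous_diff)

lemma hvec_uminus: "v \<in> hvec V j t \<Longrightarrow> - v \<in> hvec V j t"
  by (auto simp: hvec_def)

lemma hvec_smult:
  assumes "p \<in> homogeneous_part V c" "v \<in> hvec V j t"
  shows "p \<cdot>\<^sub>v v \<in> hvec V (j + c) t"
proof -
  have "p * v $ a \<in> homogeneous_part V (j + c - t ! a)" if "a < length t" for a
    using homogeneous_mult[OF assms(1), of "v $ a" "j - t ! a"] assms(2) that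
    by (auto simp: hvec_def algebra_simps)
  then show ?thesis using assms(2) by (auto simp: hvec_def)
qed

lemma hvec_append:
  assumes "u \<in> hvec V j s" "w \<in> hvec V j t"
  shows "u @\<^sub>v w \<in> hvec V j (s @ t)"
  using assms by (auto simp: hvec_def nth_append)

lemma hvec_appendE:
  assumes z: "z \<in> hvec V j (s @ t)"
  obtains u w where "z = u @\<^sub>v w" "u \<in> hvec V j s" "w \<in> hvec V j t"
proof
  let ?u = "vec (length s) (\<lambda>a. z $ a)" and ?w = "vec (length t) (\<lambda>a. z $ (length s + a))"
  show "z = ?u @\<^sub>v ?w" using z by (intro eq_vecI) (auto simp: hvec_def)
  have *: "z $ a \<in> homogeneous_part V (j - (s @ t) ! a)" if "a < length s + length t" for a
    using z that by (auto simp: hvec_def)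
  have "z $ a \<in> homogeneous_part V (j - s ! a)" if "a < length s" for a
    using *[of a] that by (simp add: nth_append)
  then show "?u \<in> hvec V j s" by (simp add: hvec_def)
  show "?w \<in> hvec V j t" using *[of "length s + _"] by (simp add: hvec_def)
qed

lemma hvec_Nil [simp]: "v \<in> hvec V j [] \<longleftrightarrow> v = vNil"
  by (auto simp: hvec_def)

lemma hvec_shift: "hvec V j (map (\<lambda>i. i + c) t) = hvec V (j - c) t"
  by (auto simp: hvec_def algebra_simps)

lemma graded_map_mult_vec:
  assumes A: "graded_map V s t A" and v: "v \<in> hvec V j s"
  shows "A *\<^sub>v v \<in> hvec V j t"
proof -
  have "(A *\<^sub>v v) $ a \<in> homogeneous_part V (j - t ! a)" if "a < length t" for a
  proof -
    have "A $$ (a, b) * v $ b \<in> homogeneous_part V (j - t ! a)" if "b < length s" for b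
      using homogeneous_mult[of "A $$ (a, b)" V "s ! b - t ! a" "v $ b" "j - s ! b"] A v
        \<open>a < length t\<close> that by (auto simp: graded_map_def hvec_def)
    then show ?thesis
      using that A v by (auto simp: graded_map_def hvec_def scalar_prod_def intro!: homogeneous_sum)
  qed
  then show ?thesis using A v by (auto simp: graded_map_def hvec_def)
qed

text \<open>Column \<open>b\<close> is the image of a basis element of degree \<open>s ! b\<close>;
  in this form a graded map is built by choosing its columns.\<close>

lemma graded_map_iff_cols:
  "graded_map V s t A \<longleftrightarrow> A \<in> carrier_mat (length t) (length s) \<and> (\<forall>b<length s. col A b \<in> hvec V (s ! b) t)"
  by (auto simp: graded_map_def hvec_def)

lemma graded_map_mult:
  assumes A: "graded_map V s t A" and B: "graded_map V r s B"
  shows "graded_map V r t (A * B)"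
  unfolding graded_map_iff_cols
proof (intro conjI allI impI)
  show "A * B \<in> carrier_mat (length t) (length r)"
    using A B by (auto simp: graded_map_def)
  fix b assume b: "b < length r"
  have "col (A * B) b = A *\<^sub>v col B b"
    using b by (intro col_mult2[OF graded_map_carrier[OF A] graded_map_carrier[OF B]])
  then show "col (A * B) b \<in> hvec V (r ! b) t"
    using graded_map_mult_vec[OF A] B b by (auto simp: graded_map_iff_cols)
qed

lemma graded_map_add: "graded_map V s t A \<Longrightarrow> graded_map V s t B \<Longrightarrow> graded_map V s t (A + B)"
  by (auto simp: graded_map_def homogeneous_add)

lemma graded_map_diff: "graded_map V s t A \<Longrightarrow> graded_map V s t B \<Longrightarrow> graded_map V s t (A - B)"
  by (auto simp: graded_map_def homogeneous_diff)

lemma graded_map_uminus: "graded_map V s t A \<Longrightarrow> graded_map V s t (- A)"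
  by (auto simp: graded_map_def)

lemma graded_map_zero: "graded_map V s t (0\<^sub>m (length t) (length s))"
  by (auto simp: graded_map_def)

lemma graded_map_one: "graded_map V s s (1\<^sub>m (length s))"
  by (auto simp: graded_map_def)

lemma graded_map_shift:
  "graded_map V (map (\<lambda>i. i + c) s) (map (\<lambda>i. i + c) t) A \<longleftrightarrow> graded_map V s t A"
  by (auto simp: graded_map_def)

lemma graded_map_smult:
  assumes "p \<in> homogeneous_part V c" "graded_map V s t A"
  shows "graded_map V (map (\<lambda>i. i + c) s) t (p \<cdot>\<^sub>m A)"
proof -
  have "p * A $$ (a, b) \<in> homogeneous_part V (s ! b + c - t ! a)"
    if "a < length t" "b < length s" for a b
    using homogeneous_mult[OF assms(1), of "A $$ (a, b)" "s ! b - t ! a"] assms(2) that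
    by (auto simp: graded_map_def algebra_simps)
  then show ?thesis using assms(2) by (auto simp: graded_map_def)
qed

lemma graded_map_four_block:
  assumes "graded_map V s1 t1 A" "graded_map V s2 t1 B" "graded_map V s1 t2 C" "graded_map V s2 t2 D"
  shows "graded_map V (s1 @ s2) (t1 @ t2) (four_block_mat A B C D)"
  using assms by (auto simp: graded_map_def nth_append)

text \<open>Projectivity of a graded free module: a homogeneous preimage is chosen for every basis
  element, and the preimages become the columns of \<open>X\<close>.\<close>

lemma graded_map_of_cols:
  assumes "\<And>b. b < length q \<Longrightarrow> \<exists>y\<in>hvec V (q ! b) u. D *\<^sub>v y = col H b"
    and D: "D \<in> carrier_mat (length s) (length u)" and H: "H \<in> carrier_mat (length s) (length q)"
  obtains X where "graded_map V q u X" "D * X = H"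
proof -
  obtain y where y: "\<And>b. b < length q \<Longrightarrow> y b \<in> hvec V (q ! b) u \<and> D *\<^sub>v y b = col H b"
    using assms(1) by metis
  let ?X = "mat (length u) (length q) (\<lambda>(a, b). y b $ a)"
  have X: "?X \<in> carrier_mat (length u) (length q)" by simp
  have col: "col ?X b = y b" if "b < length q" for b
    using y[OF that] that by (auto simp: hvec_def intro!: eq_vecI)
  have "D * ?X = H"
  proof (rule mat_col_eqI)
    fix b assume "b < dim_col H"
    then have b: "b < length q" using H by simp
    show "col (D * ?X) b = col H b"
      using col_mult2[OF D X b] col[OF b] y[OF b] by simp
  qed (use D H in auto)
  moreover have "graded_map V q u ?X" using col y by (simp add: graded_map_iff_cols)
  ultimately show thesis by (intro that)
qed

text \<open>Exactness at the module with shifts \<open>s\<close>. Testing only homogeneous vectors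
  yields homogeneous preimages, which is what makes lifts degree-preserving.\<close>

definition graded_exact ::
  "'a set \<Rightarrow> int list \<Rightarrow> int list \<Rightarrow> ('a, 'k::field) mpoly mat \<Rightarrow> ('a, 'k) mpoly mat \<Rightarrow> bool" where
  "graded_exact V u s D' D \<longleftrightarrow> graded_map V u s D' \<and> D * D' = 0\<^sub>m (dim_row D) (length u) \<and>
     (\<forall>j. \<forall>z\<in>hvec V j s. D *\<^sub>v z = 0\<^sub>v (dim_row D) \<longrightarrow> (\<exists>y\<in>hvec V j u. D' *\<^sub>v y = z))"

lemma graded_exact_lift:
  assumes ex: "graded_exact V u s D' D" and D: "graded_map V s t D"
    and H: "graded_map V q s H" and DH: "D * H = 0\<^sub>m (length t) (length q)"
  obtains X where "graded_map V q u X" "D' * X = H"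
proof (rule graded_map_of_cols)
  note c = graded_map_carrier[OF D] graded_map_carrier[OF H]
  show "D' \<in> carrier_mat (length s) (length u)"
    using ex by (auto simp: graded_exact_def graded_map_def)
  fix b assume b: "b < length q"
  have "D *\<^sub>v col H b = col (D * H) b" using col_mult2[OF c b] by simp
  also have "\<dots> = 0\<^sub>v (dim_row D)" using b c unfolding DH by auto
  finally show "\<exists>y\<in>hvec V (q ! b) u. D' *\<^sub>v y = col H b"
    using ex H b by (auto simp: graded_exact_def graded_map_iff_cols)
qed (use H that in \<open>auto simp: graded_map_def\<close>)

text \<open>Image equal to the ideal, in homogeneous form: the columns lie in the ideal, and every
  form in the ideal has a homogeneous preimage.\<close>

definition graded_augmentation ::
  "'a set \<Rightarrow> ('a \<Rightarrow>\<^sub>0 nat) set \<Rightarrow> int list \<Rightarrow> ('a, 'k::field) mpoly mat \<Rightarrow> bool" where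
  "graded_augmentation V U s D \<longleftrightarrow> graded_map V s [0] D \<and>
     (\<forall>b<length s. D $$ (0, b) \<in> mono_ideal U) \<and>
     (\<forall>j. \<forall>p\<in>homogeneous_part V j \<inter> mono_ideal U. \<exists>y\<in>hvec V j s. (D *\<^sub>v y) $ 0 = p)"

definition graded_resolution ::
  "'a set \<Rightarrow> ('a \<Rightarrow>\<^sub>0 nat) set \<Rightarrow> (nat \<Rightarrow> int list) \<Rightarrow> (nat \<Rightarrow> ('a, 'k::field) mpoly mat) \<Rightarrow> bool" where
  "graded_resolution V U d D \<longleftrightarrow> graded_augmentation V U (d 0) (D 0) \<and>
     (\<forall>i. graded_exact V (d (Suc i)) (d i) (D (Suc i)) (D i))"

lemma graded_augmentation_lift:
  assumes D: "graded_augmentation V U s D" and H: "graded_map V q [0] H"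
    and U: "\<And>b. b < length q \<Longrightarrow> H $$ (0, b) \<in> mono_ideal U"
  obtains X where "graded_map V q s X" "D * X = H"
proof (rule graded_map_of_cols[where s = "[0]"])
  fix b assume b: "b < length q"
  have "H $$ (0, b) \<in> homogeneous_part V (q ! b) \<inter> mono_ideal U"
    using H U[OF b] b by (auto simp: graded_map_def)
  then obtain y where y: "y \<in> hvec V (q ! b) s" "(D *\<^sub>v y) $ 0 = H $$ (0, b)"
    using D unfolding graded_augmentation_def by blast
  have "D *\<^sub>v y = col H b"
    using y(2) D H b by (intro eq_vecI) (auto simp: graded_augmentation_def graded_map_def)
  then show "\<exists>y\<in>hvec V (q ! b) s. D *\<^sub>v y = col H b" using y(1) by blast
qed (use assms that in \<open>auto simp: graded_augmentation_def graded_map_def\<close>)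

lemma graded_resolution_map:
  "graded_resolution V U d D \<Longrightarrow> graded_map V (d (Suc i)) (d i) (D (Suc i))"
  "graded_resolution V U d D \<Longrightarrow> graded_map V (d 0) [0] (D 0)"
  by (simp_all add: graded_resolution_def graded_exact_def graded_augmentation_def)

section \<open>Exactness in each degree and exactness on all vectors\<close>

definition hom_vec :: "int \<Rightarrow> int list \<Rightarrow> ('a, 'k::field) mpoly vec \<Rightarrow> ('a, 'k) mpoly vec" where
  "hom_vec j t w = vec (length t) (\<lambda>a. hom_comp (j - t ! a) (w $ a))"

lemma hom_vec_hvec: "w \<in> free_module V (length t) \<Longrightarrow> hom_vec j t w \<in> hvec V j t"
  by (auto simp: hom_vec_def hvec_def free_module_def hom_comp_homogeneous)

lemma hom_vec_id: "w \<in> hvec V j t \<Longrightarrow> hom_vec j t w = w"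
  by (auto simp: hom_vec_def hvec_def hom_comp_id intro!: eq_vecI)

text \<open>The entry in row \<open>a\<close> and column \<open>b\<close> has degree
  \<open>s ! b - t ! a\<close>, exactly the difference of the degrees in which the two components
  are taken.\<close>

lemma hom_vec_mult:
  assumes A: "graded_map V s t A" and w: "w \<in> free_module V (length s)"
  shows "A *\<^sub>v hom_vec j s w = hom_vec j t (A *\<^sub>v w)"
proof (rule eq_vecI)
  fix a assume "a < dim_vec (hom_vec j t (A *\<^sub>v w))"
  then have a: "a < length t" by (simp add: hom_vec_def)
  have "A $$ (a, b) * hom_comp (j - s ! b) (w $ b) = hom_comp (j - t ! a) (A $$ (a, b) * w $ b)"
    if "b < length s" for b
    using hom_comp_mult[of "A $$ (a, b)" V "s ! b - t ! a" "j - t ! a" "w $ b"] A a that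
    by (simp add: graded_map_def)
  then show "(A *\<^sub>v hom_vec j s w) $ a = hom_vec j t (A *\<^sub>v w) $ a"
    using a A w unfolding hom_vec_def graded_map_def free_module_def
    by (auto simp: scalar_prod_def hom_comp_def monom_filter_sum intro!: sum.cong)
qed (use A in \<open>auto simp: hom_vec_def graded_map_def\<close>)

text \<open>A vector is the sum of finitely many homogeneous components, so preimages of these
  components add up to a preimage of the vector.\<close>

lemma free_module_image:
  assumes D': "graded_map V u s D'" and w: "w \<in> free_module V (length s)"
    and h: "\<And>j. \<exists>y\<in>hvec V j u. D' *\<^sub>v y = hom_vec j s w"
  shows "\<exists>y\<in>free_module V (length u). D' *\<^sub>v y = w"
proof -
  obtain y where y: "\<And>j. y j \<in> hvec V j u \<and> D' *\<^sub>v y j = hom_vec j s w" using h by metis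
  \<comment> \<open>The degrees in which \<open>w\<close> has a nonzero component: a term of entry
    \<open>a\<close> counts with its own degree plus the shift \<open>s ! a\<close>.\<close>
  define J where "J = (\<Union>a<length s. (\<lambda>m. int (monom_degree m) + s ! a) ` Poly_Mapping.keys (w $ a))"
  have J: "finite J" by (simp add: J_def)
  define z where "z = vec (length u) (\<lambda>b. \<Sum>j\<in>J. y j $ b)"
  have dim: "dim_vec (y j) = length u" for j using hvec_carrier[of "y j" V j u] y[of j] by auto
  have yc: "y j $ b \<in> carrier (mpoly_ring V)" if "b < length u" for j b
    using hvec_free_module[of "y j" V j u] y[of j] that by (auto simp: free_module_def)
  have "z \<in> free_module V (length u)"
    using yc by (auto simp: z_def free_module_def carrier_mpoly_ring intro!: mono_ideal_sum)
  moreover have "D' *\<^sub>v z = w"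
  proof (rule eq_vecI)
    fix a assume "a < dim_vec w"
    then have a: "a < length s" using w by (auto simp: free_module_def)
    have "(D' *\<^sub>v z) $ a = (\<Sum>b<length u. D' $$ (a, b) * (\<Sum>j\<in>J. y j $ b))"
      using D' a by (auto simp: graded_map_def scalar_prod_def z_def atLeast0LessThan intro!: sum.cong)
    also have "\<dots> = (\<Sum>j\<in>J. \<Sum>b<length u. D' $$ (a, b) * y j $ b)"
      by (simp add: sum_distrib_left sum.swap[of _ J])
    also have "\<dots> = (\<Sum>j\<in>J. (D' *\<^sub>v y j) $ a)"
      using D' a dim by (auto simp: graded_map_def scalar_prod_def atLeast0LessThan intro!: sum.cong)
    also have "\<dots> = (\<Sum>j\<in>J. hom_comp (j - s ! a) (w $ a))"
      using y a by (simp add: hom_vec_def)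
    also have "\<dots> = (\<Sum>j\<in>(\<lambda>j. j - s ! a) ` J. hom_comp j (w $ a))"
      by (subst sum.reindex) (auto simp: inj_on_def)
    also have "\<dots> = w $ a"
      using J a by (intro sum_hom_comp) (force simp: J_def image_iff)+
    finally show "(D' *\<^sub>v z) $ a = w $ a" .
  qed (use D' w in \<open>auto simp: graded_map_def free_module_def\<close>)
  ultimately show ?thesis by blast
qed

lemma graded_map_free_module:
  assumes A: "graded_map V s t A" and v: "v \<in> free_module V (length s)"
  shows "A *\<^sub>v v \<in> free_module V (length t)"
proof -
  have "A $$ (a, b) * v $ b \<in> mono_ideal (monoms V)" if "a < length t" "b < length s" for a b
    using A v that homogeneous_carrier[of "A $$ (a, b)" V]
    by (intro carrier_mult) (auto simp: graded_map_def free_module_def carrier_mpoly_ring)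
  then show ?thesis
    using A v by (auto simp: graded_map_def free_module_def carrier_mpoly_ring scalar_prod_def
        intro!: mono_ideal_sum)
qed

lemma unit_vec_hvec: "b < length s \<Longrightarrow> unit_vec (length s) b \<in> hvec V (s ! b) s"
  by (auto simp: hvec_def unit_vec_def)

lemma mult_unit_vec:
  "A \<in> carrier_mat n m \<Longrightarrow> b < m \<Longrightarrow> (A :: 'b::comm_ring_1 mat) *\<^sub>v unit_vec m b = col A b"
  by (intro eq_vecI) auto

text \<open>From left to right, a cycle is split into homogeneous cycles. Conversely, a preimage of
  a homogeneous vector may be replaced by its component of that degree, since graded maps commute
  with \<open>hom_vec\<close>.\<close>

lemma graded_exact_iff:
  assumes D: "graded_map V s t D" and D': "graded_map V u s D'"
  shows "graded_exact V u s D' D \<longleftrightarrow>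
    (\<lambda>v. D' *\<^sub>v v) ` free_module V (length u) = {w \<in> free_module V (length s). D *\<^sub>v w = 0\<^sub>v (dim_row D)}"
    (is "?L \<longleftrightarrow> ?R")
proof -
  note c = graded_map_carrier[OF D] graded_map_carrier[OF D']
  show ?thesis
  proof
    assume L: ?L
    have "D *\<^sub>v (D' *\<^sub>v v) = 0\<^sub>v (dim_row D)" if "v \<in> free_module V (length u)" for v
    proof -
      have v: "v \<in> carrier_vec (length u)" using that by (simp add: free_module_def)
      have "D *\<^sub>v (D' *\<^sub>v v) = (D * D') *\<^sub>v v"
        by (rule assoc_mult_mat_vec[OF c v, symmetric])
      also have "D * D' = 0\<^sub>m (dim_row D) (length u)" using L by (simp add: graded_exact_def)
      also have "\<dots> *\<^sub>v v = 0\<^sub>v (dim_row D)" using v by auto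
      finally show ?thesis .
    qed
    moreover have "\<exists>y\<in>free_module V (length u). D' *\<^sub>v y = w"
      if w: "w \<in> free_module V (length s)" "D *\<^sub>v w = 0\<^sub>v (dim_row D)" for w
    proof (rule free_module_image[OF D' w(1)])
      fix j
      have "D *\<^sub>v hom_vec j s w = hom_vec j t (D *\<^sub>v w)" by (rule hom_vec_mult[OF D w(1)])
      also have "\<dots> = 0\<^sub>v (dim_row D)"
        using c unfolding w(2) by (auto simp: hom_vec_def hom_comp_def intro!: eq_vecI)
      finally show "\<exists>y\<in>hvec V j u. D' *\<^sub>v y = hom_vec j s w"
        using L hom_vec_hvec[OF w(1)] by (auto simp: graded_exact_def)
    qed
    ultimately show ?R using graded_map_free_module[OF D'] by blast
  next
    assume R: ?R
    have "D * D' = 0\<^sub>m (dim_row D) (length u)"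
    proof (rule mat_col_eqI)
      fix b assume "b < dim_col (0\<^sub>m (dim_row D) (length u) :: ('a, 'b) mpoly mat)"
      then have b: "b < length u" by simp
      have "D' *\<^sub>v unit_vec (length u) b \<in> (\<lambda>v. D' *\<^sub>v v) ` free_module V (length u)"
        using hvec_free_module[OF unit_vec_hvec[OF b]] by blast
      then have "D *\<^sub>v (D' *\<^sub>v unit_vec (length u) b) = 0\<^sub>v (dim_row D)" unfolding R by simp
      then have "D *\<^sub>v col D' b = 0\<^sub>v (dim_row D)" using mult_unit_vec[OF c(2) b] by simp
      then show "col (D * D') b = col (0\<^sub>m (dim_row D) (length u)) b"
        using col_mult2[OF c b] b by auto
    qed (use c in auto)
    moreover have "\<exists>y\<in>hvec V j u. D' *\<^sub>v y = z"
      if z: "z \<in> hvec V j s" "D *\<^sub>v z = 0\<^sub>v (dim_row D)" for j z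
    proof -
      have "z \<in> (\<lambda>v. D' *\<^sub>v v) ` free_module V (length u)"
        unfolding R using hvec_free_module[OF z(1)] z(2) by simp
      then obtain y where y: "y \<in> free_module V (length u)" "z = D' *\<^sub>v y" by blast
      have "D' *\<^sub>v hom_vec j u y = z"
        using hom_vec_mult[OF D' y(1)] y(2) hom_vec_id[OF z(1)] by simp
      then show ?thesis using hom_vec_hvec[OF y(1)] by blast
    qed
    ultimately show ?L using D' by (simp add: graded_exact_def)
  qed
qed

lemma graded_augmentation_iff:
  assumes D: "graded_map V s [0] D" and U: "up_closed V U"
  shows "graded_augmentation V U s D \<longleftrightarrow>
    (\<lambda>v. D *\<^sub>v v) ` free_module V (length s) = {w \<in> free_module V 1. w $ 0 \<in> mono_ideal U}"
    (is "?L \<longleftrightarrow> ?R")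
proof -
  note c = graded_map_carrier[OF D]
  have sub: "U \<subseteq> monoms V" using U by (simp add: up_closed_def)
  show ?thesis
  proof
    assume L: ?L
    have "(D *\<^sub>v v) $ 0 \<in> mono_ideal U" if v: "v \<in> free_module V (length s)" for v
    proof -
      have "D $$ (0, b) * v $ b \<in> mono_ideal U" if b: "b < length s" for b
      proof (rule mono_ideal_mult)
        show "D $$ (0, b) \<in> mono_ideal U" using L b by (simp add: graded_augmentation_def)
        show "v $ b \<in> mono_ideal (monoms V)"
          using v b by (auto simp: free_module_def carrier_mpoly_ring)
        show "x + y \<in> U" if "x \<in> U" "y \<in> monoms V" for x y
          using U that unfolding up_closed_def by (metis add.commute)
      qed
      then show ?thesis
        using v c by (auto simp: free_module_def scalar_prod_def intro!: mono_ideal_sum)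
    qed
    moreover have "\<exists>y\<in>free_module V (length s). D *\<^sub>v y = w"
      if w: "w \<in> free_module V 1" "w $ 0 \<in> mono_ideal U" for w
    proof (rule free_module_image[OF D])
      show w1: "w \<in> free_module V (length [0])" using w(1) by simp
      fix j
      \<comment> \<open>A monomial ideal contains the homogeneous components of its elements,
        because filtering only removes terms.\<close>
      have "hom_comp j (w $ 0) \<in> homogeneous_part V j \<inter> mono_ideal U"
        using w by (auto simp: hom_comp_homogeneous free_module_def)
          (auto simp: mono_ideal_def hom_comp_def keys_monom_filter)
      then obtain y where y: "y \<in> hvec V j s" "(D *\<^sub>v y) $ 0 = hom_comp j (w $ 0)"
        using L unfolding graded_augmentation_def by blast
      have "D *\<^sub>v y = hom_vec j [0] w"
        using y(2) c by (intro eq_vecI) (auto simp: hom_vec_def)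
      then show "\<exists>y\<in>hvec V j s. D *\<^sub>v y = hom_vec j [0] w" using y(1) by blast
    qed
    ultimately show ?R using graded_map_free_module[OF D] by auto
  next
    assume R: ?R
    have "D $$ (0, b) \<in> mono_ideal U" if b: "b < length s" for b
    proof -
      have "D *\<^sub>v unit_vec (length s) b \<in> (\<lambda>v. D *\<^sub>v v) ` free_module V (length s)"
        using hvec_free_module[OF unit_vec_hvec[OF b]] by blast
      then have "(D *\<^sub>v unit_vec (length s) b) $ 0 \<in> mono_ideal U" unfolding R by simp
      then show ?thesis using mult_unit_vec[OF c b] c b by simp
    qed
    moreover have "\<exists>y\<in>hvec V j s. (D *\<^sub>v y) $ 0 = p"
      if p: "p \<in> homogeneous_part V j \<inter> mono_ideal U" for j p
    proof -
      let ?z = "vec 1 (\<lambda>_. p)"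
      have z: "?z \<in> hvec V j [0]" using p by (simp add: hvec_def)
      have "?z \<in> (\<lambda>v. D *\<^sub>v v) ` free_module V (length s)"
        unfolding R using hvec_free_module[OF z] p by simp
      then obtain y where y: "y \<in> free_module V (length s)" "?z = D *\<^sub>v y" by blast
      have "D *\<^sub>v hom_vec j s y = ?z"
        using hom_vec_mult[OF D y(1)] y(2) hom_vec_id[OF z] by simp
      then have "(D *\<^sub>v hom_vec j s y) $ 0 = p" by simp
      then show ?thesis using hom_vec_hvec[OF y(1)] by blast
    qed
    ultimately show ?L using D by (simp add: graded_augmentation_def)
  qed
qed

text \<open>The bridge from the given definition to the homogeneous language: afterwards only
  degreewise exactness and vanishing constant coefficients matter.\<close>

lemma minimal_graded_free_resolution_iff:
  assumes U: "up_closed V U"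
  shows "minimal_graded_free_resolution V (mono_ideal U) d D \<longleftrightarrow>
    graded_resolution V U d D \<and>
    (\<forall>i. \<forall>a<length (d i). \<forall>b<length (d (Suc i)). Poly_Mapping.lookup (D (Suc i) $$ (a, b)) 0 = 0)"
    (is "?L \<longleftrightarrow> ?R")
proof -
  have "?L \<longleftrightarrow> graded_map V (d 0) [0] (D 0) \<and>
     (\<forall>i. graded_map V (d (Suc i)) (d i) (D (Suc i))) \<and>
     graded_augmentation V U (d 0) (D 0) \<and>
     (\<forall>i. graded_exact V (d (Suc i)) (d i) (D (Suc i)) (D i)) \<and>
     (\<forall>i. \<forall>a < length (d i). \<forall>b < length (d (Suc i)). D (Suc i) $$ (a, b) \<in> irrelevant_ideal V)"
    (is "_ \<longleftrightarrow> ?M")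
  proof (cases "graded_map V (d 0) [0] (D 0) \<and> (\<forall>i. graded_map V (d (Suc i)) (d i) (D (Suc i)))")
    case True
    have "graded_exact V (d (Suc i)) (d i) (D (Suc i)) (D i) \<longleftrightarrow>
      (\<lambda>v. D (Suc i) *\<^sub>v v) ` free_module V (length (d (Suc i))) =
          {w \<in> free_module V (length (d i)). D i *\<^sub>v w = 0\<^sub>v (dim_row (D i))}" for i
      using True by (cases i) (auto intro!: graded_exact_iff)
    then show ?thesis
      using True graded_augmentation_iff[OF _ U, of "d 0" "D 0"]
      by (simp add: minimal_graded_free_resolution_def)
  qed (auto simp: minimal_graded_free_resolution_def)
  also have "?M \<longleftrightarrow> ?R"
    unfolding graded_resolution_def irrelevant_ideal_iff
    by (auto simp: graded_augmentation_def graded_exact_def graded_map_def homogeneous_carrier)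
      (blast intro: homogeneous_carrier)
  finally show ?thesis .
qed

section \<open>Comparison with minimal resolutions\<close>

text \<open>Vanishing modulo the irrelevant ideal, the matrix form of minimality.\<close>

definition const_free :: "('a, 'k::field) mpoly mat \<Rightarrow> bool" where
  "const_free A \<longleftrightarrow> (\<forall>a<dim_row A. \<forall>b<dim_col A. Poly_Mapping.lookup (A $$ (a, b)) 0 = 0)"

lemma const_free_mult: "const_free A \<Longrightarrow> dim_col A = dim_row B \<Longrightarrow> const_free (A * B)"
  by (auto simp: const_free_def scalar_prod_def lookup_sum const_coeff_mult)

lemma const_free_mult_right: "const_free B \<Longrightarrow> dim_col A = dim_row B \<Longrightarrow> const_free (A * B)"
  by (auto simp: const_free_def scalar_prod_def lookup_sum const_coeff_mult)

lemma graded_exactI: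
  assumes D': "graded_map V u s D'" and D: "graded_map V s t D"
    and z: "\<And>j y. y \<in> hvec V j u \<Longrightarrow> D *\<^sub>v (D' *\<^sub>v y) = 0\<^sub>v (length t)"
    and ex: "\<And>j z. z \<in> hvec V j s \<Longrightarrow> D *\<^sub>v z = 0\<^sub>v (length t) \<Longrightarrow> \<exists>y\<in>hvec V j u. D' *\<^sub>v y = z"
  shows "graded_exact V u s D' D"
proof -
  note c = graded_map_carrier[OF D] graded_map_carrier[OF D']
  have "D * D' = 0\<^sub>m (dim_row D) (length u)"
  proof (rule mat_col_eqI)
    fix b assume "b < dim_col (0\<^sub>m (dim_row D) (length u) :: ('a, 'b) mpoly mat)"
    then have b: "b < length u" by simp
    have "D *\<^sub>v col D' b = 0\<^sub>v (dim_row D)"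
      using z[OF unit_vec_hvec[OF b]] mult_unit_vec[OF c(2) b] c by simp
    then show "col (D * D') b = col (0\<^sub>m (dim_row D) (length u)) b"
      using col_mult2[OF c b] b by auto
  qed (use c in auto)
  then show ?thesis using D' ex c by (auto simp: graded_exact_def)
qed

lemma graded_exact_mult_vec:
  assumes ex: "graded_exact V u s D' D" and D: "graded_map V s t D" and y: "y \<in> hvec V j u"
  shows "D *\<^sub>v (D' *\<^sub>v y) = 0\<^sub>v (length t)"
proof -
  have c: "D \<in> carrier_mat (length t) (length s)" "D' \<in> carrier_mat (length s) (length u)"
    using ex D by (auto simp: graded_exact_def graded_map_def)
  have "D *\<^sub>v (D' *\<^sub>v y) = (D * D') *\<^sub>v y"
    by (rule assoc_mult_mat_vec[OF c hvec_carrier[OF y], symmetric])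
  also have "D * D' = 0\<^sub>m (dim_row D) (length u)" using ex by (simp add: graded_exact_def)
  also have "\<dots> *\<^sub>v y = 0\<^sub>v (length t)" using hvec_carrier[OF y] c by auto
  finally show ?thesis .
qed

text \<open>\<open>D * X * Y = D\<close> says that the columns of \<open>D * X\<close> still
  generate the image of \<open>D\<close>. So the condition is that this image has no homogeneous
  generating system with fewer than \<open>length s\<close> elements.\<close>

definition irredundant :: "'a set \<Rightarrow> int list \<Rightarrow> ('a, 'k::field) mpoly mat \<Rightarrow> bool" where
  "irredundant V s D \<longleftrightarrow>
    (\<forall>s' X Y. graded_map V s' s X \<and> graded_map V s s' Y \<and> D * X * Y = D \<longrightarrow> length s \<le> length s')"

text \<open>A relation with a unit coefficient expresses one generator through the others.\<close>

lemma irredundant_const_free: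
  assumes irr: "irredundant V s D" and D: "graded_map V s t D" and ex: "graded_exact V u s D' D"
  shows "const_free D'"
proof (rule ccontr)
  assume "\<not> const_free D'"
  moreover have D': "graded_map V u s D'" using ex by (simp add: graded_exact_def)
  note c = graded_map_carrier[OF D] graded_map_carrier[OF D']
  ultimately obtain a b where a: "a < length s" and b: "b < length u"
    and nz: "Poly_Mapping.lookup (D' $$ (a, b)) 0 \<noteq> 0"
    by (auto simp: const_free_def)
  define w where "w = D' *\<^sub>v unit_vec (length u) b"
  have hw: "w \<in> hvec V (u ! b) s"
    unfolding w_def by (rule graded_map_mult_vec[OF D' unit_vec_hvec[OF b]])
  have wi: "w $ i = D' $$ (i, b)" if "i < length s" for i
    using mult_unit_vec[OF c(2) b] that c b unfolding w_def by simp
  have Dw: "D *\<^sub>v w = 0\<^sub>v (length t)"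
    unfolding w_def by (rule graded_exact_mult_vec[OF ex D unit_vec_hvec[OF b]])
  define k where "k = Poly_Mapping.lookup (w $ a) 0"
  have k: "k \<noteq> 0" using nz wi[OF a] by (simp add: k_def)
  \<comment> \<open>A nonzero constant coefficient sits in degree zero, which forces the two shifts
    to agree.\<close>
  have deg: "u ! b = s ! a"
  proof -
    have "w $ a \<in> homogeneous_part V (u ! b - s ! a)" using hw a by (simp add: hvec_def)
    moreover have "0 \<in> Poly_Mapping.keys (w $ a)" using k by (simp add: k_def in_keys_iff)
    ultimately show ?thesis by (fastforce simp: homogeneous_part_def)
  qed
  have wa: "w $ a = Poly_Mapping.single 0 k"
  proof -
    have "w $ a \<in> homogeneous_part V (u ! b - s ! a)" using hw a by (simp add: hvec_def)
    then show ?thesis unfolding k_def deg by (intro homogeneous_degree_0[of _ V]) simp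
  qed
  \<comment> \<open>The indices of the remaining generators; \<open>X\<close> includes them among
    all generators.\<close>
  define idx where "idx = filter (\<lambda>i. i \<noteq> a) [0..<length s]"
  have idx: "distinct idx" "set idx = {..<length s} - {a}" by (auto simp: idx_def)
  have idx_less: "idx ! j < length s" if "j < length idx" for j
    using nth_mem[OF that] idx by auto
  have sum_idx: "(\<Sum>j<length idx. f (idx ! j)) = (\<Sum>i\<in>{..<length s} - {a}. f i)"
    for f :: "nat \<Rightarrow> ('a, 'b) mpoly"
    using sum.reindex_bij_betw[OF bij_betw_nth[OF idx(1) refl refl], of f] idx(2)
    by (simp add: lessThan_atLeast0)
  define s' where "s' = map ((!) s) idx"
  define X :: "('a, 'b) mpoly mat" where
    "X = mat (length s) (length idx) (\<lambda>(i, j). if i = idx ! j then 1 else 0)"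
  have X: "graded_map V s' s X"
    using idx_less by (auto simp: X_def s'_def graded_map_def)
  have cX: "X \<in> carrier_mat (length s) (length s')" by (simp add: X_def s'_def)
  have DX: "D * X \<in> carrier_mat (length t) (length s')" using c cX by auto
  have DXi: "(D * X) $$ (r, j) = D $$ (r, idx ! j)" if "r < length t" "j < length idx" for r j
  proof -
    have "(D * X) $$ (r, j) = (\<Sum>i<length s. D $$ (r, i) * (if i = idx ! j then 1 else 0))"
      using that c by (auto simp: X_def scalar_prod_def lessThan_atLeast0 intro!: sum.cong)
    also have "\<dots> = D $$ (r, idx ! j)"
      using idx_less[OF that(2)] by (simp add: if_distrib cong: if_cong)
    finally show ?thesis .
  qed
  have "\<exists>y\<in>hvec V (s ! i) s'. (D * X) *\<^sub>v y = col D i" if i: "i < length s" for i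
  proof (cases "i = a")
    case False
    then have "i \<in> set idx" using idx i by auto
    then obtain j where j: "j < length idx" "idx ! j = i" by (auto simp: in_set_conv_nth)
    have "unit_vec (length s') j \<in> hvec V (s ! i) s'"
      using unit_vec_hvec[of j s' V] j by (simp add: s'_def)
    moreover have "(D * X) *\<^sub>v unit_vec (length s') j = col D i"
      using mult_unit_vec[OF DX, of j] j DXi c cX i by (auto simp: s'_def intro!: eq_vecI)
    ultimately show ?thesis by blast
  next
    case True
    \<comment> \<open>The relation \<open>w\<close>, divided by its unit coefficient
      \<open>k\<close> and solved for generator \<open>a\<close> in terms of the others.\<close>
    define y where "y = vec (length idx) (\<lambda>j. - (Poly_Mapping.single 0 (1 / k) * w $ (idx ! j)))"
    have "y $ j \<in> homogeneous_part V (s ! a - s' ! j)" if "j < length idx" for j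
      using homogeneous_mult[OF homogeneous_single[of 0 V 0 "1 / k"], of "w $ (idx ! j)" "s ! a - s' ! j"]
        hw idx_less[OF that] that deg by (simp add: y_def s'_def hvec_def)
    then have "y \<in> hvec V (s ! i) s'" using True by (simp add: hvec_def y_def s'_def)
    moreover have "(D * X) *\<^sub>v y = col D i"
    proof (rule eq_vecI)
      fix r assume "r < dim_vec (col D i)"
      then have r: "r < length t" using c by simp
      have "((D * X) *\<^sub>v y) $ r = (\<Sum>j<length idx. (D * X) $$ (r, j) * y $ j)"
        using r DX c by (auto simp: scalar_prod_def lessThan_atLeast0 y_def s'_def simp del: index_mult_mat(1)
            intro!: sum.cong)
      also have "\<dots> = (\<Sum>j<length idx. - (Poly_Mapping.single 0 (1 / k) * (D $$ (r, idx ! j) * w $ (idx ! j))))"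
        using DXi[OF r] by (auto simp: y_def algebra_simps intro!: sum.cong)
      also have "\<dots> = (\<Sum>i\<in>{..<length s} - {a}. - (Poly_Mapping.single 0 (1 / k) * (D $$ (r, i) * w $ i)))"
        by (rule sum_idx)
      also have "\<dots> = - (Poly_Mapping.single 0 (1 / k) * (\<Sum>i\<in>{..<length s} - {a}. D $$ (r, i) * w $ i))"
        by (simp add: sum_negf sum_distrib_left)
      also have "(\<Sum>i\<in>{..<length s} - {a}. D $$ (r, i) * w $ i) = - (D $$ (r, a) * w $ a)"
      proof -
        have "(\<Sum>i<length s. D $$ (r, i) * w $ i) = (D *\<^sub>v w) $ r"
          using r c hvec_carrier[OF hw] by (auto simp: scalar_prod_def lessThan_atLeast0 intro!: sum.cong)
        then have "(\<Sum>i<length s. D $$ (r, i) * w $ i) = 0" using Dw r by simp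
        then show ?thesis
          using a by (simp add: sum.remove[of "{..<length s}" a] eq_neg_iff_add_eq_0 add.commute)
      qed
      also have "- (Poly_Mapping.single 0 (1 / k) * - (D $$ (r, a) * w $ a)) = D $$ (r, a)"
      proof -
        have "Poly_Mapping.single (0 :: 'a \<Rightarrow>\<^sub>0 nat) (1 / k) * Poly_Mapping.single 0 k = 1"
          using k by (simp add: mult_single)
        then show ?thesis by (simp add: wa mult.left_commute)
      qed
      finally show "((D * X) *\<^sub>v y) $ r = col D i $ r" using True r a c by simp
    qed (use c DX in auto)
    ultimately show ?thesis by blast
  qed
  then obtain Y where "graded_map V s s' Y" "D * X * Y = D"
    using graded_map_of_cols[of s V s' "D * X" D t] DX c by metis
  then have "length s \<le> length s'" using irr X unfolding irredundant_def by blast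
  also have "\<dots> = card (set idx)" using distinct_card[OF idx(1)] by (simp add: s'_def)
  also have "\<dots> < length s" using idx(2) a by simp
  finally show False by simp
qed

text \<open>Among all shift lists of exact continuations of \<open>D\<close>, one of least length is
  taken; a factorization through a shorter list would itself give an exact continuation.\<close>

lemma exact_irredundant:
  assumes ex: "graded_exact V u s W D" and D: "graded_map V s t D"
  obtains u' W' where "graded_exact V u' s W' D" "irredundant V u' W'"
proof -
  obtain u' where u': "\<exists>W. graded_exact V u' s W D"
    and min: "\<And>v. \<exists>W. graded_exact V v s W D \<Longrightarrow> length u' \<le> length v"
    using ex_has_least_nat[of "\<lambda>u. \<exists>W. graded_exact V u s W D" u length] ex by blast
  obtain W' where W': "graded_exact V u' s W' D" using u' by blast
  have gW': "graded_map V u' s W'" using W' by (simp add: graded_exact_def)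
  have "irredundant V u' W'"
    unfolding irredundant_def
  proof (intro allI impI, elim conjE)
    fix v X Y assume X: "graded_map V v u' X" and Y: "graded_map V u' v Y" and eq: "W' * X * Y = W'"
    note c = graded_map_carrier[OF gW'] graded_map_carrier[OF X] graded_map_carrier[OF Y]
    have "graded_exact V v s (W' * X) D"
    proof (rule graded_exactI[OF graded_map_mult[OF gW' X] D])
      fix j and y :: "('a, 'b) mpoly vec" assume y: "y \<in> hvec V j v"
      show "D *\<^sub>v (W' * X *\<^sub>v y) = 0\<^sub>v (length t)"
        using graded_exact_mult_vec[OF W' D graded_map_mult_vec[OF X y]]
          assoc_mult_mat_vec[OF c(1,2) hvec_carrier[OF y]] by simp
    next
      fix j and z :: "('a, 'b) mpoly vec" assume z: "z \<in> hvec V j s" "D *\<^sub>v z = 0\<^sub>v (length t)"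
      then obtain y where y: "y \<in> hvec V j u'" "W' *\<^sub>v y = z"
        using W' graded_map_carrier[OF D] by (auto simp: graded_exact_def)
      have "(W' * X) *\<^sub>v (Y *\<^sub>v y) = (W' * X * Y) *\<^sub>v y"
        by (rule assoc_mult_mat_vec[OF _ c(3) hvec_carrier[OF y(1)], symmetric])
          (use c in auto)
      then have "(W' * X) *\<^sub>v (Y *\<^sub>v y) = z" using y(2) eq by simp
      then show "\<exists>y\<in>hvec V j v. (W' * X) *\<^sub>v y = z" using graded_map_mult_vec[OF Y y(1)] by blast
    qed
    then show "length u' \<le> length v" using min by blast
  qed
  then show thesis using W' that by blast
qed

text \<open>The same choice of least length, now for generators of the ideal itself; it starts the
  construction of a minimal resolution.\<close>

lemma augmentation_irredundant:
  fixes W :: "('a, 'b::field) mpoly mat"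
  assumes ex: "graded_augmentation V U u W" and U: "up_closed V U"
  obtains u' and W' :: "('a, 'b) mpoly mat" where "graded_augmentation V U u' W'" "irredundant V u' W'"
proof -
  obtain u' where u': "\<exists>W :: ('a, 'b) mpoly mat. graded_augmentation V U u' W"
    and min: "\<And>v. \<exists>W :: ('a, 'b) mpoly mat. graded_augmentation V U v W \<Longrightarrow> length u' \<le> length v"
    using ex_has_least_nat[of "\<lambda>u. \<exists>W :: ('a, 'b) mpoly mat. graded_augmentation V U u W" u length] ex
    by blast
  obtain W' :: "('a, 'b) mpoly mat" where W': "graded_augmentation V U u' W'" using u' by blast
  have gW': "graded_map V u' [0] W'" using W' by (simp add: graded_augmentation_def)
  have "irredundant V u' W'"
    unfolding irredundant_def
  proof (intro allI impI, elim conjE)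
    fix v X Y assume X: "graded_map V v u' X" and Y: "graded_map V u' v Y" and eq: "W' * X * Y = W'"
    note c = graded_map_carrier[OF gW'] graded_map_carrier[OF X] graded_map_carrier[OF Y]
    have "graded_augmentation V U v (W' * X)"
      unfolding graded_augmentation_def
    proof (intro conjI allI impI ballI)
      show "graded_map V v [0] (W' * X)" by (rule graded_map_mult[OF gW' X])
    next
      fix b assume b: "b < length v"
      have "W' $$ (0, i) * X $$ (i, b) \<in> mono_ideal U" if "i < length u'" for i
      proof (rule mono_ideal_mult)
        show "W' $$ (0, i) \<in> mono_ideal U" using W' that by (simp add: graded_augmentation_def)
        show "X $$ (i, b) \<in> mono_ideal (monoms V)"
          using X b that homogeneous_carrier by (fastforce simp: graded_map_def carrier_mpoly_ring)
        show "x + y \<in> U" if "x \<in> U" "y \<in> monoms V" for x y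
          using U that unfolding up_closed_def by (metis add.commute)
      qed
      then show "(W' * X) $$ (0, b) \<in> mono_ideal U"
        using c b by (auto simp: scalar_prod_def intro!: mono_ideal_sum)
    next
      fix j and p :: "('a, 'b) mpoly" assume "p \<in> homogeneous_part V j \<inter> mono_ideal U"
      then obtain y where y: "y \<in> hvec V j u'" "(W' *\<^sub>v y) $ 0 = p"
        using W' unfolding graded_augmentation_def by blast
      have "(W' * X) *\<^sub>v (Y *\<^sub>v y) = (W' * X * Y) *\<^sub>v y"
        by (rule assoc_mult_mat_vec[OF _ c(3) hvec_carrier[OF y(1)], symmetric])
          (use c in auto)
      then have "((W' * X) *\<^sub>v (Y *\<^sub>v y)) $ 0 = p" using y(2) eq by simp
      then show "\<exists>y\<in>hvec V j v. ((W' * X) *\<^sub>v y) $ 0 = p"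
        using graded_map_mult_vec[OF Y y(1)] by blast
    qed
    then show "length u' \<le> length v" using min by blast
  qed
  then show thesis using W' that by blast
qed

text \<open>
  The state at level \<open>i\<close> of a comparison between a partial minimal resolution, with differential
  \<open>D\<close>, and a resolution \<open>(e, E)\<close>: maps \<open>\<phi>\<close>, \<open>\<psi>\<close> in both directions and the homotopy term
  \<open>g\<close>.  Only what the next level needs is recorded, so no earlier level has to be mentioned.
\<close>

definition comparison ::
  "'a set \<Rightarrow> int list \<Rightarrow> ('a, 'k::field) mpoly mat \<Rightarrow> int list \<Rightarrow> int list \<Rightarrow> ('a, 'k) mpoly mat \<Rightarrow> bool" where
  "comparison V e E t s D \<longleftrightarrow> (\<exists>\<phi> \<psi> \<phi>' \<psi>' g.
     graded_map V s e \<phi> \<and> graded_map V e s \<psi> \<and> graded_map V t s g \<and>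
     \<phi>' \<in> carrier_mat (dim_row E) (length t) \<and> \<psi>' \<in> carrier_mat (length t) (dim_row E) \<and>
     E * \<phi> = \<phi>' * D \<and> D * \<psi> = \<psi>' * E \<and> const_free (g * D) \<and>
     D * (1\<^sub>m (length s) - \<psi> * \<phi> + g * D) = 0\<^sub>m (length t) (length s))"

text \<open>Both augmentations have the same ideal as image, so each factors through the other. On
  the ring itself both maps are the identity, and the homotopy term is zero.\<close>

lemma comparison_base:
  assumes E: "graded_augmentation V U e E" and D: "graded_augmentation V U s D"
  shows "comparison V e E [0] s D"
proof -
  have gE: "graded_map V e [0] E" and gD: "graded_map V s [0] D"
    using E D by (auto simp: graded_augmentation_def)
  obtain \<phi> where \<phi>: "graded_map V s e \<phi>" "E * \<phi> = D"
    using D by (auto simp: graded_augmentation_def intro: graded_augmentation_lift[OF E gD])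
  obtain \<psi> where \<psi>: "graded_map V e s \<psi>" "D * \<psi> = E"
    using E by (auto simp: graded_augmentation_def intro: graded_augmentation_lift[OF D gE])
  note c = graded_map_carrier[OF gE] graded_map_carrier[OF gD] graded_map_carrier[OF \<phi>(1)]
    graded_map_carrier[OF \<psi>(1)]
  let ?g = "0\<^sub>m (length s) 1 :: ('a, 'b) mpoly mat"
  have gD0: "?g * D = 0\<^sub>m (length s) (length s)" using c by simp
  have "D * (\<psi> * \<phi>) = D" using assoc_mult_mat[OF c(2,4,3)] \<phi> \<psi> by simp
  moreover have "1\<^sub>m (length s) - \<psi> * \<phi> + ?g * D = 1\<^sub>m (length s) - \<psi> * \<phi>"
    unfolding gD0 using c by (intro eq_matI) auto
  moreover have "D * (1\<^sub>m (length s) - \<psi> * \<phi>) = D * 1\<^sub>m (length s) - D * (\<psi> * \<phi>)"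
    by (rule mult_minus_distrib_mat[OF c(2)]) (use c in auto)
  ultimately have z: "D * (1\<^sub>m (length s) - \<psi> * \<phi> + ?g * D) = 0\<^sub>m (length [0::int]) (length s)" using c by auto
  show ?thesis
    unfolding comparison_def
    by (rule exI[of _ \<phi>], rule exI[of _ \<psi>], rule exI[of _ "1\<^sub>m 1"], rule exI[of _ "1\<^sub>m 1"], rule exI[of _ ?g])
      (use \<phi> \<psi> c z graded_map_zero[of V "[0]" s] in \<open>auto simp: gD0 const_free_def\<close>)
qed

text \<open>The columns of \<open>1 - \<psi> * \<phi> + g * D\<close> lie in the kernel of
  \<open>D\<close>, so this matrix is \<open>D' * h\<close>. The new homotopy term is
  \<open>- h\<close>, and its product with \<open>D'\<close> has no constant coefficients because
  \<open>D'\<close> has none.\<close>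

lemma comparison_step:
  assumes cmp: "comparison V e E t s D" and E: "graded_map V e r E" and D: "graded_map V s t D"
    and exE: "graded_exact V e' e E' E" and exD: "graded_exact V u s D' D" and cf: "const_free D'"
  shows "comparison V e' E' s u D'"
proof -
  obtain \<phi> \<psi> \<phi>' \<psi>' g where maps: "graded_map V s e \<phi>" "graded_map V e s \<psi>" "graded_map V t s g"
    and c': "\<phi>' \<in> carrier_mat (length r) (length t)" "\<psi>' \<in> carrier_mat (length t) (length r)"
    and eq: "E * \<phi> = \<phi>' * D" "D * \<psi> = \<psi>' * E"
    and z: "D * (1\<^sub>m (length s) - \<psi> * \<phi> + g * D) = 0\<^sub>m (length t) (length s)"
    using cmp graded_map_carrier[OF E] unfolding comparison_def by auto
  have gE': "graded_map V e' e E'" and gD': "graded_map V u s D'"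
    using exE exD by (auto simp: graded_exact_def)
  note c = graded_map_carrier[OF E] graded_map_carrier[OF D] graded_map_carrier[OF gE']
    graded_map_carrier[OF gD'] maps[THEN graded_map_carrier]
  have EE: "E * E' = 0\<^sub>m (length r) (length e')" and DD: "D * D' = 0\<^sub>m (length t) (length u)"
    using exE exD c by (auto simp: graded_exact_def)
  have "E * (\<phi> * D') = \<phi>' * (D * D')"
    using assoc_mult_mat[OF c(1,5,4)] assoc_mult_mat[OF c'(1) c(2,4)] eq(1) by simp
  then have "E * (\<phi> * D') = 0\<^sub>m (length r) (length u)" using DD c' by simp
  then obtain \<phi>2 where \<phi>2: "graded_map V u e' \<phi>2" "E' * \<phi>2 = \<phi> * D'"
    using graded_exact_lift[OF exE E graded_map_mult[OF maps(1) gD']] by metis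
  have "D * (\<psi> * E') = \<psi>' * (E * E')"
    using assoc_mult_mat[OF c(2,6,3)] assoc_mult_mat[OF c'(2) c(1,3)] eq(2) by simp
  then have "D * (\<psi> * E') = 0\<^sub>m (length t) (length e')" using EE c' by simp
  then obtain \<psi>2 where \<psi>2: "graded_map V e' u \<psi>2" "D' * \<psi>2 = \<psi> * E'"
    using graded_exact_lift[OF exD D graded_map_mult[OF maps(2) gE']] by metis
  let ?K = "1\<^sub>m (length s) - \<psi> * \<phi> + g * D"
  have gK: "graded_map V s s ?K"
    by (intro graded_map_add graded_map_diff graded_map_one graded_map_mult[OF maps(2,1)]
        graded_map_mult[OF maps(3) D])
  then obtain h where h: "graded_map V s u h" "D' * h = ?K"
    using graded_exact_lift[OF exD D _ z] by metis
  note c2 = graded_map_carrier[OF \<phi>2(1)] graded_map_carrier[OF \<psi>2(1)] graded_map_carrier[OF h(1)]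
    graded_map_carrier[OF gK]
  have "D' * (1\<^sub>m (length u) - \<psi>2 * \<phi>2 + - h * D') = 0\<^sub>m (length s) (length u)"
  proof -
    have 1: "D' * (\<psi>2 * \<phi>2) = \<psi> * \<phi> * D'"
      using assoc_mult_mat[OF c(4) c2(2,1)] assoc_mult_mat[OF c(6,3) c2(1)]
        assoc_mult_mat[OF c(6,5,4)] \<phi>2 \<psi>2 by simp
    have 2: "D' * (- h * D') = - (?K * D')"
      using assoc_mult_mat[OF c(4) c2(3) c(4)] c c2 h(2) by simp
    \<comment> \<open>Here \<open>g * D * D' = 0\<close> removes the old homotopy term; together
      with the new term \<open>- h * D'\<close> everything cancels.\<close>
    have 3: "?K * D' = D' - \<psi> * \<phi> * D'"
    proof -
      have "g * D * D' = 0\<^sub>m (length s) (length u)"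
        using assoc_mult_mat[OF c(7,2,4)] DD c by simp
      moreover have "?K * D' = (1\<^sub>m (length s) - \<psi> * \<phi>) * D' + g * D * D'"
        by (rule add_mult_distrib_mat[of _ "length s" "length s" _ _ "length u"]) (use c in auto)
      moreover have "(1\<^sub>m (length s) - \<psi> * \<phi>) * D' = 1\<^sub>m (length s) * D' - \<psi> * \<phi> * D'"
        by (rule minus_mult_distrib_mat[of _ "length s" "length s" _ _ "length u"]) (use c in auto)
      ultimately show ?thesis using c by auto
    qed
    have "D' * (1\<^sub>m (length u) - \<psi>2 * \<phi>2 + - h * D')
        = D' * (1\<^sub>m (length u) - \<psi>2 * \<phi>2) + D' * (- h * D')"
      by (rule mult_add_distrib_mat[of _ "length s" "length u" _ "length u"]) (use c c2 in auto)
    also have "D' * (1\<^sub>m (length u) - \<psi>2 * \<phi>2) = D' * 1\<^sub>m (length u) - D' * (\<psi>2 * \<phi>2)"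
      by (rule mult_minus_distrib_mat[of _ "length s" "length u" _ "length u"]) (use c c2 in auto)
    finally show ?thesis using c c2 unfolding 1 2 3 by (intro eq_matI) auto
  qed
  moreover have "const_free (- h * D')"
    using cf c c2 by (intro const_free_mult_right) auto
  moreover have "dim_row E' = length e" using c by simp
  ultimately show ?thesis
    unfolding comparison_def
    using \<phi>2 \<psi>2 graded_map_uminus[OF h(1)] c(5,6) by metis
qed

text \<open>The matrix \<open>1 - \<psi> * \<phi> + g * D\<close> factors through \<open>D'\<close>,
  so its constant coefficients vanish, as do those of \<open>g * D\<close>. Hence
  \<open>\<psi> * \<phi>\<close> has constant coefficient 1 in every diagonal entry.\<close>

lemma comparison_shifts:
  assumes cmp: "comparison V e E t s D" and D: "graded_map V s t D"
    and exD: "graded_exact V u s D' D" and cf: "const_free D'"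
  shows "set s \<subseteq> set e"
proof
  obtain \<phi> \<psi> g where maps: "graded_map V s e \<phi>" "graded_map V e s \<psi>" "graded_map V t s g"
    and cg: "const_free (g * D)"
    and z: "D * (1\<^sub>m (length s) - \<psi> * \<phi> + g * D) = 0\<^sub>m (length t) (length s)"
    using cmp unfolding comparison_def by auto
  have gD': "graded_map V u s D'" using exD by (auto simp: graded_exact_def)
  let ?K = "1\<^sub>m (length s) - \<psi> * \<phi> + g * D"
  have gK: "graded_map V s s ?K"
    by (intro graded_map_add graded_map_diff graded_map_one graded_map_mult[OF maps(2,1)]
        graded_map_mult[OF maps(3) D])
  then obtain h where h: "graded_map V s u h" "D' * h = ?K"
    using graded_exact_lift[OF exD D _ z] by metis
  note c = graded_map_carrier[OF D] graded_map_carrier[OF gD'] maps[THEN graded_map_carrier]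
    graded_map_carrier[OF h(1)]
  have "const_free ?K" using const_free_mult[OF cf, of h] h(2) c by simp
  fix j assume "j \<in> set s"
  then obtain b where b: "b < length s" "j = s ! b" by (auto simp: in_set_conv_nth)
  have "?K \<in> carrier_mat (length s) (length s)" using graded_map_carrier[OF gK] .
  then have "0 = Poly_Mapping.lookup (?K $$ (b, b)) 0"
    using \<open>const_free ?K\<close> b(1) unfolding const_free_def by (metis carrier_matD)
  also have "\<dots> = 1 - Poly_Mapping.lookup ((\<psi> * \<phi>) $$ (b, b)) 0"
    using cg b(1) c by (simp add: const_free_def lookup_add lookup_minus del: index_mult_mat(1))
  finally have "(\<Sum>a<length e. Poly_Mapping.lookup (\<psi> $$ (b, a)) 0 * Poly_Mapping.lookup (\<phi> $$ (a, b)) 0) \<noteq> 0"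
    using b(1) c by (simp add: scalar_prod_def lookup_sum const_coeff_mult lessThan_atLeast0)
  \<comment> \<open>Some summand of the diagonal entry is nonzero. An entry of \<open>\<psi>\<close>
    with a constant term, from generator \<open>a\<close> to generator \<open>b\<close>, is possible
    only when their shifts agree.\<close>
  then obtain a where a: "a < length e" "Poly_Mapping.lookup (\<psi> $$ (b, a)) 0 \<noteq> 0"
    by (metis (no_types, lifting) lessThan_iff mult_zero_left sum.neutral)
  have "\<psi> $$ (b, a) \<in> homogeneous_part V (e ! a - s ! b)"
    using maps(2) a b by (simp add: graded_map_def)
  moreover have "0 \<in> Poly_Mapping.keys (\<psi> $$ (b, a))" using a(2) by (simp add: in_keys_iff)
  ultimately have "e ! a = s ! b" by (fastforce simp: homogeneous_part_def)
  then show "j \<in> set e" using a(1) b(2) by (metis nth_mem)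
qed

lemma vec_diff_add_cancel:
  fixes v w :: "'b::ab_group_add vec"
  shows "v \<in> carrier_vec n \<Longrightarrow> w \<in> carrier_vec n \<Longrightarrow> v - w + w = v"
  by (intro eq_vecI) auto

text \<open>If \<open>D\<close> kills \<open>x\<close>, then \<open>E\<close> kills the image of
  \<open>x\<close> under \<open>\<phi>\<close>, which is therefore \<open>E'\<close> applied to some
  \<open>y\<close>, and x = (1 - \<psi> \<phi> + g D) x + \<psi> E' y. So the kernel of
  \<open>D\<close> is generated by the columns of these two matrices.\<close>

lemma comparison_finite:
  assumes cmp: "comparison V e E t s D" and E: "graded_map V e r E" and D: "graded_map V s t D"
    and exE: "graded_exact V e' e E' E"
  obtains u W where "graded_exact V u s W D"
proof -
  obtain \<phi> \<psi> \<phi>' \<psi>' g where maps: "graded_map V s e \<phi>" "graded_map V e s \<psi>" "graded_map V t s g"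
    and c': "\<phi>' \<in> carrier_mat (length r) (length t)" "\<psi>' \<in> carrier_mat (length t) (length r)"
    and eq: "E * \<phi> = \<phi>' * D" "D * \<psi> = \<psi>' * E"
    and z: "D * (1\<^sub>m (length s) - \<psi> * \<phi> + g * D) = 0\<^sub>m (length t) (length s)"
    using cmp graded_map_carrier[OF E] unfolding comparison_def by auto
  have gE': "graded_map V e' e E'" using exE by (auto simp: graded_exact_def)
  let ?K = "1\<^sub>m (length s) - \<psi> * \<phi> + g * D"
  have gK: "graded_map V s s ?K"
    by (intro graded_map_add graded_map_diff graded_map_one graded_map_mult[OF maps(2,1)]
        graded_map_mult[OF maps(3) D])
  note c = graded_map_carrier[OF E] graded_map_carrier[OF D] graded_map_carrier[OF gE']
    graded_map_carrier[OF gK] maps[THEN graded_map_carrier]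
  let ?P = "\<psi> * E'"
  \<comment> \<open>The block row of the two matrices, written as a block matrix whose lower blocks
    have no rows.\<close>
  let ?W = "four_block_mat ?K ?P (0\<^sub>m 0 (length s)) (0\<^sub>m 0 (length e'))"
  have gP: "graded_map V e' s ?P" by (rule graded_map_mult[OF maps(2) gE'])
  note cP = graded_map_carrier[OF gP]
  have gW: "graded_map V (s @ e') s ?W"
    using graded_map_four_block[OF gK gP, of "[]"] graded_map_zero[of V s "[]"] graded_map_zero[of V e' "[]"]
    by simp
  have W: "?W *\<^sub>v (x @\<^sub>v y) = ?K *\<^sub>v x + ?P *\<^sub>v y"
    if x: "x \<in> carrier_vec (length s)" and y: "y \<in> carrier_vec (length e')" for x y
  proof -
    have v0: "(v @\<^sub>v w) = v" if "dim_vec w = 0" for v w :: "('a, 'b) mpoly vec"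
      using that by (intro eq_vecI) auto
    show ?thesis
      by (subst four_block_mat_mult_vec[OF c(4) cP _ _ x y]) (use x y in \<open>auto intro!: v0\<close>)
  qed
  have "graded_exact V (s @ e') s ?W D"
  proof (rule graded_exactI[OF gW D])
    fix j and y :: "('a, 'b) mpoly vec" assume "y \<in> hvec V j (s @ e')"
    then obtain v w where y: "y = v @\<^sub>v w" "v \<in> hvec V j s" "w \<in> hvec V j e'" by (rule hvec_appendE)
    note cv = hvec_carrier[OF y(2)] hvec_carrier[OF y(3)]
    have "D *\<^sub>v (?W *\<^sub>v y) = D *\<^sub>v (?K *\<^sub>v v + ?P *\<^sub>v w)" using W[OF cv] y(1) by simp
    also have "\<dots> = D *\<^sub>v (?K *\<^sub>v v) + D *\<^sub>v (?P *\<^sub>v w)"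
      by (rule mult_add_distrib_mat_vec[OF c(2)]) (use cv c(4) cP in \<open>blast intro: mult_mat_vec_carrier\<close>)+
    also have "D *\<^sub>v (?K *\<^sub>v v) = 0\<^sub>v (length t)"
    proof -
      have "D *\<^sub>v (?K *\<^sub>v v) = (D * ?K) *\<^sub>v v"
        by (rule assoc_mult_mat_vec[OF c(2,4) cv(1), symmetric])
      also have "\<dots> = 0\<^sub>v (length t)" unfolding z using cv by auto
      finally show ?thesis .
    qed
    also have "D *\<^sub>v (?P *\<^sub>v w) = \<psi>' *\<^sub>v (E *\<^sub>v (E' *\<^sub>v w))"
    proof -
      have w1: "E' *\<^sub>v w \<in> carrier_vec (length e)" using c(3) cv(2) by (rule mult_mat_vec_carrier)
      have "D *\<^sub>v (?P *\<^sub>v w) = D *\<^sub>v (\<psi> *\<^sub>v (E' *\<^sub>v w))" using assoc_mult_mat_vec[OF c(6,3) cv(2)] by simp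
      also have "\<dots> = (\<psi>' * E) *\<^sub>v (E' *\<^sub>v w)" using assoc_mult_mat_vec[OF c(2,6) w1] eq(2) by simp
      also have "\<dots> = \<psi>' *\<^sub>v (E *\<^sub>v (E' *\<^sub>v w))" by (rule assoc_mult_mat_vec[OF c'(2) c(1) w1])
      finally show ?thesis .
    qed
    also have "E *\<^sub>v (E' *\<^sub>v w) = 0\<^sub>v (length r)" by (rule graded_exact_mult_vec[OF exE E y(3)])
    finally show "D *\<^sub>v (?W *\<^sub>v y) = 0\<^sub>v (length t)" using c' by auto
  next
    fix j and x :: "('a, 'b) mpoly vec" assume x: "x \<in> hvec V j s" "D *\<^sub>v x = 0\<^sub>v (length t)"
    note cx = hvec_carrier[OF x(1)]
    have "E *\<^sub>v (\<phi> *\<^sub>v x) = \<phi>' *\<^sub>v (D *\<^sub>v x)"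
      using assoc_mult_mat_vec[OF c(1,5) cx] assoc_mult_mat_vec[OF c'(1) c(2) cx] eq(1) by simp
    then have "E *\<^sub>v (\<phi> *\<^sub>v x) = 0\<^sub>v (dim_row E)" using x(2) c' c(1) by auto
    then obtain y where y: "y \<in> hvec V j e'" "E' *\<^sub>v y = \<phi> *\<^sub>v x"
      using exE graded_map_mult_vec[OF maps(1) x(1)] unfolding graded_exact_def by blast
    have \<psi>\<phi>x: "(\<psi> * \<phi>) *\<^sub>v x \<in> carrier_vec (length s)" using c cx by auto
    have "?K *\<^sub>v x = (1\<^sub>m (length s) - \<psi> * \<phi>) *\<^sub>v x + (g * D) *\<^sub>v x"
      by (rule add_mult_distrib_mat_vec[of _ "length s" "length s"]) (use c cx in auto)
    also have "(1\<^sub>m (length s) - \<psi> * \<phi>) *\<^sub>v x = 1\<^sub>m (length s) *\<^sub>v x - (\<psi> * \<phi>) *\<^sub>v x"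
      by (rule minus_mult_distrib_mat_vec[of _ "length s" "length s"]) (use c cx in auto)
    also have "(g * D) *\<^sub>v x = 0\<^sub>v (length s)"
      using assoc_mult_mat_vec[OF c(7,2) cx] x(2) c(7) by auto
    finally have K: "?K *\<^sub>v x = x - (\<psi> * \<phi>) *\<^sub>v x" using \<psi>\<phi>x cx by auto
    have P: "?P *\<^sub>v y = (\<psi> * \<phi>) *\<^sub>v x"
      using assoc_mult_mat_vec[OF c(6,3) hvec_carrier[OF y(1)]] assoc_mult_mat_vec[OF c(6,5) cx] y(2) by simp
    have "?W *\<^sub>v (x @\<^sub>v y) = x"
      unfolding W[OF cx hvec_carrier[OF y(1)]] K P
      by (rule vec_diff_add_cancel[OF cx \<psi>\<phi>x])
    then show "\<exists>y\<in>hvec V j (s @ e'). ?W *\<^sub>v y = x" using hvec_append[OF x(1) y(1)] by blast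
  qed
  then show thesis by (rule that)
qed

section \<open>Existence of a minimal resolution and comparison of its shifts\<close>

lemma graded_resolution_map':
  "graded_resolution V U d D \<Longrightarrow> graded_map V (d i) (case i of 0 \<Rightarrow> [0] | Suc j \<Rightarrow> d j) (D i)"
  using graded_resolution_map by (cases i) auto

text \<open>Each level is generated irredundantly, which makes the next differential free of
  constants. This in turn allows the next comparison step, and the comparison supplies finitely many
  generators for the kernel after that.\<close>

lemma resolution_exists_const_free:
  fixes E :: "nat \<Rightarrow> ('a, 'k::field) mpoly mat"
  assumes res: "graded_resolution V U e E" and U: "up_closed V U"
  shows "\<exists>d (D :: nat \<Rightarrow> ('a, 'k) mpoly mat). graded_resolution V U d D \<and> (\<forall>i. const_free (D (Suc i)))"
proof -
  \<comment> \<open>A state consists of target shifts, source shifts and differential; the target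
    shifts are kept because the comparison refers to them.\<close>
  define P :: "nat \<Rightarrow> int list \<times> int list \<times> ('a, 'k) mpoly mat \<Rightarrow> bool" where
    "P = (\<lambda>i (t, s, D). comparison V (e i) (E i) t s D \<and> graded_map V s t D \<and> irredundant V s D
      \<and> (i = 0 \<longrightarrow> graded_augmentation V U s D))"
  define R :: "int list \<times> int list \<times> ('a, 'k) mpoly mat \<Rightarrow> int list \<times> int list \<times> ('a, 'k) mpoly mat \<Rightarrow> bool"
    where "R = (\<lambda>(t, s, D) (t', s', D'). graded_exact V s' s D' D \<and> const_free D')"
  have aug: "graded_augmentation V U (e 0) (E 0)"
    and ex: "\<And>i. graded_exact V (e (Suc i)) (e i) (E (Suc i)) (E i)"
    using res by (auto simp: graded_resolution_def)
  note r = graded_resolution_map'[OF res]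
  obtain f where f: "\<And>i. P i (f i)" "\<And>i. R (f i) (f (Suc i))"
  proof -
    obtain s0 and D0 :: "('a, 'k) mpoly mat"
      where D0: "graded_augmentation V U s0 D0" "irredundant V s0 D0"
      by (rule augmentation_irredundant[OF aug U])
    have "P 0 ([0], s0, D0)"
      using D0 comparison_base[OF aug D0(1)] by (auto simp: P_def graded_augmentation_def)
    then have base: "\<exists>x. P 0 x" by blast
    have step: "\<exists>y. P (Suc i) y \<and> R x y" if Px: "P i x" for x i
    proof -
      obtain t s D where x: "x = (t, s, D)" by (cases x)
      have cmp: "comparison V (e i) (E i) t s D" and D: "graded_map V s t D" and irr: "irredundant V s D"
        using Px by (auto simp: P_def x)
      \<comment> \<open>The given resolution provides a finite generating system of the kernel,
        which is then made irredundant.\<close>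
      obtain u0 W0 where "graded_exact V u0 s W0 D" by (rule comparison_finite[OF cmp r D ex])
      then obtain u W where W: "graded_exact V u s W D" "irredundant V u W"
        using exact_irredundant[OF _ D] by metis
      have cf: "const_free W" by (rule irredundant_const_free[OF irr D W(1)])
      have "comparison V (e (Suc i)) (E (Suc i)) s u W" by (rule comparison_step[OF cmp r D ex W(1) cf])
      then have "P (Suc i) (s, u, W)" using W by (auto simp: P_def graded_exact_def)
      moreover have "R x (s, u, W)" using W cf by (simp add: R_def x)
      ultimately show ?thesis by blast
    qed
    show thesis using dependent_nat_choice[of P "\<lambda>_. R", OF base step] that by blast
  qed
  define d where "d i = fst (snd (f i))" for i
  define D where "D i = snd (snd (f i))" for i
  have "graded_augmentation V U (d 0) (D 0)"
    using f(1)[of 0] by (auto simp: P_def d_def D_def split: prod.splits)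
  moreover have "graded_exact V (d (Suc i)) (d i) (D (Suc i)) (D i) \<and> const_free (D (Suc i))" for i
    using f(2)[of i] by (auto simp: R_def d_def D_def split: prod.splits)
  ultimately show ?thesis unfolding graded_resolution_def by blast
qed

lemma const_free_resolution_shifts:
  fixes D E :: "nat \<Rightarrow> ('a, 'k::field) mpoly mat"
  assumes E: "graded_resolution V U e E" and D: "graded_resolution V U d D"
    and cf: "\<And>i. const_free (D (Suc i))"
  shows "set (d i) \<subseteq> set (e i)"
proof -
  have aug: "graded_augmentation V U (e 0) (E 0)" "graded_augmentation V U (d 0) (D 0)"
    and exE: "\<And>i. graded_exact V (e (Suc i)) (e i) (E (Suc i)) (E i)"
    and exD: "\<And>i. graded_exact V (d (Suc i)) (d i) (D (Suc i)) (D i)"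
    using E D by (auto simp: graded_resolution_def)
  note r = graded_resolution_map'[OF E]
  have "\<exists>t. comparison V (e i) (E i) t (d i) (D i) \<and> graded_map V (d i) t (D i)"
  proof (induction i)
    case 0
    then show ?case using comparison_base[OF aug] aug(2) by (auto simp: graded_augmentation_def)
  next
    case (Suc i)
    then obtain t where "comparison V (e i) (E i) t (d i) (D i)" "graded_map V (d i) t (D i)" by blast
    then have "comparison V (e (Suc i)) (E (Suc i)) (d i) (d (Suc i)) (D (Suc i))"
      by (intro comparison_step[OF _ r _ exE exD cf])
    then show ?case using graded_resolution_map(1)[OF D] by blast
  qed
  then show ?thesis using comparison_shifts[OF _ _ exD cf] by blast
qed

text \<open>A zero column would make a basis vector a cycle, hence an image under the next
  differential, whose constant coefficients vanish. So every column has a nonzero entry, of positive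
  degree beyond level 0, and shifts grow by at least one per level. This bounds the set in
  \<open>regularity\<close> from below.\<close>

lemma const_free_resolution_shift_ge:
  assumes D: "graded_resolution V U d D" and cf: "\<And>i. const_free (D (Suc i))" and b: "b < length (d i)"
  shows "int i \<le> d i ! b"
  using b
proof (induction i arbitrary: b)
  case (0 b)
  note m = graded_resolution_map(2)[OF D]
  have ex: "graded_exact V (d (Suc 0)) (d 0) (D (Suc 0)) (D 0)" using D by (simp add: graded_resolution_def)
  have "D 0 $$ (0, b) \<noteq> 0"
  proof
    assume z: "D 0 $$ (0, b) = 0"
    note c = graded_map_carrier[OF m]
    have "D 0 *\<^sub>v unit_vec (length (d 0)) b = 0\<^sub>v (dim_row (D 0))"
      using mult_unit_vec[OF c 0] z c 0 by (intro eq_vecI) auto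
    then obtain y where y: "y \<in> hvec V (d 0 ! b) (d (Suc 0))" "D (Suc 0) *\<^sub>v y = unit_vec (length (d 0)) b"
      using ex unit_vec_hvec[OF 0, of V] unfolding graded_exact_def by blast
    have c1: "D (Suc 0) \<in> carrier_mat (length (d 0)) (length (d (Suc 0)))"
      by (rule graded_map_carrier[OF graded_resolution_map(1)[OF D]])
    have "Poly_Mapping.lookup ((D (Suc 0) *\<^sub>v y) $ b) 0 = 0"
      using cf[of 0] c1 hvec_carrier[OF y(1)] 0
      by (auto simp: scalar_prod_def lookup_sum const_coeff_mult const_free_def)
    then show False unfolding y(2) using 0 by simp
  qed
  then have "\<not> d 0 ! b - [0] ! 0 < 0"
    using m 0 homogeneous_neg unfolding graded_map_def by fastforce
  then show ?case by simp
next
  case (Suc i b)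
  note m = graded_resolution_map(1)[OF D, of i]
  have ex: "graded_exact V (d (Suc (Suc i))) (d (Suc i)) (D (Suc (Suc i))) (D (Suc i))"
    using D by (simp add: graded_resolution_def)
  note c = graded_map_carrier[OF m]
  have "\<exists>a<length (d i). D (Suc i) $$ (a, b) \<noteq> 0"
  proof (rule ccontr)
    assume "\<not> ?thesis"
    then have "D (Suc i) *\<^sub>v unit_vec (length (d (Suc i))) b = 0\<^sub>v (dim_row (D (Suc i)))"
      using mult_unit_vec[OF c Suc.prems] c Suc.prems by (intro eq_vecI) auto
    then obtain y where y: "y \<in> hvec V (d (Suc i) ! b) (d (Suc (Suc i)))"
      "D (Suc (Suc i)) *\<^sub>v y = unit_vec (length (d (Suc i))) b"
      using ex unit_vec_hvec[OF Suc.prems, of V] unfolding graded_exact_def by blast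
    have c1: "D (Suc (Suc i)) \<in> carrier_mat (length (d (Suc i))) (length (d (Suc (Suc i))))"
      by (rule graded_map_carrier[OF graded_resolution_map(1)[OF D]])
    have "Poly_Mapping.lookup ((D (Suc (Suc i)) *\<^sub>v y) $ b) 0 = 0"
      using cf[of "Suc i"] c1 hvec_carrier[OF y(1)] Suc.prems
      by (auto simp: scalar_prod_def lookup_sum const_coeff_mult const_free_def)
    then show False unfolding y(2) using Suc.prems by simp
  qed
  then obtain a where a: "a < length (d i)" "D (Suc i) $$ (a, b) \<noteq> 0" by blast
  have h: "D (Suc i) $$ (a, b) \<in> homogeneous_part V (d (Suc i) ! b - d i ! a)"
    using m a Suc.prems by (simp add: graded_map_def)
  obtain x where x: "x \<in> Poly_Mapping.keys (D (Suc i) $$ (a, b))"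
    using a(2) poly_mapping_sum_single[of "D (Suc i) $$ (a, b)"] by fastforce
  have "x \<noteq> 0"
    using x cf[of i] c a Suc.prems by (auto simp: const_free_def in_keys_iff)
  then have "1 \<le> d (Suc i) ! b - d i ! a"
    using h x monom_degree_eq_0_iff[of x] by (fastforce simp: homogeneous_part_def)
  then show ?case using Suc.IH[OF a(1)] by simp
qed

text \<open>When \<open>m\<close> is written through the generators, it occurs in some product
  \<open>D $$ (0, b) * y $ b\<close>. The factor coming from \<open>D\<close> lies in
  \<open>U\<close> and divides \<open>m\<close>, so it is \<open>m\<close>, and the shift of
  generator \<open>b\<close> is its degree.\<close>

lemma minimal_generator_shift:
  assumes D: "graded_augmentation V U s D" and m: "m \<in> U" "m \<in> monoms V"
    and min: "\<And>m' t. m' \<in> U \<Longrightarrow> m = m' + t \<Longrightarrow> t = 0"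
  shows "int (monom_degree m) \<in> set s"
proof -
  have gD: "graded_map V s [0] D" using D by (simp add: graded_augmentation_def)
  note c = graded_map_carrier[OF gD]
  have "Poly_Mapping.single m 1 \<in> homogeneous_part V (int (monom_degree m)) \<inter> mono_ideal U"
    using m by (simp add: homogeneous_single mono_ideal_single)
  then obtain y where y: "y \<in> hvec V (int (monom_degree m)) s" "(D *\<^sub>v y) $ 0 = Poly_Mapping.single m 1"
    using D unfolding graded_augmentation_def by blast
  have "(D *\<^sub>v y) $ 0 = (\<Sum>b<length s. D $$ (0, b) * y $ b)"
    using c hvec_carrier[OF y(1)] by (auto simp: scalar_prod_def lessThan_atLeast0 intro!: sum.cong)
  then have "(\<Sum>b<length s. Poly_Mapping.lookup (D $$ (0, b) * y $ b) m) = 1"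
    using arg_cong[OF y(2), of "\<lambda>p. Poly_Mapping.lookup p m"] by (simp only: lookup_sum lookup_single_eq)
  then obtain b where b: "b < length s" "Poly_Mapping.lookup (D $$ (0, b) * y $ b) m \<noteq> 0"
    by (metis (no_types, lifting) lessThan_iff sum.neutral zero_neq_one)
  then have "m \<in> Poly_Mapping.keys (D $$ (0, b) * y $ b)" by (simp add: in_keys_iff)
  then obtain p q where pq: "m = p + q" "p \<in> Poly_Mapping.keys (D $$ (0, b))"
    using keys_mult by blast
  have "p \<in> U" using D b(1) pq(2) by (auto simp: graded_augmentation_def mono_ideal_def)
  then have "q = 0" using min pq(1) by blast
  then have "m \<in> Poly_Mapping.keys (D $$ (0, b))" using pq by simp
  moreover have "D $$ (0, b) \<in> homogeneous_part V (s ! b)"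
    using gD b(1) by (simp add: graded_map_def)
  ultimately have "s ! b = int (monom_degree m)" by (auto simp: homogeneous_part_def)
  then show ?thesis using b(1) nth_mem by metis
qed

text \<open>Any resolution may serve as witness, so the predicate passes directly through cones. The
  type argument fixes the coefficient field, which \<open>U\<close> does not determine.\<close>

definition reg_le :: "'k::field itself \<Rightarrow> 'a set \<Rightarrow> ('a \<Rightarrow>\<^sub>0 nat) set \<Rightarrow> int \<Rightarrow> bool" where
  "reg_le K V U r \<longleftrightarrow> (\<exists>e (E :: nat \<Rightarrow> ('a, 'k) mpoly mat).
     graded_resolution V U e E \<and> (\<forall>i. \<forall>j\<in>set (e i). j \<le> r + int i))"

text \<open>The existence of a minimal resolution gives meaning to the \<open>SOME\<close> in
  \<open>graded_betti\<close>. Its shifts minus their levels lie between 0 and \<open>r\<close> and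
  include the degree of \<open>m\<close>, so \<open>Max\<close> is taken over a finite nonempty
  set.\<close>

lemma regularity_bounds:
  assumes U: "up_closed V U" and reg: "reg_le TYPE('k::field) V U r"
    and m: "m \<in> U" and min: "\<And>m' t. m' \<in> U \<Longrightarrow> m = m' + t \<Longrightarrow> t = 0"
  shows "int (monom_degree m) \<le> regularity V (mono_ideal U :: ('a, 'k) mpoly set)"
    and "regularity V (mono_ideal U :: ('a, 'k) mpoly set) \<le> r"
proof -
  let ?I = "mono_ideal U :: ('a, 'k) mpoly set"
  obtain e and E :: "nat \<Rightarrow> ('a, 'k) mpoly mat" where E: "graded_resolution V U e E"
    and er: "\<And>i j. j \<in> set (e i) \<Longrightarrow> j \<le> r + int i"
    using reg unfolding reg_le_def by blast
  have cf_iff: "const_free (D (Suc i)) \<longleftrightarrow>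
    (\<forall>a<length (d i). \<forall>b<length (d (Suc i)). Poly_Mapping.lookup (D (Suc i) $$ (a, b)) 0 = 0)"
    if "graded_resolution V U d D" for d i and D :: "nat \<Rightarrow> ('a, 'k) mpoly mat"
    using graded_map_carrier[OF graded_resolution_map(1)[OF that, of i]] by (auto simp: const_free_def)
  have "\<exists>d. \<exists>D. minimal_graded_free_resolution V ?I d D"
    unfolding minimal_graded_free_resolution_iff[OF U]
    using resolution_exists_const_free[OF E U] cf_iff by blast
  then have "\<exists>D. minimal_graded_free_resolution V ?I (SOME d. \<exists>D. minimal_graded_free_resolution V ?I d D) D"
    by (rule someI_ex)
  then obtain d D where d: "d = (SOME d. \<exists>D. minimal_graded_free_resolution V ?I d D)"
    and min_res: "minimal_graded_free_resolution V ?I d D" by blast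
  have D: "graded_resolution V U d D" and cf: "\<And>i. const_free (D (Suc i))"
    using min_res cf_iff unfolding minimal_graded_free_resolution_iff[OF U] by blast+
  let ?S = "{j - int i | i j. graded_betti V ?I i j \<noteq> 0}"
  have S: "?S = {j - int i | i j. j \<in> set (d i)}"
    unfolding graded_betti_def d[symmetric] by (simp add: count_list_0_iff)
  have le: "x \<le> r" if "x \<in> ?S" for x
    using that const_free_resolution_shifts[OF E D cf] er unfolding S by fastforce
  have ge: "0 \<le> x" if "x \<in> ?S" for x
    using that const_free_resolution_shift_ge[OF D cf] unfolding S by (fastforce simp: in_set_conv_nth)
  have fin: "finite ?S"
  proof (rule finite_subset)
    show "?S \<subseteq> {0..r}" using le ge by (meson atLeastAtMost_iff subsetI)
  qed simp
  have "int (monom_degree m) \<in> set (d 0)"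
    using D m min U by (intro minimal_generator_shift[of V U "d 0" "D 0"])
      (auto simp: graded_resolution_def up_closed_def)
  then have mem: "int (monom_degree m) \<in> ?S" unfolding S by force
  show "int (monom_degree m) \<le> regularity V ?I"
    unfolding regularity_def using fin mem by (rule Max_ge)
  show "regularity V ?I \<le> r"
    unfolding regularity_def using fin mem le by (subst Max_le_iff) auto
qed

section \<open>Bounding the regularity\<close>

lemma smult_mat_mult_vec:
  "A \<in> carrier_mat nr nc \<Longrightarrow> v \<in> carrier_vec nc \<Longrightarrow> (p \<cdot>\<^sub>m A) *\<^sub>v v = p \<cdot>\<^sub>v (A *\<^sub>v (v :: 'b::comm_ring_1 vec))"
  by (intro eq_vecI) auto

lemma mult_mat_vec_smult:
  "A \<in> carrier_mat nr nc \<Longrightarrow> v \<in> carrier_vec nc \<Longrightarrow> A *\<^sub>v (p \<cdot>\<^sub>v v) = p \<cdot>\<^sub>v (A *\<^sub>v (v :: 'b::comm_ring_1 vec))"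
  by (intro eq_vecI) auto

lemma mult_mat_vec_uminus:
  "A \<in> carrier_mat nr nc \<Longrightarrow> v \<in> carrier_vec nc \<Longrightarrow> A *\<^sub>v (- v) = - (A *\<^sub>v (v :: 'b::comm_ring_1 vec))"
  by (intro eq_vecI) auto

lemma vec_add_eq_0_iff:
  "v \<in> carrier_vec n \<Longrightarrow> w \<in> carrier_vec n \<Longrightarrow> v + w = 0\<^sub>v n \<longleftrightarrow> v = - (w :: 'b::ab_group_add vec)"
  by (auto simp: vec_eq_iff eq_neg_iff_add_eq_0)

lemma vec_add_diff_cancel:
  fixes v w :: "'b::ab_group_add vec"
  shows "v \<in> carrier_vec n \<Longrightarrow> w \<in> carrier_vec n \<Longrightarrow> v + w - w = v"
  by (intro eq_vecI) auto

lemma smult_vec_uminus: "p \<cdot>\<^sub>v (- v) = - (p \<cdot>\<^sub>v (v :: 'b::comm_ring_1 vec))"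
  by (intro eq_vecI) auto

lemma monom_smult_vec_eq_0_iff:
  fixes v :: "('a, 'k::field) mpoly vec"
  assumes "v \<in> carrier_vec n"
  shows "monom_poly t \<cdot>\<^sub>v v = 0\<^sub>v n \<longleftrightarrow> v = 0\<^sub>v n"
proof -
  have "monom_poly t * p = 0 \<longleftrightarrow> p = 0" for p :: "('a, 'k) mpoly" by (rule monom_mult_eq_0_iff)
  then show ?thesis using assms by (auto simp: vec_eq_iff)
qed

text \<open>The ring resolves itself by one generator of degree 0. This case is the origin of the
  \<open>max 0\<close> in the bound for the colon ideals.\<close>

lemma reg_le_monoms:
  assumes "0 \<le> r"
  shows "reg_le TYPE('k::field) V (monoms V) r"
proof -
  define e :: "nat \<Rightarrow> int list" where "e i = (if i = 0 then [0] else [])" for i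
  define E :: "nat \<Rightarrow> ('a, 'k) mpoly mat" where
    "E i = (if i = 0 then 1\<^sub>m 1 else 0\<^sub>m (length (e (i - 1))) 0)" for i
  have E0: "graded_map V [0] [0] (1\<^sub>m 1 :: ('a, 'k) mpoly mat)"
    using graded_map_one[of V "[0]"] by simp
  have "graded_augmentation V (monoms V) (e 0) (E 0)"
    unfolding graded_augmentation_def
  proof (intro conjI allI impI ballI)
    fix j and p :: "('a, 'k) mpoly" assume p: "p \<in> homogeneous_part V j \<inter> mono_ideal (monoms V)"
    show "\<exists>y\<in>hvec V j (e 0). (E 0 *\<^sub>v y) $ 0 = p"
      by (rule bexI[of _ "vec 1 (\<lambda>_. p)"])
        (use p in \<open>auto simp: e_def E_def hvec_def one_mult_mat_vec[of _ 1]\<close>)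
  qed (use E0 in \<open>auto simp: e_def E_def one_in_carrier\<close>)
  moreover have "graded_exact V (e (Suc i)) (e i) (E (Suc i)) (E i)" for i
  proof (rule graded_exactI)
    show "graded_map V (e (Suc i)) (e i) (E (Suc i))"
      by (auto simp: graded_map_def E_def e_def)
    show "graded_map V (e i) (if i = 0 then [0] else e (i - 1)) (E i)"
      using E0 by (auto simp: graded_map_def E_def e_def)
    fix j and y :: "('a, 'k) mpoly vec" assume "y \<in> hvec V j (e (Suc i))"
    then show "E i *\<^sub>v (E (Suc i) *\<^sub>v y) = 0\<^sub>v (length (if i = 0 then [0] else e (i - 1)))"
      by (intro eq_vecI) (auto simp: E_def e_def scalar_prod_def hvec_def split: if_splits)
  next
    fix j and z :: "('a, 'k) mpoly vec"
    assume z: "z \<in> hvec V j (e i)" "E i *\<^sub>v z = 0\<^sub>v (length (if i = 0 then [0] else e (i - 1)))"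
    have "z = 0\<^sub>v (length (e i))"
      using z one_mult_mat_vec[of z 1] by (cases i) (auto simp: E_def e_def hvec_def)
    then show "\<exists>y\<in>hvec V j (e (Suc i)). E (Suc i) *\<^sub>v y = z"
      by (intro bexI[of _ vNil]) (auto simp: E_def e_def scalar_prod_def)
  qed
  moreover have "\<forall>i. \<forall>j\<in>set (e i). j \<le> r + int i" using assms by (simp add: e_def)
  ultimately show ?thesis unfolding reg_le_def graded_resolution_def by blast
qed

lemma reg_le_mono: "reg_le K V U r \<Longrightarrow> r \<le> r' \<Longrightarrow> reg_le K V U r'"
  unfolding reg_le_def by (meson add_right_mono order_trans)

text \<open>Multiplication by \<open>t\<close> maps the ideal isomorphically onto the translated one
  and raises degrees by that of \<open>t\<close>. Only the augmentation is changed, and its kernel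
  stays the same since \<open>t\<close> is a nonzerodivisor.\<close>

lemma reg_le_translate:
  assumes reg: "reg_le TYPE('k::field) V U r" and t: "t \<in> monoms V"
  shows "reg_le TYPE('k) V ((+) t ` U) (r + int (monom_degree t))"
proof -
  obtain e and E :: "nat \<Rightarrow> ('a, 'k) mpoly mat" where E: "graded_resolution V U e E"
    and er: "\<And>i j. j \<in> set (e i) \<Longrightarrow> j \<le> r + int i"
    using reg unfolding reg_le_def by blast
  let ?c = "int (monom_degree t)"
  define e' where "e' i = map (\<lambda>j. j + ?c) (e i)" for i
  define E' where "E' i = (if i = 0 then monom_poly t \<cdot>\<^sub>m E 0 else E i)" for i
  have ht: "(monom_poly t :: ('a, 'k) mpoly) \<in> homogeneous_part V ?c"
    using t by (simp add: monom_poly_def homogeneous_single)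
  have aug: "graded_augmentation V U (e 0) (E 0)" using E by (simp add: graded_resolution_def)
  note m0 = graded_resolution_map(2)[OF E]
  note c0 = graded_map_carrier[OF m0]
  have m0': "graded_map V (e' 0) [0] (E' 0)"
    unfolding e'_def E'_def using graded_map_smult[OF ht m0] by simp
  have E'0: "E' 0 *\<^sub>v v = monom_poly t \<cdot>\<^sub>v (E 0 *\<^sub>v v)" if "v \<in> carrier_vec (length (e 0))" for v
    using smult_mat_mult_vec[OF c0 that] by (simp add: E'_def)
  have "graded_augmentation V ((+) t ` U) (e' 0) (E' 0)"
    unfolding graded_augmentation_def
  proof (intro conjI allI impI ballI m0')
    fix b assume "b < length (e' 0)"
    then have b: "b < length (e 0)" by (simp add: e'_def)
    then have "Poly_Mapping.keys (E 0 $$ (0, b)) \<subseteq> U"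
      using aug by (simp add: graded_augmentation_def mono_ideal_def)
    then show "E' 0 $$ (0, b) \<in> mono_ideal ((+) t ` U)"
      using b c0 by (auto simp: E'_def mono_ideal_def keys_monom_mult)
  next
    fix j and p :: "('a, 'k) mpoly" assume p: "p \<in> homogeneous_part V j \<inter> mono_ideal ((+) t ` U)"
    then obtain q where q: "p = monom_poly t * q"
      by (auto simp: mono_ideal_def intro: monom_dvd_poly[of p t])
    have "q \<in> homogeneous_part V (j - ?c) \<inter> mono_ideal U"
      using p unfolding q Int_iff homogeneous_part_iff mono_ideal_def mem_Collect_eq keys_monom_mult
      by (auto simp: monoms_add_iff monom_degree_add)
    then obtain y where y: "y \<in> hvec V (j - ?c) (e 0)" "(E 0 *\<^sub>v y) $ 0 = q"
      using aug unfolding graded_augmentation_def by blast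
    have "(E' 0 *\<^sub>v y) $ 0 = p"
      unfolding E'0[OF hvec_carrier[OF y(1)]] q using y(2) c0 by simp
    then show "\<exists>y\<in>hvec V j (e' 0). (E' 0 *\<^sub>v y) $ 0 = p"
      using y(1) unfolding e'_def hvec_shift by blast
  qed
  moreover have "graded_exact V (e' (Suc i)) (e' i) (E' (Suc i)) (E' i)" for i
  proof -
    have ex: "graded_exact V (e (Suc i)) (e i) (E (Suc i)) (E i)" using E by (simp add: graded_resolution_def)
    have m: "graded_map V (e' (Suc i)) (e' i) (E (Suc i))"
      unfolding e'_def graded_map_shift by (rule graded_resolution_map(1)[OF E])
    define s where "s = (case i of 0 \<Rightarrow> [0] | Suc j \<Rightarrow> e j)"
    have mi: "graded_map V (e i) s (E i)" unfolding s_def by (rule graded_resolution_map'[OF E])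
    have mi': "graded_map V (e' i) (case i of 0 \<Rightarrow> [0] | Suc j \<Rightarrow> e' j) (E' i)"
    proof (cases i)
      case (Suc j)
      then show ?thesis
        using graded_resolution_map(1)[OF E, of j] by (simp add: E'_def e'_def graded_map_shift)
    qed (use m0' in simp)
    have len: "length (case i of 0 \<Rightarrow> [0] | Suc j \<Rightarrow> e' j) = length s"
      by (cases i) (auto simp: e'_def s_def)
    have ker: "E' i *\<^sub>v v = 0\<^sub>v (length s) \<longleftrightarrow> E i *\<^sub>v v = 0\<^sub>v (length s)"
      if v: "v \<in> carrier_vec (length (e i))" for v
    proof (cases i)
      case 0
      have "E 0 *\<^sub>v v \<in> carrier_vec 1" using c0 v 0 by (intro mult_mat_vec_carrier) auto
      then show ?thesis
        using monom_smult_vec_eq_0_iff[of "E 0 *\<^sub>v v" 1 t] E'0[of v] v 0 by (simp add: s_def)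
    qed (simp add: E'_def)
    have E'S: "E' (Suc i) = E (Suc i)" by (simp add: E'_def)
    have "graded_exact V (e' (Suc i)) (e' i) (E (Suc i)) (E' i)"
    proof (rule graded_exactI[OF m mi'], unfold len)
      fix j and y :: "('a, 'k) mpoly vec" assume "y \<in> hvec V j (e' (Suc i))"
      then have y: "y \<in> hvec V (j - ?c) (e (Suc i))" by (simp add: e'_def hvec_shift)
      have "E (Suc i) *\<^sub>v y \<in> carrier_vec (length (e i))"
        using graded_map_mult_vec[OF graded_resolution_map(1)[OF E] y] by (rule hvec_carrier)
      then show "E' i *\<^sub>v (E (Suc i) *\<^sub>v y) = 0\<^sub>v (length s)"
        using ker graded_exact_mult_vec[OF ex mi y] by blast
    next
      fix j and z :: "('a, 'k) mpoly vec"
      assume "z \<in> hvec V j (e' i)" and z0: "E' i *\<^sub>v z = 0\<^sub>v (length s)"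
      then have z: "z \<in> hvec V (j - ?c) (e i)" by (simp add: e'_def hvec_shift)
      then have "E i *\<^sub>v z = 0\<^sub>v (dim_row (E i))"
        using ker[OF hvec_carrier[OF z]] z0 graded_map_carrier[OF mi] by auto
      then show "\<exists>y\<in>hvec V j (e' (Suc i)). E (Suc i) *\<^sub>v y = z"
        using ex z unfolding graded_exact_def e'_def hvec_shift by blast
    qed
    then show ?thesis unfolding E'S .
  qed
  moreover have "\<forall>i. \<forall>j\<in>set (e' i). j \<le> r + ?c + int i"
    using er by (force simp: e'_def)
  ultimately show ?thesis unfolding reg_le_def graded_resolution_def by blast
qed

text \<open>The cone needs this lift for the inclusion of \<open>U0\<close> in the colon by
  \<open>x\<close>. Exactness of the target resolution provides each level from the one
  below.\<close>

lemma resolution_chain_map: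
  fixes D E :: "nat \<Rightarrow> ('a, 'k::field) mpoly mat"
  assumes D: "graded_resolution V W d D" and E: "graded_resolution V U e E" and sub: "W \<subseteq> U"
  obtains \<phi> where "\<And>i. graded_map V (d i) (e i) (\<phi> i)" "E 0 * \<phi> 0 = D 0"
    "\<And>i. E (Suc i) * \<phi> (Suc i) = \<phi> i * D (Suc i)"
proof -
  \<comment> \<open>Above level 0, \<open>P\<close> remembers some commuting square ending in
    \<open>X\<close>, with an unnamed lower map; that is all the next lift requires.\<close>
  define P where "P i X \<longleftrightarrow> graded_map V (d i) (e i) X \<and>
    (case i of 0 \<Rightarrow> E 0 * X = D 0 | Suc j \<Rightarrow> \<exists>Y. graded_map V (d j) (e j) Y \<and> E (Suc j) * X = Y * D (Suc j))"
    for i X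
  have "\<exists>X. P 0 X"
  proof -
    have aug: "graded_augmentation V W (d 0) (D 0)" "graded_augmentation V U (e 0) (E 0)"
      using D E by (auto simp: graded_resolution_def)
    have "\<And>b. b < length (d 0) \<Longrightarrow> D 0 $$ (0, b) \<in> mono_ideal U"
      using aug(1) mono_ideal_mono[OF sub] by (auto simp: graded_augmentation_def)
    then obtain X where "graded_map V (d 0) (e 0) X" "E 0 * X = D 0"
      using graded_augmentation_lift[OF aug(2) graded_resolution_map(2)[OF D]] by metis
    then show ?thesis by (auto simp: P_def)
  qed
  moreover have "\<exists>Y. P (Suc i) Y \<and> E (Suc i) * Y = X * D (Suc i)" if X: "P i X" for i X
  proof -
    define s where "s = (case i of 0 \<Rightarrow> [0] | Suc j \<Rightarrow> e j)"
    define s' where "s' = (case i of 0 \<Rightarrow> [0] | Suc j \<Rightarrow> d j)"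
    have mE: "graded_map V (e i) s (E i)" unfolding s_def by (rule graded_resolution_map'[OF E])
    have mD: "graded_map V (d i) s' (D i)" unfolding s'_def by (rule graded_resolution_map'[OF D])
    have mX: "graded_map V (d i) (e i) X" using X by (simp add: P_def)
    note mD1 = graded_resolution_map(1)[OF D, of i]
    note c = graded_map_carrier[OF mE] graded_map_carrier[OF mD] graded_map_carrier[OF mX]
      graded_map_carrier[OF mD1]
    have DD: "D i * D (Suc i) = 0\<^sub>m (length s') (length (d (Suc i)))"
      using D c by (auto simp: graded_resolution_def graded_exact_def)
    \<comment> \<open>The lower edge of the square; at level 0 it is the identity of the
      ring.\<close>
    obtain Z where Z: "Z \<in> carrier_mat (length s) (length s')" "E i * X = Z * D i"
    proof (cases i)
      case 0
      then have "E i * X = 1\<^sub>m 1 * D i" using X c by (simp add: P_def s'_def)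
      then show thesis using 0 that[of "1\<^sub>m 1"] by (simp add: s_def s'_def)
    next
      case (Suc j)
      then show thesis
        using X that graded_map_carrier by (fastforce simp: P_def s_def s'_def)
    qed
    have "E i * (X * D (Suc i)) = Z * (D i * D (Suc i))"
      using assoc_mult_mat[OF c(1,3,4)] assoc_mult_mat[OF Z(1) c(2,4)] Z(2) by simp
    then have "E i * (X * D (Suc i)) = 0\<^sub>m (length s) (length (d (Suc i)))"
      unfolding DD using Z by simp
    moreover have "graded_exact V (e (Suc i)) (e i) (E (Suc i)) (E i)" using E by (simp add: graded_resolution_def)
    ultimately obtain Y where Y: "graded_map V (d (Suc i)) (e (Suc i)) Y" "E (Suc i) * Y = X * D (Suc i)"
      using graded_exact_lift[OF _ mE graded_map_mult[OF mX mD1]] by metis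
    then show ?thesis using mX by (auto simp: P_def)
  qed
  ultimately obtain \<phi> where \<phi>: "\<And>i. P i (\<phi> i)" "\<And>i. E (Suc i) * \<phi> (Suc i) = \<phi> i * D (Suc i)"
    using dependent_nat_choice[of P "\<lambda>i X Y. E (Suc i) * Y = X * D (Suc i)"] by metis
  have "E 0 * \<phi> 0 = D 0" using \<phi>(1)[of 0] by (simp add: P_def)
  then show thesis using \<phi> that by (auto simp: P_def)
qed

section \<open>The mapping cone that splits off a variable\<close>

lemma graded_augmentation_mult_vec:
  assumes D: "graded_augmentation V U s D" and U: "up_closed V U" and v: "v \<in> hvec V j s"
  shows "(D *\<^sub>v v) $ 0 \<in> mono_ideal U"
proof -
  have "graded_map V s [0] D" using D by (simp add: graded_augmentation_def)
  then have "(\<lambda>v. D *\<^sub>v v) ` free_module V (length s) = {w \<in> free_module V 1. w $ 0 \<in> mono_ideal U}"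
    using D graded_augmentation_iff U by blast
  then show ?thesis using hvec_free_module[OF v] by blast
qed

text \<open>By \<open>restr\<close> every monomial of \<open>U\<close> lies in \<open>U0\<close> or
  is \<open>x\<close> times one of the colon, so (a, b) \<mapsto> a + x b is onto. By
  \<open>cancel\<close> its kernel consists of the pairs (x y, - y) with \<open>y\<close> supported
  on \<open>U0\<close>. The copy of the resolution of \<open>U0\<close> that moves up one level has
  its shifts raised by one as well, so it costs nothing; only the colon pays one.\<close>

lemma reg_le_cone:
  assumes x: "x \<in> V" and U: "up_closed V U"
    and U0: "up_closed V U0" and sub: "U0 \<subseteq> U"
    and cancel: "\<And>m. m \<in> monoms V \<Longrightarrow> Poly_Mapping.single x 1 + m \<in> U0 \<Longrightarrow> m \<in> U0"
    and restr: "\<And>m. m \<in> U \<Longrightarrow> x \<notin> Poly_Mapping.keys m \<Longrightarrow> m \<in> U0"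
    and reg0: "reg_le TYPE('k::field) V U0 r"
    and reg1: "reg_le TYPE('k) V {m \<in> monoms V. Poly_Mapping.single x 1 + m \<in> U} (r - 1)"
  shows "reg_le TYPE('k) V U r"
proof -
  let ?X = "var x :: ('a, 'k) mpoly"
  let ?Ux = "{m \<in> monoms V. Poly_Mapping.single x 1 + m \<in> U}"
  let ?sh = "map (\<lambda>j. j + 1) :: int list \<Rightarrow> int list"
  obtain dN and DN :: "nat \<Rightarrow> ('a, 'k) mpoly mat" where N: "graded_resolution V U0 dN DN"
    and dN: "\<And>i j. j \<in> set (dN i) \<Longrightarrow> j \<le> r + int i"
    using reg0 unfolding reg_le_def by blast
  obtain dL and DL :: "nat \<Rightarrow> ('a, 'k) mpoly mat" where L: "graded_resolution V ?Ux dL DL"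
    and dL: "\<And>i j. j \<in> set (dL i) \<Longrightarrow> j \<le> (r - 1) + int i"
    using reg1 unfolding reg_le_def by blast
  have UV: "U \<subseteq> monoms V" and up: "\<And>t m. t \<in> monoms V \<Longrightarrow> m \<in> U \<Longrightarrow> t + m \<in> U"
    using U by (auto simp: up_closed_def)
  \<comment> \<open>\<open>U\<close> is closed under multiplication by \<open>x\<close>, so it is
    contained in its colon; this gives the inclusion to be lifted.\<close>
  have "U0 \<subseteq> ?Ux" using sub UV up single_in_monoms[OF x] by blast
  then obtain \<phi> where \<phi>: "\<And>i. graded_map V (dN i) (dL i) (\<phi> i)" "DL 0 * \<phi> 0 = DN 0"
    "\<And>i. DL (Suc i) * \<phi> (Suc i) = \<phi> i * DN (Suc i)"
    using resolution_chain_map[OF N L] by metis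
  have hx: "?X \<in> homogeneous_part V 1" by (rule homogeneous_var[OF x])
  have augN: "graded_augmentation V U0 (dN 0) (DN 0)" and augL: "graded_augmentation V ?Ux (dL 0) (DL 0)"
    using N L by (auto simp: graded_resolution_def)
  have exN: "graded_exact V (dN (Suc i)) (dN i) (DN (Suc i)) (DN i)"
    and exL: "graded_exact V (dL (Suc i)) (dL i) (DL (Suc i)) (DL i)" for i
    using N L by (auto simp: graded_resolution_def)
  note mN = graded_resolution_map(1)[OF N] and mN0 = graded_resolution_map(2)[OF N]
  note mL = graded_resolution_map(1)[OF L] and mL0 = graded_resolution_map(2)[OF L]
  note cN = graded_map_carrier[OF mN] and cL = graded_map_carrier[OF mL]
  note cN0 = graded_map_carrier[OF mN0] and cL0 = graded_map_carrier[OF mL0]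
  note c\<phi> = graded_map_carrier[OF \<phi>(1)]

  \<comment> \<open>The source of the cone: the resolution of \<open>U0\<close> with degrees raised
    by one and moved up one level, hence empty at level 0.\<close>
  define tN where "tN i = (case i of 0 \<Rightarrow> [] | Suc j \<Rightarrow> ?sh (dN j))" for i
  define TN :: "nat \<Rightarrow> ('a, 'k) mpoly mat" where
    "TN i = (case i of 0 \<Rightarrow> 0\<^sub>m 0 (length (dN 0)) | Suc j \<Rightarrow> DN (Suc j))" for i
  define c where "c i = (dN i @ ?sh (dL i)) @ tN i" for i
  define A where "A i = four_block_mat (DN (Suc i)) (0\<^sub>m (length (dN i)) (length (dL (Suc i))))
    (0\<^sub>m (length (dL i)) (length (dN (Suc i)))) (DL (Suc i))" for i
  \<comment> \<open>The two components of the map from that copy: multiplication by \<open>x\<close>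
    into the resolution of \<open>U0\<close>, and \<open>- \<phi>\<close> into that of the
    colon.\<close>
  define B where "B i = (?X \<cdot>\<^sub>m 1\<^sub>m (length (dN i))) @\<^sub>r (- \<phi> i)" for i
  \<comment> \<open>Level 0 is a + x b. Above it stands the cone matrix, whose sign on
    \<open>TN\<close> makes consecutive differentials compose to zero.\<close>
  define C where "C i = (case i of
      0 \<Rightarrow> four_block_mat (DN 0) (?X \<cdot>\<^sub>m DL 0) (0\<^sub>m 0 (length (dN 0))) (0\<^sub>m 0 (length (dL 0)))
    | Suc j \<Rightarrow> four_block_mat (A j) (B j)
        (0\<^sub>m (length (tN j)) (length (dN (Suc j)) + length (dL (Suc j)))) (- TN j))" for i

  have mTN: "graded_map V (tN (Suc i)) (tN i) (TN i)" for i
  proof (cases i)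
    case 0
    then show ?thesis using graded_map_zero[of V "?sh (dN 0)" "[]"] by (simp add: tN_def TN_def)
  next
    case (Suc j)
    then show ?thesis using mN[of j] by (simp add: tN_def TN_def graded_map_shift)
  qed
  have cTN: "TN i \<in> carrier_mat (length (tN i)) (length (dN i))" for i
    using graded_map_carrier[OF mTN[of i]] by (simp add: tN_def)
  have mA: "graded_map V (dN (Suc i) @ ?sh (dL (Suc i))) (dN i @ ?sh (dL i)) (A i)" for i
    unfolding A_def
    using mN[of i] mL[of i] graded_map_zero[of V "?sh (dL (Suc i))" "dN i"]
      graded_map_zero[of V "dN (Suc i)" "?sh (dL i)"]
    by (intro graded_map_four_block) (simp_all add: graded_map_shift)
  have mB: "graded_map V (tN (Suc i)) (dN i @ ?sh (dL i)) (B i)" for i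
  proof -
    have 1: "graded_map V (?sh (dN i)) (dN i) (?X \<cdot>\<^sub>m 1\<^sub>m (length (dN i)))"
      by (rule graded_map_smult[OF hx graded_map_one])
    have 2: "graded_map V (?sh (dN i)) (?sh (dL i)) (- \<phi> i)"
      unfolding graded_map_shift by (rule graded_map_uminus[OF \<phi>(1)])
    have z: "graded_map V [] s (0\<^sub>m (length s) 0)" for s using graded_map_zero[of V "[]" s] by simp
    show ?thesis
      using graded_map_four_block[OF 1 z 2 z] c\<phi>[of i]
      unfolding B_def append_rows_def tN_def by simp
  qed
  have cA: "A i \<in> carrier_mat (length (dN i) + length (dL i)) (length (dN (Suc i)) + length (dL (Suc i)))" for i
    using graded_map_carrier[OF mA[of i]] by simp
  have cB: "B i \<in> carrier_mat (length (dN i) + length (dL i)) (length (dN i))" for i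
    using graded_map_carrier[OF mB[of i]] by (simp add: tN_def)
  have mC: "graded_map V (c (Suc i)) (c i) (C (Suc i))" for i
  proof -
    have "graded_map V (dN (Suc i) @ ?sh (dL (Suc i))) (tN i)
        (0\<^sub>m (length (tN i)) (length (dN (Suc i)) + length (dL (Suc i))))"
      using graded_map_zero[of V "dN (Suc i) @ ?sh (dL (Suc i))" "tN i"] by simp
    from graded_map_four_block[OF mA mB this graded_map_uminus[OF mTN]]
    show ?thesis by (simp add: C_def c_def)
  qed
  have mC0: "graded_map V (c 0) [0] (C 0)"
  proof -
    have z: "graded_map V s [] (0\<^sub>m 0 (length s))" for s using graded_map_zero[of V s "[]"] by simp
    from graded_map_four_block[OF mN0 graded_map_smult[OF hx mL0] z z]
    show ?thesis by (simp add: C_def c_def tN_def)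
  qed
  have C: "C (Suc i) *\<^sub>v ((u @\<^sub>v w) @\<^sub>v y) =
      ((DN (Suc i) *\<^sub>v u + ?X \<cdot>\<^sub>v y) @\<^sub>v (DL (Suc i) *\<^sub>v w - \<phi> i *\<^sub>v y)) @\<^sub>v (- (TN i *\<^sub>v y))"
    if u: "u \<in> carrier_vec (length (dN (Suc i)))" and w: "w \<in> carrier_vec (length (dL (Suc i)))"
      and y: "y \<in> carrier_vec (length (dN i))" for i u w y
  proof -
    have uw: "u @\<^sub>v w \<in> carrier_vec (length (dN (Suc i)) + length (dL (Suc i)))" using u w by simp
    have "A i *\<^sub>v (u @\<^sub>v w) = (DN (Suc i) *\<^sub>v u) @\<^sub>v (DL (Suc i) *\<^sub>v w)"
      unfolding A_def
      by (subst four_block_mat_mult_vec[OF cN _ _ cL u w]) (use cN[of i] cL[of i] u w in auto)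
    moreover have "B i *\<^sub>v y = (?X \<cdot>\<^sub>v y) @\<^sub>v (- (\<phi> i *\<^sub>v y))"
    proof -
      have "B i *\<^sub>v y = ((?X \<cdot>\<^sub>m 1\<^sub>m (length (dN i))) *\<^sub>v y) @\<^sub>v ((- \<phi> i) *\<^sub>v y)"
        unfolding B_def by (rule mat_mult_append) (use c\<phi>[of i] y in auto)
      also have "(?X \<cdot>\<^sub>m 1\<^sub>m (length (dN i))) *\<^sub>v y = ?X \<cdot>\<^sub>v y"
        using smult_mat_mult_vec[OF one_carrier_mat y] one_mult_mat_vec[OF y] by simp
      finally show ?thesis using uminus_mult_mat_vec[of y "\<phi> i"] c\<phi>[of i] y by simp
    qed
    moreover have "C (Suc i) *\<^sub>v ((u @\<^sub>v w) @\<^sub>v y) = (A i *\<^sub>v (u @\<^sub>v w) + B i *\<^sub>v y) @\<^sub>v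
        (0\<^sub>m (length (tN i)) (length (dN (Suc i)) + length (dL (Suc i))) *\<^sub>v (u @\<^sub>v w) + (- TN i) *\<^sub>v y)"
      unfolding C_def nat.case
      by (rule four_block_mat_mult_vec[OF cA cB _ _ uw y]) (use cTN[of i] in auto)
    moreover have "0\<^sub>m (length (tN i)) (length (dN (Suc i)) + length (dL (Suc i))) *\<^sub>v (u @\<^sub>v w)
        = 0\<^sub>v (length (tN i))"
      using uw by auto
    moreover have "0\<^sub>v (length (tN i)) + (- TN i) *\<^sub>v y = - (TN i *\<^sub>v y)"
      using uminus_mult_mat_vec[of y "TN i"] cTN[of i] y by simp
    moreover have "((DN (Suc i) *\<^sub>v u) @\<^sub>v (DL (Suc i) *\<^sub>v w)) + ((?X \<cdot>\<^sub>v y) @\<^sub>v (- (\<phi> i *\<^sub>v y)))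
      = (DN (Suc i) *\<^sub>v u + ?X \<cdot>\<^sub>v y) @\<^sub>v (DL (Suc i) *\<^sub>v w - \<phi> i *\<^sub>v y)"
    proof -
      have "DL (Suc i) *\<^sub>v w - \<phi> i *\<^sub>v y = DL (Suc i) *\<^sub>v w + - (\<phi> i *\<^sub>v y)"
        by (rule minus_add_uminus_vec[OF mult_mat_vec_carrier[OF cL w] mult_mat_vec_carrier[OF c\<phi> y]])
      moreover have "- (\<phi> i *\<^sub>v y) \<in> carrier_vec (length (dL i))"
        using mult_mat_vec_carrier[OF c\<phi> y] by simp
      ultimately show ?thesis
        using append_vec_add[OF mult_mat_vec_carrier[OF cN u] _ mult_mat_vec_carrier[OF cL w]] y by simp
    qed
    ultimately show ?thesis by simp
  qed
  have C0: "(C 0 *\<^sub>v ((u @\<^sub>v w) @\<^sub>v vNil)) = vec 1 (\<lambda>_. (DN 0 *\<^sub>v u) $ 0 + ?X * (DL 0 *\<^sub>v w) $ 0)"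
    if u: "u \<in> carrier_vec (length (dN 0))" and w: "w \<in> carrier_vec (length (dL 0))" for u w
  proof -
    have "(u @\<^sub>v w) @\<^sub>v vNil = u @\<^sub>v w" by (intro eq_vecI) auto
    moreover have "C 0 *\<^sub>v (u @\<^sub>v w) = (DN 0 *\<^sub>v u + (?X \<cdot>\<^sub>m DL 0) *\<^sub>v w) @\<^sub>v
        (0\<^sub>m 0 (length (dN 0)) *\<^sub>v u + 0\<^sub>m 0 (length (dL 0)) *\<^sub>v w)"
      unfolding C_def nat.case
      by (rule four_block_mat_mult_vec[OF cN0 _ _ _ u w]) (use cL0 in auto)
    moreover have "(?X \<cdot>\<^sub>m DL 0) *\<^sub>v w = ?X \<cdot>\<^sub>v (DL 0 *\<^sub>v w)" by (rule smult_mat_mult_vec[OF cL0 w])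
    ultimately show ?thesis using cN0 cL0 by (intro eq_vecI) auto
  qed

  have shL: "hvec V j (?sh t) = (hvec V (j - 1) t :: ('a, 'k) mpoly vec set)" for j t by (rule hvec_shift)
  have elim: "thesis" if z: "z \<in> hvec V j (c i)" and
    k: "\<And>u w y. z = (u @\<^sub>v w) @\<^sub>v y \<Longrightarrow> u \<in> hvec V j (dN i) \<Longrightarrow> w \<in> hvec V (j - 1) (dL i) \<Longrightarrow>
      y \<in> hvec V j (tN i) \<Longrightarrow> thesis" for z :: "('a, 'k) mpoly vec" and i j thesis
  proof -
    obtain v y where v: "z = v @\<^sub>v y" "v \<in> hvec V j (dN i @ ?sh (dL i))" "y \<in> hvec V j (tN i)"
      using z unfolding c_def by (rule hvec_appendE)
    obtain u w where "v = u @\<^sub>v w" "u \<in> hvec V j (dN i)" "w \<in> hvec V j (?sh (dL i))"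
      using v(2) by (rule hvec_appendE)
    then show thesis using k[of u w y] v shL by simp
  qed
  have intro: "(u @\<^sub>v w) @\<^sub>v y \<in> hvec V j (c i)"
    if "u \<in> hvec V j (dN i)" "w \<in> hvec V (j - 1) (dL i)" "y \<in> hvec V j (tN i)" for u w y :: "('a, 'k) mpoly vec" and i j
    unfolding c_def using that shL by (intro hvec_append) auto
  have tS: "hvec V j (tN (Suc i)) = (hvec V (j - 1) (dN i) :: ('a, 'k) mpoly vec set)" for i j by (simp add: tN_def shL)

  have aug: "graded_augmentation V U (c 0) (C 0)"
    unfolding graded_augmentation_def
  proof (intro conjI allI impI ballI mC0)
    fix b assume "b < length (c 0)"
    then have b: "b < length (dN 0) + length (dL 0)" by (simp add: c_def tN_def)
    show "C 0 $$ (0, b) \<in> mono_ideal U"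
    proof (cases "b < length (dN 0)")
      case True
      then have "C 0 $$ (0, b) = DN 0 $$ (0, b)" using cN0 cL0 b by (simp add: C_def)
      then show ?thesis using augN True mono_ideal_mono[OF sub] by (auto simp: graded_augmentation_def)
    next
      case False
      let ?b = "b - length (dN 0)"
      have "C 0 $$ (0, b) = ?X * DL 0 $$ (0, ?b)" using cN0 cL0 b False by (simp add: C_def)
      moreover have "Poly_Mapping.keys (DL 0 $$ (0, ?b)) \<subseteq> ?Ux"
        using augL b False by (auto simp: graded_augmentation_def mono_ideal_def)
      ultimately show ?thesis by (auto simp: mono_ideal_def var_def keys_monom_mult)
    qed
  next
    fix j and p :: "('a, 'k) mpoly" assume p: "p \<in> homogeneous_part V j \<inter> mono_ideal U"
    \<comment> \<open>The terms of \<open>p\<close> without \<open>x\<close> lie in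
      \<open>U0\<close> by \<open>restr\<close>; the others are divided by \<open>x\<close> and then
      belong to the colon.\<close>
    define p0 where "p0 = monom_filter (\<lambda>m. x \<notin> Poly_Mapping.keys m) p"
    define p1 where "p1 = monom_filter (\<lambda>m. \<not> x \<notin> Poly_Mapping.keys m) p"
    have pp: "p = p0 + p1" unfolding p0_def p1_def by (rule monom_filter_split[symmetric])
    have "p0 \<in> homogeneous_part V j \<inter> mono_ideal U0"
      using p restr by (auto simp: p0_def homogeneous_part_iff mono_ideal_def keys_monom_filter)
    then obtain u where u: "u \<in> hvec V j (dN 0)" "(DN 0 *\<^sub>v u) $ 0 = p0"
      using augN unfolding graded_augmentation_def by blast
    obtain q where q: "p1 = ?X * q"
      unfolding var_def
    proof (rule monom_dvd_poly)
      fix m assume "m \<in> Poly_Mapping.keys p1"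
      then have "x \<in> Poly_Mapping.keys m" by (auto simp: p1_def keys_monom_filter)
      from monom_peel[OF this] show "\<exists>m'. m = Poly_Mapping.single x 1 + m'" by (metis add.commute)
    qed
    have "(+) (Poly_Mapping.single x 1) ` Poly_Mapping.keys q = Poly_Mapping.keys p1"
      using keys_monom_mult[of "Poly_Mapping.single x 1" q] q by (simp add: var_def)
    also have "\<dots> \<subseteq> Poly_Mapping.keys p" by (auto simp: p1_def keys_monom_filter)
    also have "\<dots> \<subseteq> {m \<in> monoms V. int (monom_degree m) = j} \<inter> U"
      using p by (auto simp: homogeneous_part_iff mono_ideal_def)
    finally have "(+) (Poly_Mapping.single x 1) ` Poly_Mapping.keys q
        \<subseteq> {m \<in> monoms V. int (monom_degree m) = j} \<inter> U" .
    then have "q \<in> homogeneous_part V (j - 1) \<inter> mono_ideal ?Ux"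
      by (auto simp: homogeneous_part_iff mono_ideal_def monoms_add_iff monom_degree_add)
    then obtain w where w: "w \<in> hvec V (j - 1) (dL 0)" "(DL 0 *\<^sub>v w) $ 0 = q"
      using augL unfolding graded_augmentation_def by blast
    have "(C 0 *\<^sub>v ((u @\<^sub>v w) @\<^sub>v vNil)) $ 0 = p"
      unfolding C0[OF hvec_carrier[OF u(1)] hvec_carrier[OF w(1)]] pp q using u(2) w(2) by simp
    moreover have "(u @\<^sub>v w) @\<^sub>v vNil \<in> hvec V j (c 0)"
      by (rule intro[OF u(1) w(1)]) (simp add: tN_def)
    ultimately show "\<exists>y\<in>hvec V j (c 0). (C 0 *\<^sub>v y) $ 0 = p" by blast
  qed

  have NN: "DN i *\<^sub>v (DN (Suc i) *\<^sub>v v) = 0\<^sub>v (dim_row (DN i))" if "v \<in> hvec V j (dN (Suc i))" for i v j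
    using graded_exact_mult_vec[OF exN graded_resolution_map'[OF N] that]
      graded_map_carrier[OF graded_resolution_map'[OF N]] by (metis carrier_matD(1))
  have LL: "DL i *\<^sub>v (DL (Suc i) *\<^sub>v v) = 0\<^sub>v (dim_row (DL i))" if "v \<in> hvec V j (dL (Suc i))" for i v j
    using graded_exact_mult_vec[OF exL graded_resolution_map'[OF L] that]
      graded_map_carrier[OF graded_resolution_map'[OF L]] by (metis carrier_matD(1))
  have L\<phi>: "DL (Suc i) *\<^sub>v (\<phi> (Suc i) *\<^sub>v v) = \<phi> i *\<^sub>v (DN (Suc i) *\<^sub>v v)"
    if "v \<in> carrier_vec (length (dN (Suc i)))" for i v
    using assoc_mult_mat_vec[OF cL c\<phi> that] assoc_mult_mat_vec[OF c\<phi> cN that] \<phi>(3)[of i] by simp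
  have L\<phi>0: "DL 0 *\<^sub>v (\<phi> 0 *\<^sub>v v) = DN 0 *\<^sub>v v" if "v \<in> carrier_vec (length (dN 0))" for v
    using assoc_mult_mat_vec[OF cL0 c\<phi> that] \<phi>(2) by simp
  \<comment> \<open>Finds the first two coordinates of a preimage in the cone once the last
    coordinate \<open>y\<close> is known. The clause \<open>y' = y\<close> is recorded because the
    third equation still refers to it.\<close>
  have LN_lift: "\<exists>u' w' y'. u' \<in> hvec V j (dN (Suc i)) \<and> w' \<in> hvec V (j - 1) (dL (Suc i)) \<and>
      y' \<in> hvec V (j - 1) (dN i) \<and> DN (Suc i) *\<^sub>v u' + ?X \<cdot>\<^sub>v y' = u \<and>
      DL (Suc i) *\<^sub>v w' - \<phi> i *\<^sub>v y' = w \<and> y' = y"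
    if u: "u \<in> hvec V j (dN i)" and w: "w \<in> hvec V (j - 1) (dL i)" and y: "y \<in> hvec V (j - 1) (dN i)"
      and Nu: "DN i *\<^sub>v (u - ?X \<cdot>\<^sub>v y) = 0\<^sub>v (dim_row (DN i))"
      and Lw: "DL i *\<^sub>v (w + \<phi> i *\<^sub>v y) = 0\<^sub>v (dim_row (DL i))" for i j u w y
  proof -
    have Xy: "?X \<cdot>\<^sub>v y \<in> hvec V j (dN i)" using hvec_smult[OF hx y] by simp
    have \<phi>y: "\<phi> i *\<^sub>v y \<in> hvec V (j - 1) (dL i)" by (rule graded_map_mult_vec[OF \<phi>(1) y])
    obtain u' where u': "u' \<in> hvec V j (dN (Suc i))" "DN (Suc i) *\<^sub>v u' = u - ?X \<cdot>\<^sub>v y"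
      using exN[of i] hvec_diff[OF u Xy] Nu unfolding graded_exact_def by blast
    obtain w' where w': "w' \<in> hvec V (j - 1) (dL (Suc i))" "DL (Suc i) *\<^sub>v w' = w + \<phi> i *\<^sub>v y"
      using exL[of i] hvec_add[OF w \<phi>y] Lw unfolding graded_exact_def by blast
    have "DN (Suc i) *\<^sub>v u' + ?X \<cdot>\<^sub>v y = u"
      unfolding u'(2) by (rule vec_diff_add_cancel[OF hvec_carrier[OF u] hvec_carrier[OF Xy]])
    moreover have "DL (Suc i) *\<^sub>v w' - \<phi> i *\<^sub>v y = w"
      unfolding w'(2) by (rule vec_add_diff_cancel[OF hvec_carrier[OF w] hvec_carrier[OF \<phi>y]])
    ultimately show ?thesis using u'(1) w'(1) y by blast
  qed

  have "graded_exact V (c (Suc i)) (c i) (C (Suc i)) (C i)" for i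
  proof (cases i)
    case 0
    have "graded_exact V (c (Suc 0)) (c 0) (C (Suc 0)) (C 0)"
    proof (rule graded_exactI[OF mC mC0])
      fix j and z :: "('a, 'k) mpoly vec" assume "z \<in> hvec V j (c (Suc 0))"
      then obtain u w y where z: "z = (u @\<^sub>v w) @\<^sub>v y" and u: "u \<in> hvec V j (dN (Suc 0))"
        and w: "w \<in> hvec V (j - 1) (dL (Suc 0))" and y: "y \<in> hvec V (j - 1) (dN 0)"
        by (rule elim) (auto simp: tS)
      note cv = hvec_carrier[OF u] hvec_carrier[OF w] hvec_carrier[OF y]
      have Nu: "DN (Suc 0) *\<^sub>v u \<in> carrier_vec (length (dN 0))" using cN cv(1) by (rule mult_mat_vec_carrier)
      have Lw: "DL (Suc 0) *\<^sub>v w \<in> carrier_vec (length (dL 0))" using cL cv(2) by (rule mult_mat_vec_carrier)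
      have \<phi>y: "\<phi> 0 *\<^sub>v y \<in> carrier_vec (length (dL 0))" using c\<phi> cv(3) by (rule mult_mat_vec_carrier)
      have t: "- (TN 0 *\<^sub>v y) = vNil" by (intro eq_vecI) (auto simp: TN_def)
      have "DN 0 *\<^sub>v (DN (Suc 0) *\<^sub>v u + ?X \<cdot>\<^sub>v y) = ?X \<cdot>\<^sub>v (DN 0 *\<^sub>v y)"
        using mult_add_distrib_mat_vec[OF cN0 Nu, of "?X \<cdot>\<^sub>v y"] NN[OF u] mult_mat_vec_smult[OF cN0 cv(3)]
          cv(3) cN0 mult_mat_vec_carrier[OF cN0 cv(3)] by simp
      moreover have "DL 0 *\<^sub>v (DL (Suc 0) *\<^sub>v w - \<phi> 0 *\<^sub>v y) = - (DN 0 *\<^sub>v y)"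
        using mult_minus_distrib_mat_vec[OF cL0 Lw \<phi>y] LL[OF w] L\<phi>0[OF cv(3)]
          cL0 mult_mat_vec_carrier[OF cN0 cv(3)] by simp
      ultimately show "C 0 *\<^sub>v (C (Suc 0) *\<^sub>v z) = 0\<^sub>v (length [0 :: int])"
        unfolding z C[OF cv] t
        using Nu Lw \<phi>y cv cN0 by (subst C0) (auto simp del: index_mult_mat_vec)
    next
      fix j and z :: "('a, 'k) mpoly vec"
      assume zc: "z \<in> hvec V j (c 0)" and Cz: "C 0 *\<^sub>v z = 0\<^sub>v (length [0 :: int])"
      obtain u w y0 where z0: "z = (u @\<^sub>v w) @\<^sub>v y0" and u: "u \<in> hvec V j (dN 0)"
        and w: "w \<in> hvec V (j - 1) (dL 0)" and y0: "y0 \<in> hvec V j (tN 0)"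
        by (rule elim[OF zc])
      have z: "z = (u @\<^sub>v w) @\<^sub>v vNil" using z0 y0 by (simp add: tN_def)
      note cv = hvec_carrier[OF u] hvec_carrier[OF w]
      let ?a = "(DL 0 *\<^sub>v w) $ 0"
      have a: "(DN 0 *\<^sub>v u) $ 0 = ?X * (- ?a)"
      proof -
        have "(C 0 *\<^sub>v z) $ 0 = 0" unfolding Cz by simp
        then have "(DN 0 *\<^sub>v u) $ 0 + ?X * ?a = 0" unfolding z C0[OF cv] by simp
        then show ?thesis by (simp add: eq_neg_iff_add_eq_0)
      qed
      have "DL 0 *\<^sub>v w \<in> hvec V (j - 1) [0]" by (rule graded_map_mult_vec[OF mL0 w])
      then have ha: "- ?a \<in> homogeneous_part V (j - 1)" by (simp add: hvec_def)
      \<comment> \<open>By the equation \<open>a\<close> this element of \<open>U0\<close> is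
        \<open>x\<close> times \<open>- ?a\<close>. By \<open>cancel\<close> also
        \<open>- ?a\<close> is supported on \<open>U0\<close>, and it lifts to the last coordinate
        \<open>y\<close>.\<close>
      have "(DN 0 *\<^sub>v u) $ 0 \<in> mono_ideal U0"
        by (rule graded_augmentation_mult_vec[OF augN U0 u])
      then have "(+) (Poly_Mapping.single x 1) ` Poly_Mapping.keys (- ?a) \<subseteq> U0"
        unfolding a by (simp add: mono_ideal_def var_def keys_monom_mult)
      then have "- ?a \<in> mono_ideal U0"
        using cancel ha by (auto simp: mono_ideal_def homogeneous_part_iff)
      then obtain y where y: "y \<in> hvec V (j - 1) (dN 0)" "(DN 0 *\<^sub>v y) $ 0 = - ?a"
        using augN ha unfolding graded_augmentation_def by blast
      note cy = hvec_carrier[OF y(1)]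
      have \<phi>y: "\<phi> 0 *\<^sub>v y \<in> carrier_vec (length (dL 0))" using c\<phi> cy by (rule mult_mat_vec_carrier)
      have Nu: "DN 0 *\<^sub>v (u - ?X \<cdot>\<^sub>v y) = 0\<^sub>v (dim_row (DN 0))"
      proof -
        have "DN 0 *\<^sub>v (u - ?X \<cdot>\<^sub>v y) = DN 0 *\<^sub>v u - ?X \<cdot>\<^sub>v (DN 0 *\<^sub>v y)"
          using mult_minus_distrib_mat_vec[OF cN0 cv(1), of "?X \<cdot>\<^sub>v y"] mult_mat_vec_smult[OF cN0 cy] cy by simp
        then show ?thesis using a y(2) cN0 by (intro eq_vecI) (auto simp del: index_mult_mat_vec)
      qed
      have Lw: "DL 0 *\<^sub>v (w + \<phi> 0 *\<^sub>v y) = 0\<^sub>v (dim_row (DL 0))"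
      proof -
        have "DL 0 *\<^sub>v (w + \<phi> 0 *\<^sub>v y) = DL 0 *\<^sub>v w + DN 0 *\<^sub>v y"
          using mult_add_distrib_mat_vec[OF cL0 cv(2) \<phi>y] L\<phi>0[OF cy] by simp
        then show ?thesis using y(2) cN0 cL0 by (intro eq_vecI) (auto simp del: index_mult_mat_vec)
      qed
      obtain u' w' y' where l: "u' \<in> hvec V j (dN (Suc 0))" "w' \<in> hvec V (j - 1) (dL (Suc 0))"
        "y' \<in> hvec V (j - 1) (dN 0)" "DN (Suc 0) *\<^sub>v u' + ?X \<cdot>\<^sub>v y' = u"
        "DL (Suc 0) *\<^sub>v w' - \<phi> 0 *\<^sub>v y' = w"
        using LN_lift[OF u w y(1) Nu Lw] by blast
      have "- (TN 0 *\<^sub>v y') = vNil" by (intro eq_vecI) (auto simp: TN_def)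
      then have "C (Suc 0) *\<^sub>v ((u' @\<^sub>v w') @\<^sub>v y') = z"
        unfolding z C[OF hvec_carrier[OF l(1)] hvec_carrier[OF l(2)] hvec_carrier[OF l(3)]] l(4,5) by simp
      moreover have "(u' @\<^sub>v w') @\<^sub>v y' \<in> hvec V j (c (Suc 0))"
        by (rule intro[OF l(1,2)]) (use l(3) in \<open>simp add: tS\<close>)
      ultimately show "\<exists>y\<in>hvec V j (c (Suc 0)). C (Suc 0) *\<^sub>v y = z" by blast
    qed
    then show ?thesis using 0 by simp
  next
    case (Suc k)
    have "graded_exact V (c (Suc (Suc k))) (c (Suc k)) (C (Suc (Suc k))) (C (Suc k))"
    proof (rule graded_exactI[OF mC mC])
      fix j and z :: "('a, 'k) mpoly vec" assume "z \<in> hvec V j (c (Suc (Suc k)))"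
      then obtain u w y where z: "z = (u @\<^sub>v w) @\<^sub>v y" and u: "u \<in> hvec V j (dN (Suc (Suc k)))"
        and w: "w \<in> hvec V (j - 1) (dL (Suc (Suc k)))" and y: "y \<in> hvec V (j - 1) (dN (Suc k))"
        by (rule elim) (auto simp: tS)
      note cv = hvec_carrier[OF u] hvec_carrier[OF w] hvec_carrier[OF y]
      have Nu: "DN (Suc (Suc k)) *\<^sub>v u \<in> carrier_vec (length (dN (Suc k)))" using cN cv(1) by (rule mult_mat_vec_carrier)
      have Lw: "DL (Suc (Suc k)) *\<^sub>v w \<in> carrier_vec (length (dL (Suc k)))" using cL cv(2) by (rule mult_mat_vec_carrier)
      have \<phi>y: "\<phi> (Suc k) *\<^sub>v y \<in> carrier_vec (length (dL (Suc k)))" using c\<phi> cv(3) by (rule mult_mat_vec_carrier)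
      have Ny: "DN (Suc k) *\<^sub>v y \<in> carrier_vec (length (dN k))" using cN cv(3) by (rule mult_mat_vec_carrier)
      have \<phi>Ny: "\<phi> k *\<^sub>v (DN (Suc k) *\<^sub>v y) \<in> carrier_vec (length (dL k))" using c\<phi> Ny by (rule mult_mat_vec_carrier)
      have T: "TN (Suc k) = DN (Suc k)" by (simp add: TN_def)
      have 1: "DN (Suc k) *\<^sub>v (DN (Suc (Suc k)) *\<^sub>v u + ?X \<cdot>\<^sub>v y) + ?X \<cdot>\<^sub>v (- (DN (Suc k) *\<^sub>v y))
          = 0\<^sub>v (length (dN k))"
        using mult_add_distrib_mat_vec[OF cN Nu, of "?X \<cdot>\<^sub>v y"] NN[OF u] mult_mat_vec_smult[OF cN cv(3)]
          cv(3) cN[of k] Ny by (simp add: smult_vec_uminus)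
      have 2: "DL (Suc k) *\<^sub>v (DL (Suc (Suc k)) *\<^sub>v w - \<phi> (Suc k) *\<^sub>v y) - \<phi> k *\<^sub>v (- (DN (Suc k) *\<^sub>v y))
          = 0\<^sub>v (length (dL k))"
        using mult_minus_distrib_mat_vec[OF cL Lw \<phi>y] LL[OF w] L\<phi>[OF cv(3)] mult_mat_vec_uminus[OF c\<phi> Ny]
          cL[of k] \<phi>Ny by simp
      have 3: "- (TN k *\<^sub>v (- (DN (Suc k) *\<^sub>v y))) = 0\<^sub>v (length (tN k))"
      proof (cases k)
        case 0
        then show ?thesis by (intro eq_vecI) (auto simp: TN_def tN_def)
      next
        case (Suc l)
        have "TN k *\<^sub>v (DN (Suc k) *\<^sub>v y) = 0\<^sub>v (length (tN k))"
          using NN[OF y] Suc cN[of l] by (auto simp: TN_def tN_def)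
        then show ?thesis using mult_mat_vec_uminus[OF cTN Ny] by simp
      qed
      have cN': "DN (Suc (Suc k)) *\<^sub>v u + ?X \<cdot>\<^sub>v y \<in> carrier_vec (length (dN (Suc k)))" using Nu cv(3) by simp
      have cL': "DL (Suc (Suc k)) *\<^sub>v w - \<phi> (Suc k) *\<^sub>v y \<in> carrier_vec (length (dL (Suc k)))" using Lw \<phi>y by simp
      have cT': "- (DN (Suc k) *\<^sub>v y) \<in> carrier_vec (length (dN k))" using Ny by simp
      show "C (Suc k) *\<^sub>v (C (Suc (Suc k)) *\<^sub>v z) = 0\<^sub>v (length (c k))"
        unfolding z C[OF cv] T C[OF cN' cL' cT'] 1 2 3 c_def by (intro eq_vecI) auto
    next
      fix j and z :: "('a, 'k) mpoly vec"
      assume zc: "z \<in> hvec V j (c (Suc k))" and Cz: "C (Suc k) *\<^sub>v z = 0\<^sub>v (length (c k))"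
      obtain u w y where z: "z = (u @\<^sub>v w) @\<^sub>v y" and u: "u \<in> hvec V j (dN (Suc k))"
        and w: "w \<in> hvec V (j - 1) (dL (Suc k))" and "y \<in> hvec V j (tN (Suc k))"
        by (rule elim[OF zc])
      then have y: "y \<in> hvec V (j - 1) (dN k)" by (simp only: tS)
      note cv = hvec_carrier[OF u] hvec_carrier[OF w] hvec_carrier[OF y]
      have Nu: "DN (Suc k) *\<^sub>v u \<in> carrier_vec (length (dN k))" using cN cv(1) by (rule mult_mat_vec_carrier)
      have Lw: "DL (Suc k) *\<^sub>v w \<in> carrier_vec (length (dL k))" using cL cv(2) by (rule mult_mat_vec_carrier)
      have \<phi>y: "\<phi> k *\<^sub>v y \<in> carrier_vec (length (dL k))" using c\<phi> cv(3) by (rule mult_mat_vec_carrier)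
      have "0\<^sub>v (length (c k)) = (0\<^sub>v (length (dN k)) @\<^sub>v 0\<^sub>v (length (dL k))) @\<^sub>v (0\<^sub>v (length (tN k)) :: ('a, 'k) mpoly vec)"
        unfolding c_def by (intro eq_vecI) auto
      then have z1: "DN (Suc k) *\<^sub>v u + ?X \<cdot>\<^sub>v y = 0\<^sub>v (length (dN k))"
        and z2: "DL (Suc k) *\<^sub>v w - \<phi> k *\<^sub>v y = 0\<^sub>v (length (dL k))"
        using Cz Nu Lw \<phi>y cv(3) unfolding z C[OF cv]
        by (auto simp: append_vec_eq[of _ "length (dN k) + length (dL k)"] append_vec_eq[of _ "length (dN k)"])
      define s where "s = (case k of 0 \<Rightarrow> [0] | Suc j \<Rightarrow> dN j)"
      have cNk: "DN k \<in> carrier_mat (length s) (length (dN k))"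
        unfolding s_def by (rule graded_map_carrier[OF graded_resolution_map'[OF N]])
      have dimk: "dim_row (DN k) = length s" using cNk by simp
      \<comment> \<open>The first coordinate of the cone equation says that \<open>x\<close> times
        \<open>y\<close> is a boundary; applying \<open>DN k\<close> and cancelling \<open>x\<close>
        shows that \<open>y\<close> is a cycle.\<close>
      have "?X \<cdot>\<^sub>v (DN k *\<^sub>v y) = 0\<^sub>v (length s)"
      proof -
        have "?X \<cdot>\<^sub>v y = - (DN (Suc k) *\<^sub>v u)"
          using z1 vec_add_eq_0_iff[OF Nu, of "?X \<cdot>\<^sub>v y"] cv(3) by simp
        then have "DN k *\<^sub>v (?X \<cdot>\<^sub>v y) = 0\<^sub>v (length s)"
          using mult_mat_vec_uminus[OF cNk Nu] NN[OF u] dimk by simp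
        then show ?thesis using mult_mat_vec_smult[OF cNk cv(3)] by simp
      qed
      then have Ny: "DN k *\<^sub>v y = 0\<^sub>v (length s)"
        using monom_smult_vec_eq_0_iff[OF mult_mat_vec_carrier[OF cNk cv(3)]] unfolding var_def by blast
      then have "DN k *\<^sub>v (- y) = 0\<^sub>v (dim_row (DN k))"
        using mult_mat_vec_uminus[OF cNk cv(3)] dimk by simp
      \<comment> \<open>The third coordinate of the differential is \<open>- TN\<close>, which
        accounts for the sign.\<close>
      then obtain y2 where y2: "y2 \<in> hvec V (j - 1) (dN (Suc k))" "DN (Suc k) *\<^sub>v y2 = - y"
        using exN[of k] hvec_uminus[OF y] unfolding graded_exact_def by blast
      note cy2 = hvec_carrier[OF y2(1)]
      have \<phi>y2: "\<phi> (Suc k) *\<^sub>v y2 \<in> carrier_vec (length (dL (Suc k)))" using c\<phi> cy2 by (rule mult_mat_vec_carrier)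
      have "DN (Suc k) *\<^sub>v (u - ?X \<cdot>\<^sub>v y2) = DN (Suc k) *\<^sub>v u - ?X \<cdot>\<^sub>v (- y)"
        using mult_minus_distrib_mat_vec[OF cN cv(1), of "?X \<cdot>\<^sub>v y2"] mult_mat_vec_smult[OF cN cy2] cy2 y2(2)
        by simp
      also have "\<dots> = DN (Suc k) *\<^sub>v u + ?X \<cdot>\<^sub>v y" using Nu cv(3) by (simp add: smult_vec_uminus)
          (simp add: minus_add_uminus_vec[of _ "length (dN k)"])
      finally have Nu2: "DN (Suc k) *\<^sub>v (u - ?X \<cdot>\<^sub>v y2) = 0\<^sub>v (dim_row (DN (Suc k)))"
        using z1 cN[of k] by simp
      have "DL (Suc k) *\<^sub>v (w + \<phi> (Suc k) *\<^sub>v y2) = DL (Suc k) *\<^sub>v w + - (\<phi> k *\<^sub>v y)"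
        using mult_add_distrib_mat_vec[OF cL cv(2) \<phi>y2] L\<phi>[OF cy2] y2(2) mult_mat_vec_uminus[OF c\<phi> cv(3)]
        by simp
      then have Lw2: "DL (Suc k) *\<^sub>v (w + \<phi> (Suc k) *\<^sub>v y2) = 0\<^sub>v (dim_row (DL (Suc k)))"
        using z2 cL[of k] minus_add_uminus_vec[OF Lw \<phi>y] by simp
      obtain u' w' y' where l: "u' \<in> hvec V j (dN (Suc (Suc k)))" "w' \<in> hvec V (j - 1) (dL (Suc (Suc k)))"
        "y' \<in> hvec V (j - 1) (dN (Suc k))" "DN (Suc (Suc k)) *\<^sub>v u' + ?X \<cdot>\<^sub>v y' = u"
        "DL (Suc (Suc k)) *\<^sub>v w' - \<phi> (Suc k) *\<^sub>v y' = w" "y' = y2"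
        using LN_lift[OF u w y2(1) Nu2 Lw2] by blast
      have "- (TN (Suc k) *\<^sub>v y') = y" using y2(2) l(6) by (simp add: TN_def)
      then have "C (Suc (Suc k)) *\<^sub>v ((u' @\<^sub>v w') @\<^sub>v y') = z"
        unfolding z C[OF hvec_carrier[OF l(1)] hvec_carrier[OF l(2)] hvec_carrier[OF l(3)]] l(4,5) by simp
      moreover have "(u' @\<^sub>v w') @\<^sub>v y' \<in> hvec V j (c (Suc (Suc k)))"
        by (rule intro[OF l(1,2)]) (use l(3) in \<open>simp add: tS\<close>)
      ultimately show "\<exists>y\<in>hvec V j (c (Suc (Suc k))). C (Suc (Suc k)) *\<^sub>v y = z" by blast
    qed
    then show ?thesis using Suc by simp
  qed
  moreover have "\<forall>i. \<forall>j\<in>set (c i). j \<le> r + int i"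
  proof (intro allI ballI)
    fix i j assume "j \<in> set (c i)"
    then show "j \<le> r + int i"
      using dN dL by (cases i) (force simp: c_def tN_def)+
  qed
  ultimately show ?thesis using aug unfolding reg_le_def graded_resolution_def by blast
qed

section \<open>Vertex covers and the upper bound\<close>

lemma edgeE:
  assumes "finite_simple_graph G" "e \<in> edges G" "x \<in> e"
  obtains y where "e = {x, y}" "y \<noteq> x" "y \<in> nbhd G x" "x \<in> nbhd G y"
proof -
  have e: "e \<subseteq> verts G" "card e = 2" using assms by (auto simp: finite_simple_graph_def)
  obtain a b where ab: "e = {a, b}" "a \<noteq> b" using e(2) by (auto simp: card_2_iff)
  define y where "y = (if x = a then b else a)"
  have y: "e = {x, y}" "y \<noteq> x" using ab assms(3) by (auto simp: y_def)
  then have "y \<in> nbhd G x" "x \<in> nbhd G y"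
    using e(1) assms(2) by (auto simp: nbhd_def insert_commute)
  with y show thesis by (rule that)
qed

lemma not_in_nbhd: "finite_simple_graph G \<Longrightarrow> x \<notin> nbhd G x"
  by (auto simp: finite_simple_graph_def nbhd_def)

lemma edge_meets_nbhd:
  assumes "finite_simple_graph G" "e \<in> edges G" "e \<inter> closed_nbhd G x \<noteq> {}"
  shows "e \<inter> nbhd G x \<noteq> {}"
proof (cases "x \<in> e")
  case True
  then obtain y where "e = {x, y}" "y \<in> nbhd G x" by (rule edgeE[OF assms(1,2)])
  then show ?thesis by auto
qed (use assms(3) in \<open>auto simp: closed_nbhd_def\<close>)

text \<open>Edges meeting N[x] already meet N(x), and the others are covered by \<open>C\<close>. A
  neighbour of \<open>x\<close> cannot be dropped since \<open>x\<close> is outside the cover; a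
  vertex of \<open>C\<close> cannot be dropped by minimality in the smaller graph.\<close>

lemma minimal_vertex_cover_extend:
  assumes G: "finite_simple_graph G" and x: "x \<in> verts G"
    and C: "minimal_vertex_cover (delete_verts G (closed_nbhd G x)) C"
  shows "minimal_vertex_cover G (nbhd G x \<union> C)"
  unfolding minimal_vertex_cover_def
proof (intro conjI allI impI)
  have covC: "vertex_cover (delete_verts G (closed_nbhd G x)) C"
    and minC: "\<And>C'. C' \<subset> C \<Longrightarrow> \<not> vertex_cover (delete_verts G (closed_nbhd G x)) C'"
    using C by (auto simp: minimal_vertex_cover_def)
  have sub: "C \<subseteq> verts G" "C \<inter> closed_nbhd G x = {}"
    and cov: "\<And>e. e \<in> edges G \<Longrightarrow> e \<inter> closed_nbhd G x = {} \<Longrightarrow> e \<inter> C \<noteq> {}"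
    using covC by (auto simp: vertex_cover_def delete_verts_def)
  have min: "\<exists>e\<in>edges G. e \<inter> closed_nbhd G x = {} \<and> e \<inter> C' = {}" if C': "C' \<subset> C" for C'
  proof -
    have "C' \<subseteq> verts (delete_verts G (closed_nbhd G x))"
      using covC C' by (auto simp: vertex_cover_def)
    then obtain e where "e \<in> edges (delete_verts G (closed_nbhd G x))" "e \<inter> C' = {}"
      using minC[OF C'] by (auto simp: vertex_cover_def)
    then show ?thesis by (auto simp: delete_verts_def)
  qed
  show "vertex_cover G (nbhd G x \<union> C)"
    unfolding vertex_cover_def
  proof (intro conjI ballI)
    show "nbhd G x \<union> C \<subseteq> verts G" using sub(1) by (auto simp: nbhd_def)
    fix e assume "e \<in> edges G"
    then show "e \<inter> (nbhd G x \<union> C) \<noteq> {}"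
      using cov edge_meets_nbhd[OF G] by blast
  qed
  fix C'' assume C'': "C'' \<subset> nbhd G x \<union> C"
  then obtain z where z: "z \<in> nbhd G x \<union> C" "z \<notin> C''" by auto
  show "\<not> vertex_cover G C''"
  proof (cases "z \<in> nbhd G x")
    case True
    then have "{x, z} \<in> edges G" by (simp add: nbhd_def)
    moreover have "x \<notin> C''" using not_in_nbhd[OF G, of x] sub(2) C'' by (auto simp: closed_nbhd_def)
    ultimately show ?thesis using z(2) by (auto simp: vertex_cover_def intro!: bexI[of _ "{x, z}"])
  next
    case False
    then have "C'' \<inter> C \<subset> C" using z by auto
    then obtain e where e: "e \<in> edges G" "e \<inter> closed_nbhd G x = {}" "e \<inter> (C'' \<inter> C) = {}"
      using min by blast
    then have "e \<inter> C'' = {}" using C'' by (auto simp: closed_nbhd_def)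
    then show ?thesis using e(1) unfolding vertex_cover_def by blast
  qed
qed

text \<open>This is deg(J(G)) by \<open>ideal_degree_cover_ideal\<close>, without reference to a
  field.\<close>

definition max_cover :: "'a ugraph \<Rightarrow> nat" where
  "max_cover G = Max (card ` {C. minimal_vertex_cover G C})"

lemma finite_minimal_vertex_covers: "finite_simple_graph G \<Longrightarrow> finite {C. minimal_vertex_cover G C}"
  by (rule finite_subset[of _ "Pow (verts G)"])
     (auto simp: minimal_vertex_cover_def vertex_cover_def finite_simple_graph_def)

lemma minimal_vertex_cover_exists:
  assumes "finite_simple_graph G"
  shows "\<exists>C. minimal_vertex_cover G C"
proof -
  have "vertex_cover G (verts G)"
    using assms unfolding vertex_cover_def finite_simple_graph_def
    by (metis card.empty inf.absorb1 order_refl zero_neq_numeral)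
  moreover have "finite {C. vertex_cover G C}"
    by (rule finite_subset[of _ "Pow (verts G)"])
      (use assms in \<open>auto simp: vertex_cover_def finite_simple_graph_def\<close>)
  ultimately obtain C where "vertex_cover G C" "\<And>C'. vertex_cover G C' \<Longrightarrow> C' \<subseteq> C \<Longrightarrow> C = C'"
    using finite_has_minimal[of "{C. vertex_cover G C}"] by auto
  then show ?thesis unfolding minimal_vertex_cover_def by blast
qed

lemma card_le_max_cover:
  "finite_simple_graph G \<Longrightarrow> minimal_vertex_cover G C \<Longrightarrow> card C \<le> max_cover G"
  unfolding max_cover_def using finite_minimal_vertex_covers by (intro Max_ge) auto

lemma max_cover_attained:
  assumes "finite_simple_graph G"
  obtains C where "minimal_vertex_cover G C" "card C = max_cover G"
proof -
  have "max_cover G \<in> card ` {C. minimal_vertex_cover G C}"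
    unfolding max_cover_def
    using finite_minimal_vertex_covers[OF assms] minimal_vertex_cover_exists[OF assms] by (intro Max_in) auto
  then show thesis using that by auto
qed

text \<open>A largest minimal cover of the smaller graph is disjoint from N(x) and is extended by
  it. This inequality pays for the monomial factor that appears when \<open>x\<close> is split
  off.\<close>

lemma max_cover_delete:
  assumes G: "finite_simple_graph G" and x: "x \<in> verts G"
    and G': "finite_simple_graph (delete_verts G (closed_nbhd G x))"
  shows "max_cover (delete_verts G (closed_nbhd G x)) + card (nbhd G x) \<le> max_cover G"
proof -
  obtain C where C: "minimal_vertex_cover (delete_verts G (closed_nbhd G x)) C"
    "card C = max_cover (delete_verts G (closed_nbhd G x))"
    by (rule max_cover_attained[OF G'])
  have min: "minimal_vertex_cover G (nbhd G x \<union> C)" by (rule minimal_vertex_cover_extend[OF G x C(1)])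
  have "finite (nbhd G x \<union> C)" by (rule minimal_vertex_cover_finite[OF G min])
  moreover have "nbhd G x \<inter> C = {}"
    using C(1) by (auto simp: minimal_vertex_cover_def vertex_cover_def delete_verts_def closed_nbhd_def)
  ultimately have "card (nbhd G x \<union> C) = card (nbhd G x) + card C" by (intro card_Un_disjoint) auto
  then show ?thesis using card_le_max_cover[OF G min] C(2) by simp
qed

text \<open>Exponents of the monomials in \<open>J(G)\<^sup>(\<^sup>k\<^sup>) : \<Prod>x\<in>A. x\<close>.\<close>

definition colon_exponents :: "'a set \<Rightarrow> 'a ugraph \<Rightarrow> 'a set \<Rightarrow> nat \<Rightarrow> ('a \<Rightarrow>\<^sub>0 nat) set" where
  "colon_exponents V G A k =
     {m \<in> monoms V. \<forall>e\<in>edges G. k \<le> (\<Sum>y\<in>e. Poly_Mapping.lookup m y) + card (e \<inter> A)}"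

lemma up_closed_colon_exponents: "up_closed V (colon_exponents V G A k)"
  by (auto simp: up_closed_def colon_exponents_def monoms_add_iff lookup_add sum.distrib)

lemma up_closed_translate:
  assumes U: "up_closed V U" and t: "t \<in> monoms V"
  shows "up_closed V ((+) t ` U)"
proof -
  have "s + (t + m) = t + (s + m)" for s m :: "'a \<Rightarrow>\<^sub>0 nat" by (simp add: ac_simps)
  then show ?thesis using U t by (auto simp: up_closed_def monoms_add_iff)
qed

lemma nat_poly_mapping_le_add:
  fixes s m :: "'a \<Rightarrow>\<^sub>0 nat"
  assumes "\<And>y. Poly_Mapping.lookup s y \<le> Poly_Mapping.lookup m y"
  shows "m = s + (m - s)"
  using assms by (intro poly_mapping_eqI) (simp add: lookup_add lookup_minus)

text \<open>The recursion is lexicographic: splitting off \<open>x\<close> or deleting an isolated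
  vertex shrinks the graph, a full \<open>A\<close> lowers \<open>k\<close> by two, and adding a
  vertex to \<open>A\<close> shrinks its complement. The set \<open>V\<close> of variables stays
  fixed, and \<open>max 0\<close> allows for the unit ideal.\<close>

lemma reg_le_colon:
  fixes \<H> :: "'a ugraph set"
  assumes simple: "\<And>G. G \<in> \<H> \<Longrightarrow> finite_simple_graph G"
    and del: "\<And>G x. G \<in> \<H> \<Longrightarrow> x \<in> verts G \<Longrightarrow> delete_verts G (closed_nbhd G x) \<in> \<H>"
    and half: "\<And>G. G \<in> \<H> \<Longrightarrow> \<nexists>x. isolated_vertex G x \<Longrightarrow>
           \<exists>C. minimal_vertex_cover G C \<and> real (card C) \<ge> real (card (verts G)) / 2"
  shows "G \<in> \<H> \<Longrightarrow> verts G \<subseteq> V \<Longrightarrow> A \<subseteq> verts G \<Longrightarrow>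
    reg_le TYPE('k::field) V (colon_exponents V G A k)
      (max 0 ((int k - 1) * int (max_cover G) + int (card (verts G)) - 1 - int (card A)))"
proof (induction "(card (verts G), k, card (verts G - A))" arbitrary: G A k
    rule: wf_induct_rule[OF wf_lex_prod[OF wf_less_than wf_lex_prod[OF wf_less_than wf_less_than]], case_names less])
  case (less G A k)
  note G = simple[OF less.prems(1)]
  have finV: "finite (verts G)" and edge: "\<And>e. e \<in> edges G \<Longrightarrow> e \<subseteq> verts G \<and> card e = 2"
    using G by (auto simp: finite_simple_graph_def)
  have fine: "finite e" if "e \<in> edges G" for e using edge[OF that] by (auto intro: card_ge_0_finite)
  have finA: "finite A" using less.prems(3) finV by (rule finite_subset)
  let ?U = "colon_exponents V G A k"
  define n where "n = int (card (verts G))"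
  define D where "D = int (max_cover G)"
  define r where "r = max 0 ((int k - 1) * D + n - 1 - int (card A))"
  have goal: "reg_le TYPE('k) V ?U r"
  \<comment> \<open>The case of the unit ideal includes \<open>k = 0\<close>.\<close>
  proof (cases "?U = monoms V")
    case True
    then show ?thesis unfolding True by (intro reg_le_monoms) (simp add: r_def)
  next
    case False
    have "?U \<subseteq> monoms V" by (auto simp: colon_exponents_def)
    \<comment> \<open>An edge whose condition does not already follow from \<open>A\<close>; it
      supplies \<open>k \<ge> 1\<close> and, later, a positive number of vertices.\<close>
    then obtain e0 where e0: "e0 \<in> edges G" "card (e0 \<inter> A) < k"
      using False unfolding colon_exponents_def by fastforce
    have k1: "k \<ge> 1" using e0(2) by simp
    show ?thesis
    proof (cases "\<exists>z. isolated_vertex G z")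
      case True
      then obtain z where z: "z \<in> verts G" "nbhd G z = {}" by (auto simp: isolated_vertex_def)
      \<comment> \<open>An isolated vertex lies on no edge, so deleting it changes no exponent
        condition; |V(G)| drops by one and |A| by at most one.\<close>
      define G' where "G' = delete_verts G (closed_nbhd G z)"
      have cn: "closed_nbhd G z = {z}" using z(2) by (simp add: closed_nbhd_def)
      have G'H: "G' \<in> \<H>" unfolding G'_def by (rule del[OF less.prems(1) z(1)])
      have V': "verts G' = verts G - {z}" by (simp add: G'_def delete_verts_def cn)
      have "z \<notin> e" if "e \<in> edges G" for e
        using edgeE[OF G that, of z] z(2) by blast
      then have E': "edges G' = edges G" by (auto simp: G'_def delete_verts_def cn)
      have "e \<inter> (A - {z}) = e \<inter> A" if "e \<in> edges G" for e
        using \<open>\<And>e. e \<in> edges G \<Longrightarrow> z \<notin> e\<close>[OF that] by auto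
      then have U': "colon_exponents V G' (A - {z}) k = ?U" by (simp add: colon_exponents_def E')
      have card': "card (verts G) = Suc (card (verts G'))" unfolding V' by (rule card.remove[OF finV z(1)])
      have "reg_le TYPE('k) V (colon_exponents V G' (A - {z}) k)
        (max 0 ((int k - 1) * int (max_cover G') + int (card (verts G')) - 1 - int (card (A - {z}))))"
        by (rule less.hyps) (use card' G'H V' less.prems in auto)
      moreover have "int (max_cover G') \<le> D"
        using max_cover_delete[OF G z(1)] simple[OF G'H] z(2) by (simp add: G'_def D_def)
      then have "(int k - 1) * int (max_cover G') \<le> (int k - 1) * D" using k1 by (intro mult_left_mono) auto
      moreover have "card A \<le> Suc (card (A - {z}))" by (simp add: card_Diff_singleton_if) linarith
      ultimately show ?thesis
        unfolding U' r_def n_def using card' by (elim reg_le_mono) auto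
    next
      case noiso: False
      obtain C where C: "minimal_vertex_cover G C" "real (card C) \<ge> real (card (verts G)) / 2"
        using half[OF less.prems(1)] noiso by blast
      have nD: "n \<le> 2 * D"
        using card_le_max_cover[OF G C(1)] C(2) by (simp add: n_def D_def)
      have "e0 \<noteq> {}" using edge[OF e0(1)] by auto
      then have n1: "n \<ge> 1"
        using edge[OF e0(1)] finV by (auto simp: n_def Suc_le_eq card_gt_0_iff)
      then have D1: "D \<ge> 1" using nD by simp
      show ?thesis
      proof (cases "A = verts G")
        case True
        have eA: "card (e \<inter> A) = 2" if "e \<in> edges G" for e
          using edge[OF that] by (simp add: True inf.absorb1)
        have k3: "k > 2" using e0 eA by simp
        \<comment> \<open>Both ends of every edge lie in \<open>A\<close>, so each condition is
          lowered by two; \<open>k > 2\<close> because the edge \<open>e0\<close> is not yet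
          satisfied by \<open>A\<close>.\<close>
        have "?U = colon_exponents V G {} (k - 2)"
          using eA k3 by (auto simp: colon_exponents_def le_diff_conv)
        moreover have reg2: "reg_le TYPE('k) V (colon_exponents V G {} (k - 2))
          (max 0 ((int (k - 2) - 1) * int (max_cover G) + int (card (verts G)) - 1 - int (card ({} :: 'a set))))"
          by (rule less.hyps) (use k3 less.prems in auto)
        \<comment> \<open>The restart bound against the bound for full \<open>A\<close>, where
          \<open>card A\<close> equals \<open>n\<close>; this is where \<open>n \<le> 2 * D\<close>
          enters.\<close>
        moreover have "(int k - 3) * D + n - 1 \<le> (int k - 1) * D - 1"
          using nD by (simp add: algebra_simps)
        moreover have "0 \<le> (int k - 1) * D" using k1 D1 by simp
        ultimately show ?thesis
          using reg_le_mono[OF reg2, of r] k3 by (simp add: r_def True n_def D_def of_nat_diff)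
      next
        case nA: False
        then obtain x where x: "x \<in> verts G" "x \<notin> A" using less.prems(3) by auto
        have cA: "int (card A) + 1 \<le> n"
        proof -
          have "card (insert x A) \<le> card (verts G)" using x less.prems(3) finV by (intro card_mono) auto
          then show ?thesis using x(2) finA by (simp add: n_def)
        qed
        \<comment> \<open>The colon by \<open>x\<close> must meet the bound \<open>r - 1\<close>,
          and \<open>max 0\<close> there requires \<open>r \<ge> 1\<close>. For \<open>k = 1\<close>
          both ends of \<open>e0\<close> lie outside \<open>A\<close>; for larger \<open>k\<close>
          the summand \<open>(k - 1) * D\<close> is at least 1.\<close>
        have r1: "r \<ge> 1" and r: "r = (int k - 1) * D + n - 1 - int (card A)"
        proof -
          have "1 \<le> (int k - 1) * D + n - 1 - int (card A)"
          proof (cases "k = 1")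
            case True
            then have "e0 \<inter> A = {}" using e0 fine[OF e0(1)] by simp
            then have "card (e0 \<union> A) = 2 + card A"
              using edge[OF e0(1)] fine[OF e0(1)] finA by (subst card_Un_disjoint) auto
            moreover have "card (e0 \<union> A) \<le> card (verts G)"
              using edge[OF e0(1)] less.prems(3) finV by (intro card_mono) auto
            ultimately show ?thesis using True by (simp add: n_def)
          next
            case False
            then have "1 * D \<le> (int k - 1) * D" using k1 D1 by (intro mult_right_mono) auto
            then show ?thesis using D1 cA by linarith
          qed
          then show "r \<ge> 1" "r = (int k - 1) * D + n - 1 - int (card A)" by (auto simp: r_def)
        qed
        define G' where "G' = delete_verts G (closed_nbhd G x)"
        define N where "N = nbhd G x"
        define A' where "A' = A - N"
        \<comment> \<open>A monomial of the ideal without \<open>x\<close> must satisfy the edge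
          from \<open>x\<close> to a neighbour \<open>v\<close> by its exponent at \<open>v\<close>
          alone, with one unit less if \<open>v\<close> is in \<open>A\<close>. So \<open>t\<close>
          divides all these monomials.\<close>
        define t where "t = (\<Sum>v\<in>N. Poly_Mapping.single v (k - (if v \<in> A then 1 else 0)))"
        have G'H: "G' \<in> \<H>" unfolding G'_def by (rule del[OF less.prems(1) x(1)])
        have NV: "N \<subseteq> verts G" by (auto simp: N_def nbhd_def)
        have finN: "finite N" using NV finV by (rule finite_subset)
        have xN: "x \<notin> N" unfolding N_def by (rule not_in_nbhd[OF G])
        have V': "verts G' = verts G - insert x N" by (auto simp: G'_def delete_verts_def closed_nbhd_def N_def)
        have E': "edges G' = {e \<in> edges G. e \<inter> insert x N = {}}"
          by (auto simp: G'_def delete_verts_def closed_nbhd_def N_def)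
        have t_lookup: "Poly_Mapping.lookup t v = (if v \<in> N then k - (if v \<in> A then 1 else 0) else 0)" for v
          using finN by (simp add: t_def lookup_sum lookup_single when_def)
        have tV: "t \<in> monoms V"
          using NV less.prems(2) by (auto simp: monoms_def in_keys_iff t_lookup split: if_splits)
        have t_deg: "int (monom_degree t) = int k * int (card N) - int (card (A \<inter> N))"
        proof -
          have "Poly_Mapping.keys t \<subseteq> N" by (auto simp: in_keys_iff t_lookup split: if_splits)
          then have "monom_degree t = (\<Sum>v\<in>N. k - (if v \<in> A then 1 else 0))"
            using monom_degree_eq_sum[OF finN, of t] by (simp add: t_lookup)
          then have "int (monom_degree t) = (\<Sum>v\<in>N. int k - (if v \<in> A then 1 else 0))"
            using k1 by (simp add: of_nat_diff if_distrib[of int] cong: if_cong)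
          also have "\<dots> = int k * int (card N) - int (card (A \<inter> N))"
            using finN by (simp add: sum_subtractf sum.If_cases Int_commute)
          finally show ?thesis .
        qed
        let ?U' = "colon_exponents V G' A' k"
        have "reg_le TYPE('k) V ?U r"
        proof (rule reg_le_cone[where x = x and ?U0.0 = "(+) t ` ?U'"])
          show "x \<in> V" using x(1) less.prems(2) by auto
          show "up_closed V ?U" by (rule up_closed_colon_exponents)
          show "up_closed V ((+) t ` ?U')" by (rule up_closed_translate[OF up_closed_colon_exponents tV])
          \<comment> \<open>Edges meeting N[x] contain a neighbour of \<open>x\<close>, where
            \<open>t\<close> alone suffices; the remaining edges are those of \<open>G'\<close>, and
            on them \<open>A'\<close> and \<open>A\<close> agree.\<close>
          show "(+) t ` ?U' \<subseteq> ?U"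
          proof
            fix m assume "m \<in> (+) t ` ?U'"
            then obtain m' where m: "m = t + m'" and m': "m' \<in> ?U'" by auto
            have "k \<le> (\<Sum>y\<in>e. Poly_Mapping.lookup m y) + card (e \<inter> A)" if e: "e \<in> edges G" for e
            proof (cases "e \<inter> insert x N = {}")
              case True
              then have "e \<in> edges G'" "e \<inter> A' = e \<inter> A" using e by (auto simp: E' A'_def)
              then have "k \<le> (\<Sum>y\<in>e. Poly_Mapping.lookup m' y) + card (e \<inter> A)"
                using m' by (auto simp: colon_exponents_def)
              then show ?thesis by (simp add: m lookup_add sum.distrib)
            next
              case False
              then obtain v where v: "v \<in> e" "v \<in> N"
                using edge_meets_nbhd[OF G e, of x] by (auto simp: N_def closed_nbhd_def)
              have "k - (if v \<in> A then 1 else 0) \<le> Poly_Mapping.lookup m v"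
                using v by (simp add: m lookup_add t_lookup)
              also have "\<dots> \<le> (\<Sum>y\<in>e. Poly_Mapping.lookup m y)"
                using v(1) fine[OF e] by (intro member_le_sum) auto
              finally have "k \<le> (\<Sum>y\<in>e. Poly_Mapping.lookup m y) + (if v \<in> A then 1 else 0)" by auto
              moreover have "(if v \<in> A then 1 else 0) \<le> card (e \<inter> A)"
                using v(1) fine[OF e] by (auto simp: Suc_le_eq card_gt_0_iff)
              ultimately show ?thesis by linarith
            qed
            moreover have "m \<in> monoms V" using m m' tV by (auto simp: monoms_add_iff colon_exponents_def)
            ultimately show "m \<in> ?U" by (simp add: colon_exponents_def)
          qed
          \<comment> \<open>Neither \<open>t\<close> nor any condition of \<open>G'\<close> involves
            \<open>x\<close>, so a factor \<open>x\<close> can be removed.\<close>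
          show "m \<in> (+) t ` ?U'" if m: "m \<in> monoms V" "Poly_Mapping.single x 1 + m \<in> (+) t ` ?U'" for m
          proof -
            obtain m' where m': "Poly_Mapping.single x 1 + m = t + m'" "m' \<in> ?U'" using m(2) by auto
            have l: "Poly_Mapping.lookup (Poly_Mapping.single x 1) y + Poly_Mapping.lookup m y
                = Poly_Mapping.lookup t y + Poly_Mapping.lookup m' y" for y
              using arg_cong[OF m'(1), of "\<lambda>p. Poly_Mapping.lookup p y"] by (simp only: lookup_add)
            have le: "Poly_Mapping.lookup t y \<le> Poly_Mapping.lookup m y" for y
              using l[of y] xN by (cases "y = x") (auto simp: t_lookup lookup_single when_def)
            have lk: "Poly_Mapping.lookup (m - t) y = Poly_Mapping.lookup m' y" if "y \<noteq> x" for y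
              using l[of y] that by (simp add: lookup_minus lookup_single when_def)
            have "(\<Sum>y\<in>e. Poly_Mapping.lookup (m - t) y) = (\<Sum>y\<in>e. Poly_Mapping.lookup m' y)"
              if "e \<in> edges G'" for e
              using that by (intro sum.cong refl lk) (auto simp: E')
            moreover have "m = t + (m - t)" by (rule nat_poly_mapping_le_add[OF le])
            moreover have "m - t \<in> monoms V" using m(1) calculation(2) monoms_add_iff by metis
            ultimately have "m - t \<in> ?U'" using m'(2) by (simp add: colon_exponents_def)
            then show ?thesis using \<open>m = t + (m - t)\<close> by blast
          qed
          show "m \<in> (+) t ` ?U'" if m: "m \<in> ?U" "x \<notin> Poly_Mapping.keys m" for m
          proof -
            have le: "Poly_Mapping.lookup t v \<le> Poly_Mapping.lookup m v" for v
            proof (cases "v \<in> N")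
              case True
              then have "{x, v} \<in> edges G" "v \<noteq> x" using xN by (auto simp: N_def nbhd_def)
              then have "k \<le> (\<Sum>y\<in>{x, v}. Poly_Mapping.lookup m y) + card ({x, v} \<inter> A)"
                using m(1) by (auto simp: colon_exponents_def simp del: sum.insert)
              moreover have "{x, v} \<inter> A = (if v \<in> A then {v} else {})" using x(2) by auto
              ultimately have "k \<le> Poly_Mapping.lookup m v + (if v \<in> A then 1 else 0)"
                using m(2) \<open>v \<noteq> x\<close> by (auto simp: in_keys_iff split: if_splits)
              then show ?thesis using True by (auto simp: t_lookup)
            qed (simp add: t_lookup)
            have eq: "m = t + (m - t)" by (rule nat_poly_mapping_le_add[OF le])
            have "k \<le> (\<Sum>y\<in>e. Poly_Mapping.lookup (m - t) y) + card (e \<inter> A')" if e: "e \<in> edges G'" for e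
            proof -
              have "e \<in> edges G" "e \<inter> N = {}" using e by (auto simp: E')
              then have "(\<Sum>y\<in>e. Poly_Mapping.lookup (m - t) y) = (\<Sum>y\<in>e. Poly_Mapping.lookup m y)"
                "e \<inter> A' = e \<inter> A"
                by (auto simp: lookup_minus t_lookup A'_def intro!: sum.cong)
              then show ?thesis using m(1) \<open>e \<in> edges G\<close> by (simp add: colon_exponents_def)
            qed
            moreover have "m - t \<in> monoms V"
              using m(1) eq monoms_add_iff[of t "m - t" V] by (simp add: colon_exponents_def)
            ultimately have "m - t \<in> ?U'" by (simp add: colon_exponents_def)
            then show ?thesis using eq by blast
          qed
          show "reg_le TYPE('k) V ((+) t ` ?U') r"
          proof -
            define n' where "n' = int (card (verts G'))"
            define D' where "D' = int (max_cover G')"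
            have cV: "n = n' + 1 + int (card N)"
            proof -
              have "card (verts G') = card (verts G) - card (insert x N)"
                unfolding V' using x(1) NV finN by (intro card_Diff_subset) auto
              moreover have "card (insert x N) \<le> card (verts G)" using x(1) NV finV by (intro card_mono) auto
              ultimately show ?thesis using finN xN by (simp add: n_def n'_def)
            qed
            have cA': "int (card A) = int (card A') + int (card (A \<inter> N))"
              using card_Int_Diff[OF finA, of N] by (simp add: A'_def)
            have A'V: "A' \<subseteq> verts G'" using less.prems(3) x(2) by (auto simp: A'_def V')
            have "card A' \<le> card (verts G')" using A'V finV by (intro card_mono) (auto simp: V')
            then have A'n: "int (card A') \<le> n'" by (simp add: n'_def)
            have DD: "D' + int (card N) \<le> D"
              using max_cover_delete[OF G x(1)] simple[OF G'H] by (simp add: G'_def D_def D'_def N_def)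
            have "card (verts G') < card (verts G)" using cV by (simp add: n_def n'_def)
            then have "reg_le TYPE('k) V ?U' (max 0 ((int k - 1) * D' + n' - 1 - int (card A')))"
              unfolding D'_def n'_def
              by (intro less.hyps) (use G'H A'V V' less.prems in auto)
            then have "reg_le TYPE('k) V ((+) t ` ?U')
                (max 0 ((int k - 1) * D' + n' - 1 - int (card A')) + int (monom_degree t))"
              by (rule reg_le_translate[OF _ tV])
            \<comment> \<open>The two inequalities serve the two cases of \<open>max\<close>. If the
              bound for \<open>G'\<close> is positive, the degree of \<open>t\<close> is paid for by
              \<open>D' + card N \<le> D\<close> and by the vertices removed. If it is 0, only the
              degree of \<open>t\<close> has to be covered, and \<open>card A' \<le> n'\<close>
              suffices for the rest.\<close>
            moreover have "(int k - 1) * (D' + int (card N)) \<le> (int k - 1) * D"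
              using k1 DD by (intro mult_left_mono) auto
            then have "(int k - 1) * D' + int k * int (card N) \<le> (int k - 1) * D + int (card N)"
              by (simp add: algebra_simps)
            moreover have "(int k - 1) * int (card N) \<le> (int k - 1) * D"
              using k1 DD by (intro mult_left_mono) (auto simp: D'_def)
            then have "int k * int (card N) \<le> (int k - 1) * D + int (card N)"
              by (simp add: algebra_simps)
            ultimately show ?thesis
              unfolding r t_deg using cV cA' A'n by (elim reg_le_mono) (auto simp: max_def)
          qed
          \<comment> \<open>Since \<open>x\<close> is not in \<open>A\<close>, one more factor
            \<open>x\<close> in the monomial counts exactly like putting \<open>x\<close> into
            \<open>A\<close>.\<close>
          have "{m \<in> monoms V. Poly_Mapping.single x 1 + m \<in> ?U} = colon_exponents V G (insert x A) k"
          proof -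
            have "(\<Sum>y\<in>e. Poly_Mapping.lookup (Poly_Mapping.single x 1 + m) y) + card (e \<inter> A)
                = (\<Sum>y\<in>e. Poly_Mapping.lookup m y) + card (e \<inter> insert x A)" if "e \<in> edges G" for e m
              using fine[OF that] x(2)
              by (cases "x \<in> e") (auto simp: lookup_add sum.distrib lookup_single when_def)
            then show ?thesis
              using single_in_monoms[of x V 1] x(1) less.prems(2)
              by (auto simp: colon_exponents_def monoms_add_iff)
          qed
          moreover have "reg_le TYPE('k) V (colon_exponents V G (insert x A) k)
            (max 0 ((int k - 1) * int (max_cover G) + int (card (verts G)) - 1 - int (card (insert x A))))"
          proof (rule less.hyps)
            have "card (verts G - insert x A) < card (verts G - A)"
              using x finV by (intro psubset_card_mono) auto
            then show "((card (verts G), k, card (verts G - insert x A)), (card (verts G), k, card (verts G - A)))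
                \<in> less_than <*lex*> less_than <*lex*> less_than" by simp
          qed (use x less.prems in auto)
          ultimately show "reg_le TYPE('k) V {m \<in> monoms V. Poly_Mapping.single x 1 + m \<in> ?U} (r - 1)"
            using x(2) finA r1 by (elim ssubst reg_le_mono) (auto simp: r n_def D_def)
        qed
        then show ?thesis .
      qed
    qed
  qed
  then show ?case by (simp add: r_def n_def D_def)
qed

theorem theorem3p2:
  fixes \<H> :: "'a ugraph set" and G :: "'a ugraph" and k :: nat
  assumes "\<And>G. G \<in> \<H> \<Longrightarrow> finite_simple_graph G"
    and "\<And>G x. G \<in> \<H> \<Longrightarrow> x \<in> verts G \<Longrightarrow> delete_verts G (closed_nbhd G x) \<in> \<H>"
    and "\<And>G. G \<in> \<H> \<Longrightarrow> \<nexists>x. isolated_vertex G x \<Longrightarrow>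
           \<exists>C. minimal_vertex_cover G C \<and> real (card C) \<ge> real (card (verts G)) / 2"
    and "G \<in> \<H>" and "verts G \<noteq> {}" and "k \<ge> 1"
  shows "int k * int (ideal_degree (verts G) (cover_ideal G :: ('a, 'k::field) mpoly set))
           \<le> regularity (verts G) (cover_ideal_symbolic_power G k :: ('a, 'k) mpoly set) \<and>
         regularity (verts G) (cover_ideal_symbolic_power G k :: ('a, 'k) mpoly set)
           \<le> (int k - 1) * int (ideal_degree (verts G) (cover_ideal G :: ('a, 'k) mpoly set))
              + int (card (verts G)) - 1"
proof -
  let ?V = "verts G" and ?D = "max_cover G"
  let ?U = "colon_exponents ?V G {} k"
  have G: "finite_simple_graph G" using assms(1,4) by blast
  have deg: "ideal_degree ?V (cover_ideal G :: ('a, 'k) mpoly set) = ?D"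
    unfolding max_cover_def by (rule ideal_degree_cover_ideal[OF G])
  have U: "cover_ideal_symbolic_power G k = (mono_ideal ?U :: ('a, 'k) mpoly set)"
    unfolding cover_ideal_symbolic_power_eq[OF G] by (simp add: colon_exponents_def)
  \<comment> \<open>A nonempty vertex set and \<open>k \<ge> 1\<close> make the bound nonnegative,
    so \<open>max 0\<close> disappears.\<close>
  have "card ?V \<ge> 1"
    using G assms(5) by (simp add: finite_simple_graph_def Suc_le_eq card_gt_0_iff)
  moreover have "0 \<le> (int k - 1) * int ?D" using assms(6) by simp
  moreover have "reg_le TYPE('k) ?V ?U (max 0 ((int k - 1) * int ?D + int (card ?V) - 1 - int (card ({} :: 'a set))))"
    using assms(1-4) by (intro reg_le_colon[of \<H>]) auto
  ultimately have reg: "reg_le TYPE('k) ?V ?U ((int k - 1) * int ?D + int (card ?V) - 1)"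
    by (elim reg_le_mono) simp
  obtain C where C: "minimal_vertex_cover G C" "card C = ?D" by (rule max_cover_attained[OF G])
  have finC: "finite C" by (rule minimal_vertex_cover_finite[OF G C(1)])
  have CV: "C \<subseteq> verts G" and cov: "\<And>e. e \<in> edges G \<Longrightarrow> e \<inter> C \<noteq> {}"
    and minC: "\<And>C'. C' \<subset> C \<Longrightarrow> \<not> vertex_cover G C'"
    using C(1) unfolding minimal_vertex_cover_def vertex_cover_def by blast+
  have fine: "finite e" if "e \<in> edges G" for e
    using that G by (auto simp: finite_simple_graph_def intro: card_ge_0_finite)
  \<comment> \<open>Taking \<open>C\<close> of largest size makes the degree of this generator equal
    to k deg(J(G)).\<close>
  define m where "m = (\<Sum>x\<in>C. Poly_Mapping.single x k)"
  have m: "Poly_Mapping.lookup m x = (if x \<in> C then k else 0)" for x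
    using finC by (simp add: m_def lookup_sum lookup_single when_def)
  have keys: "Poly_Mapping.keys m \<subseteq> C" by (auto simp: in_keys_iff m split: if_splits)
  have mdeg: "monom_degree m = k * ?D"
    using monom_degree_eq_sum[OF finC keys] C(2) by (simp add: m)
  have "k \<le> (\<Sum>y\<in>e. Poly_Mapping.lookup m y)" if e: "e \<in> edges G" for e
  proof -
    obtain v where "v \<in> e" "v \<in> C" using cov[OF e] by blast
    then have "k = Poly_Mapping.lookup m v" by (simp add: m)
    also have "\<dots> \<le> (\<Sum>y\<in>e. Poly_Mapping.lookup m y)" using \<open>v \<in> e\<close> fine[OF e] by (intro member_le_sum) auto
    finally show ?thesis .
  qed
  then have mU: "m \<in> ?U"
    using keys CV by (auto simp: colon_exponents_def monoms_def)
  have "t = 0" if m': "m' \<in> ?U" and eq: "m = m' + t" for m' t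
  proof (rule ccontr)
    assume "t \<noteq> 0"
    then obtain x where x: "Poly_Mapping.lookup t x \<noteq> 0" by (auto simp: poly_mapping_eq_iff fun_eq_iff)
    have l: "Poly_Mapping.lookup m' y + Poly_Mapping.lookup t y = (if y \<in> C then k else 0)" for y
      using m[of y] by (simp add: eq lookup_add)
    have "x \<in> C" using l[of x] x by (auto split: if_splits)
    \<comment> \<open>Minimality of \<open>C\<close> gives an edge that meets \<open>C\<close> only
      in \<open>x\<close>. On it \<open>m\<close> has total exponent exactly \<open>k\<close>, so
      nothing can be divided out at \<open>x\<close>.\<close>
    then have "\<not> vertex_cover G (C - {x})" by (intro minC) auto
    then obtain e where e: "e \<in> edges G" "e \<inter> (C - {x}) = {}"
      using CV unfolding vertex_cover_def by blast
    then have "x \<in> e" using cov[OF e(1)] by blast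
    then obtain y where y: "e = {x, y}" "y \<noteq> x" using edgeE[OF G e(1)] by metis
    then have "y \<notin> C" using e(2) by auto
    have "k \<le> Poly_Mapping.lookup m' x + Poly_Mapping.lookup m' y"
      using m' e(1) y by (auto simp: colon_exponents_def)
    then show False using l[of x] l[of y] x \<open>y \<notin> C\<close> \<open>x \<in> C\<close> by simp
  qed
  note bounds = regularity_bounds[OF up_closed_colon_exponents reg mU this]
  then show ?thesis unfolding deg U by (simp add: mdeg)
qed

end
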